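(* Let $\beta\ge0$ be fixed, let $\boldsymbol a=(a_0,a_1)$ be the true parameter, and let $\hat{\boldsymbol a}^\beta=(\hat a_0^\beta,\hat a_1^\beta)$ be the MDPDE with tuning parameter $\beta$ (the MLE if $\beta=0$), assumed consistent under the standard regularity conditions. Then $$\sqrt N\big((\hat a_0^\beta,\hat a_1^\beta)^\top-(a_0,a_1)^\top\big)\xrightarrow[N\to\infty]{\mathcal L}\mathcal N\big(0,\;\boldsymbol J_\beta(\boldsymbol a)^{-1}\boldsymbol K_\beta(\boldsymbol a)\boldsymbol J_\beta(\boldsymbol a)^{-1}\big),$$ where, for $\gamma\ge0$, $$\boldsymbol J_\gamma(\boldsymbol a)=\begin{pmatrix}J_\gamma(a_0)&J_\gamma(a_0,a_1)\\ J_\gamma(a_0,a_1)&J_\gamma(a_1)\end{pmatrix},\qquad \boldsymbol K_\beta(\boldsymbol a)=\boldsymbol J_{2\beta}(\boldsymbol a)-\boldsymbol\xi_\beta^\top\boldsymbol\xi_\beta,\quad \boldsymbol\xi_\beta=(\xi_\beta(a_0),\xi_\beta(a_1)),$$ with $$J_\gamma(a_0)=B(\gamma)+\frac{E(\gamma)}{\lambda_2^\gamma}\Big[\frac{L^2A_0(\gamma)}{\gamma+1}+\frac{A_2(\gamma)}{(\gamma+1)^3}+\frac{2LA_1(\gamma)}{(\gamma+1)^2}\Big]+\Big(\frac{\tau_2+h}{\lambda_2}\Big)^2S(\gamma),$$ $$J_\gamma(a_1)=x_1^2B(\gamma)+\frac{E(\gamma)}{\lambda_2^\gamma}\Big[\frac{(L^*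 )^2A_0(\gamma)}{\gamma+1}+\frac{x_2^2A_2(\gamma)}{(\gamma+1)^3}+\frac{2L^*x_2A_1(\gamma)}{(\gamma+1)^2}\Big]+D^2S(\gamma),$$ $$J_\gamma(a_0,a_1)=x_1B(\gamma)+\frac{E(\gamma)}{\lambda_2^\gamma}\Big[\frac{LL^*A_0(\gamma)}{\gamma+1}+\frac{x_2A_2(\gamma)}{(\gamma+1)^3}+\frac{(L^*+x_2L)A_1(\gamma)}{(\gamma+1)^2}\Big]+D\,\frac{\tau_2+h}{\lambda_2}S(\gamma),$$ $$\xi_\beta(a_0)=M(\beta)+\frac{E(\beta)}{\lambda_2^\beta}\Big[\frac{LA_0(\beta)}{\beta+1}+\frac{A_1(\beta)}{(\beta+1)^2}\Big]+\frac{\tau_2+h}{\lambda_2}S(\beta),$$ $$\xi_\beta(a_1)=x_1M(\beta)+\frac{E(\beta)}{\lambda_2^\beta}\Big[\frac{L^*A_0(\beta)}{\beta+1}+\frac{x_2A_1(\beta)}{(\beta+1)^2}\Big]+D\,S(\beta).$$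
   Context: Simple step-stress accelerated life test with Type-I censoring, exponential lifetimes and the cumulative exposure model. Fix stress levels $x_1,x_2\in\mathbb R$, times $0<\tau_1<\tau_2$. Parameters $(a_0,a_1)\in\mathbb R\times(-\infty,0)$; $\lambda_i=\exp(a_0+a_1x_i)$, $\boldsymbol\lambda=(\lambda_1,\lambda_2)$, $h=\frac{\lambda_2}{\lambda_1}\tau_1-\tau_1$. Write $f_1(t|\lambda_1)=\frac1{\lambda_1}e^{-t/\lambda_1}$, $f_2(t+h|\boldsymbol\lambda)=\frac1{\lambda_2}e^{-(t+h)/\lambda_2}$, $1-F_2(\tau_2+h|\boldsymbol\lambda)=e^{-(\tau_2+h)/\lambda_2}$. A unit's lifetime has density $f_1$ on $[0,\tau_1)$ and $f_2(t+h|\boldsymbol\lambda)$ on $[\tau_1,\infty)$. $N$ units with i.i.d. lifetimes are tested until $\tau_2$; $n_1,n_2$ are the numbers of failures in $[0,\tau_1)$, $[\tau_1,\tau_2)$, with failure times $t_1<\dots<t_{n_1}<\tau_1\le t_{n_1+1}<\dots<t_{n_1+n_2}<\tau_2$. For $\beta>0$ the MDPDE minimizes over $\mathbb R\times(-\infty,0)$ the DPD loss $H_N^\beta(a_0,a_1)=\int_0^{\tau_1}f_1^{\beta+1}dt+\int_{\tau_1}^{\tau_2}f_2(t+h|\boldsymbol\lambda)^{\beta+1}dt+(1-F_2(\tau_2+h|\boldsymbol\lambda))^{\beta+1}-\frac{\beta+1}{\beta N}\{\sum_{i=1}^{n_1}f_1(t_i|\lambda_1)^\beta+\sum_{i=n_1+1}^{n_1+n_2}f_2(t_i+h|\boldsymbol\lambda)^\beta+(N-n_1-n_2)(1-F_2(\tau_2+h|\boldsymbol\lambda))^\beta\}$;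 for $\beta=0$ it is the MLE, maximizing $\ell(a_0,a_1)=-n_1\log\lambda_1-n_2\log\lambda_2-\sum_{i=1}^{n_1}\frac{t_i}{\lambda_1}-\sum_{i=n_1+1}^{n_1+n_2}\frac{t_i+h}{\lambda_2}-(N-n_1-n_2)\frac{\tau_2+h}{\lambda_2}$. Notation (at the true parameter), for $\gamma\ge0$: $L=-1-\frac{\tau_1}{\lambda_2}+\frac{\tau_1}{\lambda_1}$; $L^*=-x_2-\frac{\tau_1}{\lambda_2}x_2+\frac{\tau_1}{\lambda_1}x_1$; $D=\frac{\tau_2}{\lambda_2}x_2+\frac{\tau_1}{\lambda_1}x_1-\frac{\tau_1}{\lambda_2}x_2$; $c(\gamma)=\frac{\tau_1(\gamma+1)}{\lambda_1}$; $E(\gamma)=\exp(-\frac{h(\gamma+1)}{\lambda_2})$; $S(\gamma)=\exp(-\frac{(\tau_2+h)(\gamma+1)}{\lambda_2})$; with $d_k=\frac{\tau_k(\gamma+1)}{\lambda_2}$: $A_0(\gamma)=e^{-d_1}-e^{-d_2}$, $A_1(\gamma)=e^{-d_1}(d_1+1)-e^{-d_2}(d_2+1)$, $A_2(\gamma)=e^{-d_1}(d_1^2+2d_1+2)-e^{-d_2}(d_2^2+2d_2+2)$; $B(\gamma)=\frac{1}{\lambda_1^\gamma(\gamma+1)}\Big[e^{-c(\gamma)}\Big(-1-\frac{c(\gamma)^2+2c(\gamma)+2}{(\gamma+1)^2}+\frac{2(c(\gamma)+1)}{\gamma+1}\Big)+1+\frac{2}{(\gamma+1)^2}-\frac{2}{\gamma+1}\Big]$;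 $M(\beta)=-\frac{1-e^{-c(\beta)}}{\lambda_1^\beta(\beta+1)}+\frac{1-e^{-c(\beta)}(c(\beta)+1)}{\lambda_1^\beta(\beta+1)^2}$. *)

theory Defs
  imports "HOL-Probability.Probability"
begin

section \<open>Model: simple step-stress ALT, exponential lifetimes, cumulative exposure\<close>

text \<open>Mean lifetime at stress x: lambda = exp(a0 + a1 x).\<close>
definition lam :: "real \<Rightarrow> real \<Rightarrow> real \<Rightarrow> real" where
  "lam a0 a1 x = exp (a0 + a1 * x)"

definition hsh :: "real \<Rightarrow> real \<Rightarrow> real \<Rightarrow> real" where
  "hsh l1 l2 tau1 = l2 / l1 * tau1 - tau1"

definition f1 :: "real \<Rightarrow> real \<Rightarrow> real" where
  "f1 l1 t = 1 / l1 * exp (- t / l1)"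

definition f2 :: "real \<Rightarrow> real \<Rightarrow> real \<Rightarrow> real" where
  "f2 l2 h t = 1 / l2 * exp (- (t + h) / l2)"

definition surv :: "real \<Rightarrow> real \<Rightarrow> real \<Rightarrow> real" where
  "surv l2 h tau2 = exp (- (tau2 + h) / l2)"

definition life_dens :: "real \<Rightarrow> real \<Rightarrow> real \<Rightarrow> real \<Rightarrow> real \<Rightarrow> real \<Rightarrow> real" where
  "life_dens x1 x2 tau1 a0 a1 t =
     (let l1 = lam a0 a1 x1; l2 = lam a0 a1 x2; h = hsh l1 l2 tau1 in
      if t < 0 then 0 else if t < tau1 then f1 l1 t else f2 l2 h t)"

text \<open>DPD loss H_N^beta(b0,b1) for sample size N and lifetimes t 0, ..., t (N-1)
  (Type-I censored at tau2).\<close>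
definition dpd_loss ::
  "real \<Rightarrow> real \<Rightarrow> real \<Rightarrow> real \<Rightarrow> real \<Rightarrow> nat \<Rightarrow> (nat \<Rightarrow> real) \<Rightarrow> real \<Rightarrow> real \<Rightarrow> real" where
  "dpd_loss beta x1 x2 tau1 tau2 N t b0 b1 =
     (let l1 = lam b0 b1 x1; l2 = lam b0 b1 x2; h = hsh l1 l2 tau1 in
        integral {0..tau1} (\<lambda>s. f1 l1 s powr (beta + 1))
      + integral {tau1..tau2} (\<lambda>s. f2 l2 h s powr (beta + 1))
      + surv l2 h tau2 powr (beta + 1)
      - (beta + 1) / (beta * real N) *
          ((\<Sum>i\<in>{i. i < N \<and> t i < tau1}. f1 l1 (t i) powr beta)
         + (\<Sum>i\<in>{i. i < N \<and> tau1 \<le> t i \<and> t i < tau2}. f2 l2 h (t i) powr beta)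
         + real (card {i. i < N \<and> tau2 \<le> t i}) * surv l2 h tau2 powr beta))"

definition loglik ::
  "real \<Rightarrow> real \<Rightarrow> real \<Rightarrow> real \<Rightarrow> nat \<Rightarrow> (nat \<Rightarrow> real) \<Rightarrow> real \<Rightarrow> real \<Rightarrow> real" where
  "loglik x1 x2 tau1 tau2 N t b0 b1 =
     (let l1 = lam b0 b1 x1; l2 = lam b0 b1 x2; h = hsh l1 l2 tau1;
          n1 = card {i. i < N \<and> t i < tau1};
          n2 = card {i. i < N \<and> tau1 \<le> t i \<and> t i < tau2} in
        - real n1 * ln l1 - real n2 * ln l2
      - (\<Sum>i\<in>{i. i < N \<and> t i < tau1}. t i / l1)
      - (\<Sum>i\<in>{i. i < N \<and> tau1 \<le> t i \<and> t i < tau2}. (t i + h) / l2)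
      - real (N - n1 - n2) * (tau2 + h) / l2)"

definition is_mdpde ::
  "real \<Rightarrow> real \<Rightarrow> real \<Rightarrow> real \<Rightarrow> real \<Rightarrow> nat \<Rightarrow> (nat \<Rightarrow> real) \<Rightarrow> real^2 \<Rightarrow> bool" where
  "is_mdpde beta x1 x2 tau1 tau2 N t b \<longleftrightarrow>
     b$2 < 0 \<and>
     (if beta = 0
      then (\<forall>c0 c1. c1 < 0 \<longrightarrow> loglik x1 x2 tau1 tau2 N t c0 c1 \<le> loglik x1 x2 tau1 tau2 N t (b$1) (b$2))
      else (\<forall>c0 c1. c1 < 0 \<longrightarrow> dpd_loss beta x1 x2 tau1 tau2 N t (b$1) (b$2) \<le> dpd_loss beta x1 x2 tau1 tau2 N t c0 c1))"

definition Bf :: "real \<Rightarrow> real \<Rightarrow> real \<Rightarrow> real" where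
  "Bf l1 tau1 g = (let c = tau1 * (g + 1) / l1 in
     1 / (l1 powr g * (g + 1)) *
       (exp (- c) * (- 1 - (c^2 + 2*c + 2) / (g + 1)^2 + 2 * (c + 1) / (g + 1))
        + 1 + 2 / (g + 1)^2 - 2 / (g + 1)))"

definition Mf :: "real \<Rightarrow> real \<Rightarrow> real \<Rightarrow> real" where
  "Mf l1 tau1 b = (let c = tau1 * (b + 1) / l1 in
     - (1 - exp (- c)) / (l1 powr b * (b + 1))
     + (1 - exp (- c) * (c + 1)) / (l1 powr b * (b + 1)^2))"

definition A0 :: "real \<Rightarrow> real \<Rightarrow> real \<Rightarrow> real \<Rightarrow> real" where
  "A0 l2 tau1 tau2 g = (let d1 = tau1 * (g + 1) / l2; d2 = tau2 * (g + 1) / l2 in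
     exp (- d1) - exp (- d2))"

definition A1 :: "real \<Rightarrow> real \<Rightarrow> real \<Rightarrow> real \<Rightarrow> real" where
  "A1 l2 tau1 tau2 g = (let d1 = tau1 * (g + 1) / l2; d2 = tau2 * (g + 1) / l2 in
     exp (- d1) * (d1 + 1) - exp (- d2) * (d2 + 1))"

definition A2 :: "real \<Rightarrow> real \<Rightarrow> real \<Rightarrow> real \<Rightarrow> real" where
  "A2 l2 tau1 tau2 g = (let d1 = tau1 * (g + 1) / l2; d2 = tau2 * (g + 1) / l2 in
     exp (- d1) * (d1^2 + 2*d1 + 2) - exp (- d2) * (d2^2 + 2*d2 + 2))"

definition Jmat :: "real \<Rightarrow> real \<Rightarrow> real \<Rightarrow> real \<Rightarrow> real \<Rightarrow> real \<Rightarrow> real \<Rightarrow> real^2^2" where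
  "Jmat x1 x2 tau1 tau2 a0 a1 g =
     (let l1 = lam a0 a1 x1; l2 = lam a0 a1 x2; h = hsh l1 l2 tau1;
          L = - 1 - tau1 / l2 + tau1 / l1;
          Ls = - x2 - tau1 / l2 * x2 + tau1 / l1 * x1;
          D = tau2 / l2 * x2 + tau1 / l1 * x1 - tau1 / l2 * x2;
          E = exp (- h * (g + 1) / l2);
          S = exp (- (tau2 + h) * (g + 1) / l2);
          B = Bf l1 tau1 g;
          a0' = A0 l2 tau1 tau2 g; a1' = A1 l2 tau1 tau2 g; a2' = A2 l2 tau1 tau2 g;
          J00 = B + E / l2 powr g * (L^2 * a0' / (g + 1) + a2' / (g + 1)^3 + 2 * L * a1' / (g + 1)^2)
                + ((tau2 + h) / l2)^2 * S;
          J11 = x1^2 * B + E / l2 powr g * (Ls^2 * a0' / (g + 1) + x2^2 * a2' / (g + 1)^3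
                + 2 * Ls * x2 * a1' / (g + 1)^2) + D^2 * S;
          J01 = x1 * B + E / l2 powr g * (L * Ls * a0' / (g + 1) + x2 * a2' / (g + 1)^3
                + (Ls + x2 * L) * a1' / (g + 1)^2) + D * ((tau2 + h) / l2) * S
      in vector [vector [J00, J01], vector [J01, J11]])"

definition xivec :: "real \<Rightarrow> real \<Rightarrow> real \<Rightarrow> real \<Rightarrow> real \<Rightarrow> real \<Rightarrow> real \<Rightarrow> real^2" where
  "xivec x1 x2 tau1 tau2 a0 a1 b =
     (let l1 = lam a0 a1 x1; l2 = lam a0 a1 x2; h = hsh l1 l2 tau1;
          L = - 1 - tau1 / l2 + tau1 / l1;
          Ls = - x2 - tau1 / l2 * x2 + tau1 / l1 * x1;
          D = tau2 / l2 * x2 + tau1 / l1 * x1 - tau1 / l2 * x2;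
          E = exp (- h * (b + 1) / l2);
          S = exp (- (tau2 + h) * (b + 1) / l2);
          M = Mf l1 tau1 b;
          a0' = A0 l2 tau1 tau2 b; a1' = A1 l2 tau1 tau2 b;
          xi0 = M + E / l2 powr b * (L * a0' / (b + 1) + a1' / (b + 1)^2) + (tau2 + h) / l2 * S;
          xi1 = x1 * M + E / l2 powr b * (Ls * a0' / (b + 1) + x2 * a1' / (b + 1)^2) + D * S
      in vector [xi0, xi1])"

text \<open>K_beta = J_{2 beta} - xi^T xi (xi a row vector, so xi^T xi is the outer product).\<close>
definition Kmat :: "real \<Rightarrow> real \<Rightarrow> real \<Rightarrow> real \<Rightarrow> real \<Rightarrow> real \<Rightarrow> real \<Rightarrow> real^2^2" where
  "Kmat x1 x2 tau1 tau2 a0 a1 b =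
     Jmat x1 x2 tau1 tau2 a0 a1 (2 * b)
     - (\<chi> i j. xivec x1 x2 tau1 tau2 a0 a1 b $ i * xivec x1 x2 tau1 tau2 a0 a1 b $ j)"

definition Sigma_mdpde :: "real \<Rightarrow> real \<Rightarrow> real \<Rightarrow> real \<Rightarrow> real \<Rightarrow> real \<Rightarrow> real \<Rightarrow> real^2^2" where
  "Sigma_mdpde x1 x2 tau1 tau2 a0 a1 b =
     matrix_inv (Jmat x1 x2 tau1 tau2 a0 a1 b) ** Kmat x1 x2 tau1 tau2 a0 a1 b
       ** matrix_inv (Jmat x1 x2 tau1 tau2 a0 a1 b)"

text \<open>Centred bivariate normal distribution N(0, Sigma) (Sigma positive definite), via its density.\<close>
definition normal2 :: "real^2^2 \<Rightarrow> (real^2) measure" where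
  "normal2 Sig = density lborel
     (\<lambda>v. ennreal (exp (- (v \<bullet> (matrix_inv Sig *v v)) / 2) / (2 * pi * sqrt (det Sig))))"

definition conv_in_law :: "'a measure \<Rightarrow> (nat \<Rightarrow> 'a \<Rightarrow> real^2) \<Rightarrow> (real^2) measure \<Rightarrow> bool" where
  "conv_in_law M X mu \<longleftrightarrow>
     (\<forall>g :: real^2 \<Rightarrow> real. continuous_on UNIV g \<and> bounded (range g) \<longrightarrow>
        (\<lambda>N. integral\<^sup>L M (\<lambda>\<omega>. g (X N \<omega>))) \<longlonglongrightarrow> integral\<^sup>L mu g)"

definition conv_in_prob :: "'a measure \<Rightarrow> (nat \<Rightarrow> 'a \<Rightarrow> real^2) \<Rightarrow> real^2 \<Rightarrow> bool" where
  "conv_in_prob M X c \<longleftrightarrow>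
     (\<forall>e>0. (\<lambda>N. measure M {\<omega> \<in> space M. e < dist (X N \<omega>) c}) \<longlonglongrightarrow> 0)"

end

theory Submission
  imports Defs
begin

text \<open>Reparametrize by the failure rates. With respect to Lebesgue measure on \<open>[0, tau2)\<close> plus a unit
  mass at \<open>tau2\<close>, the logarithm of the density of a censored lifetime is affine in functions of
  the observation with coefficients that are smooth in the parameter. Everything is bounded, so
  all first-order expansions in the parameter hold uniformly in the observation and may be integrated.
  For \<open>\<beta> = 0\<close> and \<open>\<beta> > 0\<close> alike, an interior extremum is a zero of the empirical mean of
  \<open>\<psi> = \<xi> - u g\<^sup>\<beta>\<close>, where \<open>g\<close> is the density and \<open>u\<close> its score. At the truth \<open>\<psi>\<close> is centred with covariance
  \<open>K\<close>, and its derivative has mean \<open>J\<close>. A linearization at a consistent sequence of zeros, Hoeffding's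
  inequality and the one-dimensional central limit theorem give the limit of the characteristic functions.

  Consistency says nothing when there is no minimizer, so one must also show that a minimizer exists
  with probability tending to one. The MLE is explicit. For \<open>\<beta> > 0\<close> the loss extends continuously
  to rates equal to zero and is coercive for almost every sample, hence attains its infimum on the closed cone
  of admissible rates. On the boundary of that cone it exceeds its value at the truth with probability
  tending to one: on a compact part by a uniform law of large numbers and the strict positivity of
  the density power divergence, and far out because few lifetimes lie near \<open>0\<close> and \<open>tau1\<close>.\<close>

section \<open>Convergence in law in the plane from trigonometric test functions\<close>

text \<open>Cumulative exposure gives hazard 1/lambda1 before \<open>tau1\<close> and 1/lambda2
  after it; the shift \<open>hsh\<close> keeps the cumulative hazard continuous at
  \<open>tau1\<close>. In terms of the rates this hazard is \<open>m1 * X t + m2 * Y t\<close>,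
  where \<open>X\<close> and \<open>Y\<close> are the times spent in the two phases, and the shift
  disappears once the density is rewritten in this way.

  The hard point is existence. The constraint a1 < 0 describes an open cone of rates, so a
  minimizing sequence may approach a zero rate, equal rates or infinity. At infinity the gain of the
  second phase carries the factor \<open>exp (- (m1 * tau1))\<close>, which can fall below the share
  of failures just after \<open>tau1\<close>, and then the lower bound is useless. For a single
  sample without failures at 0 and \<open>tau1\<close> a radius depending on the sample cures this.
  A radius common to most samples is obtained only on the boundary of the cone, where m1 = 0, m2 = 0
  or m1 = m2 makes that factor harmless, and only there is it required.

  The set of samples that admit a minimizer is not visibly measurable, hence the use of inner
  probabilities.\<close>

lemma inner_real2: "(v::real^2) \<bullet> w = v$1 * w$1 + v$2 * w$2"
  by (simp add: inner_vec_def sum_2)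

lemma norm_real2_le: "norm (v::real^2) \<le> \<bar>v$1\<bar> + \<bar>v$2\<bar>"
  using norm_le_l1_cart[of v] by (simp add: sum_2)

text \<open>Trigonometric polynomials with arbitrary real frequencies. The phase \<open>c\<close>
  covers the sines, so the product-to-sum formula stays within a single kind of summand.\<close>

inductive trig_sum :: "(real^2 \<Rightarrow> real) \<Rightarrow> bool" where
  trig_cos: "trig_sum (\<lambda>x. a * cos (v \<bullet> x + c))"
| trig_add: "trig_sum f \<Longrightarrow> trig_sum g \<Longrightarrow> trig_sum (\<lambda>x. f x + g x)"

lemma trig_sum_const: "trig_sum (\<lambda>x. c)"
  using trig_cos[of c 0 0] by simp

lemma trig_sum_cos_mult:
  assumes "trig_sum g"
  shows "trig_sum (\<lambda>x. a * cos (v \<bullet> x + c) * g x)"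
  using assms
proof (induction)
  case (trig_cos a' v' c')
  have "(\<lambda>x. a * cos (v \<bullet> x + c) * (a' * cos (v' \<bullet> x + c'))) =
     (\<lambda>x. a * a' / 2 * cos ((v - v') \<bullet> x + (c - c')) + a * a' / 2 * cos ((v + v') \<bullet> x + (c + c')))"
  proof
    fix x
    have "cos (v \<bullet> x + c) * cos (v' \<bullet> x + c') =
        (cos ((v - v') \<bullet> x + (c - c')) + cos ((v + v') \<bullet> x + (c + c'))) / 2"
      by (subst cos_times_cos) (simp add: inner_simps algebra_simps)
    then have "a * a' * (cos (v \<bullet> x + c) * cos (v' \<bullet> x + c')) =
        a * a' * ((cos ((v - v') \<bullet> x + (c - c')) + cos ((v + v') \<bullet> x + (c + c'))) / 2)"
      by (simp only:)
    then show "a * cos (v \<bullet> x + c) * (a' * cos (v' \<bullet> x + c')) =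
      a * a' / 2 * cos ((v - v') \<bullet> x + (c - c')) + a * a' / 2 * cos ((v + v') \<bullet> x + (c + c'))"
      by (simp only: distrib_left add_divide_distrib times_divide_eq_right times_divide_eq_left mult_ac)
  qed
  then show ?case by (simp only:) (intro trig_sum.intros)
next
  case (trig_add f g)
  then show ?case by (simp add: distrib_left trig_sum.intros)
qed

lemma trig_sum_mult:
  assumes "trig_sum f" "trig_sum g"
  shows "trig_sum (\<lambda>x. f x * g x)"
  using assms
  by (induction) (auto simp: distrib_right intro: trig_sum_cos_mult trig_sum.intros)

lemma trig_sum_real_polynomial:
  fixes p :: "real \<times> real \<Rightarrow> real"
  assumes "real_polynomial_function p"
  shows "trig_sum (\<lambda>x. p (cos (k * (x$1 + R)), cos (k * (x$2 + R))))"
  using assms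
proof (induction)
  case (linear f)
  have *: "f (a, b) = f (1, 0) * a + f (0, 1) * b" for a b
  proof -
    have "f (a, b) = f (a *\<^sub>R (1, 0) + b *\<^sub>R (0, 1))" by simp
    also have "\<dots> = f (1, 0) * a + f (0, 1) * b"
      using linear by (simp only: linear_simps) simp
    finally show ?thesis .
  qed
  have "trig_sum (\<lambda>x. f (1, 0) * cos ((k *\<^sub>R axis 1 1) \<bullet> x + k * R)
         + f (0, 1) * cos ((k *\<^sub>R axis 2 1) \<bullet> x + k * R))"
    by (intro trig_sum.intros)
  then show ?case by (subst *) (simp add: inner_axis' algebra_simps)
qed (auto intro: trig_sum.intros trig_sum_const trig_sum_mult)

lemma trig_sum_measurable: "trig_sum f \<Longrightarrow> f \<in> borel_measurable borel"
  by (induction rule: trig_sum.induct) measurable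

lemma trig_sum_bounded: "trig_sum f \<Longrightarrow> \<exists>C. \<forall>x. \<bar>f x\<bar> \<le> C"
proof (induction rule: trig_sum.induct)
  case (trig_cos a v c)
  have "\<bar>a * cos (v \<bullet> x + c)\<bar> \<le> \<bar>a\<bar>" for x
    by (simp add: abs_mult mult_left_le)
  then show ?case by blast
next
  case (trig_add f g)
  then obtain C D where "\<forall>x. \<bar>f x\<bar> \<le> C" "\<forall>x. \<bar>g x\<bar> \<le> D" by auto
  then have "\<forall>x. \<bar>f x + g x\<bar> \<le> C + D"
    by (meson abs_triangle_ineq add_mono order_trans)
  then show ?case by blast
qed

text \<open>The substitution \<open>c = cos (\<pi> (s + R) / (2 R))\<close> carries \<open>[-R, R]\<close> bijectively onto
  \<open>[-1, 1]\<close> and maps the whole line into \<open>[-1, 1]\<close>, so that a polynomial approximation on the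
  square automatically stays bounded outside of the box.\<close>
lemma trig_sum_approx:
  fixes g :: "real^2 \<Rightarrow> real"
  assumes g: "continuous_on UNIV g" and B: "\<And>x. \<bar>g x\<bar> \<le> B" and R: "R > 0" and e: "e > 0"
  obtains p where "trig_sum p" "\<And>x. \<bar>p x\<bar> \<le> B + e"
    "\<And>x. \<bar>x$1\<bar> \<le> R \<Longrightarrow> \<bar>x$2\<bar> \<le> R \<Longrightarrow> \<bar>g x - p x\<bar> \<le> e"
proof -
  define w where "w c = 2 * R / pi * arccos c - R" for c
  define h where "h = (\<lambda>(c, d). g (vector [w c, w d]))"
  let ?S = "cbox (-1, -1) (1, 1) :: (real \<times> real) set"
  have S: "?S = {-1..1} \<times> {-1..1}" by (simp add: cbox_Pair_eq)
  have w: "continuous_on {-1..1} w"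
    unfolding w_def by (intro continuous_intros continuous_on_arccos')
  have "continuous_on ?S (\<lambda>z. vector [w (fst z), w (snd z)] :: real^2)"
  proof -
    have *: "(\<lambda>z. vector [w (fst z), w (snd z)] :: real^2) = (\<lambda>z. w (fst z) *\<^sub>R axis 1 1 + w (snd z) *\<^sub>R axis 2 1)"
      by (auto simp: vec_eq_iff forall_2 axis_def)
    show "continuous_on ?S (\<lambda>z. vector [w (fst z), w (snd z)] :: real^2)"
      unfolding * S
      by (intro continuous_intros continuous_on_compose2[OF w]) auto
  qed
  then have "continuous_on ?S h"
    unfolding h_def case_prod_beta
    by (intro continuous_on_compose2[OF g]) auto
  then obtain q where q: "real_polynomial_function q" and qh: "\<And>z. z \<in> ?S \<Longrightarrow> \<bar>h z - q z\<bar> < e"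
    using Stone_Weierstrass_real_polynomial_function[OF compact_cbox _ e] by blast
  define k where "k = pi / (2 * R)"
  define p where "p x = q (cos (k * (x$1 + R)), cos (k * (x$2 + R)))" for x :: "real^2"
  show thesis
  proof
    show "trig_sum p" unfolding p_def by (rule trig_sum_real_polynomial[OF q])
    have mem: "(cos (k * (x$1 + R)), cos (k * (x$2 + R))) \<in> ?S" for x :: "real^2"
      by (simp add: S)
    show "\<bar>p x\<bar> \<le> B + e" for x
    proof -
      have "\<bar>h (cos (k * (x$1 + R)), cos (k * (x$2 + R)))\<bar> \<le> B"
        unfolding h_def by (simp add: B)
      with qh[OF mem[of x]] show ?thesis unfolding p_def by linarith
    qed
    have inv: "w (cos (k * (s + R))) = s" if "\<bar>s\<bar> \<le> R" for s
    proof -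
      have "arccos (cos (k * (s + R))) = k * (s + R)"
      proof (rule arccos_cos)
        have "0 \<le> s + R" "s + R \<le> 2 * R" using that by auto
        moreover have "k > 0" "pi = k * (2 * R)" using R by (auto simp: k_def)
        ultimately show "0 \<le> k * (s + R)" "k * (s + R) \<le> pi"
          by (metis mult_nonneg_nonneg less_imp_le, metis mult_left_mono less_imp_le)
      qed
      then show ?thesis using R by (simp add: w_def k_def)
    qed
    show "\<bar>g x - p x\<bar> \<le> e" if "\<bar>x$1\<bar> \<le> R" "\<bar>x$2\<bar> \<le> R" for x
    proof -
      have "vector [x$1, x$2] = x" by (simp add: vec_eq_iff forall_2)
      then have "h (cos (k * (x$1 + R)), cos (k * (x$2 + R))) = g x"
        using that by (simp add: h_def inv)
      with qh[OF mem[of x]] show ?thesis unfolding p_def by simp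
    qed
  qed
qed

lemma (in prob_space) expectation_diff_le:
  fixes f g :: "'a \<Rightarrow> real"
  assumes [measurable]: "f \<in> borel_measurable M" "g \<in> borel_measurable M" and A: "A \<in> events"
    and f: "\<And>\<omega>. \<omega> \<in> space M \<Longrightarrow> \<bar>f \<omega>\<bar> \<le> B" and g: "\<And>\<omega>. \<omega> \<in> space M \<Longrightarrow> \<bar>g \<omega>\<bar> \<le> B'"
    and fg: "\<And>\<omega>. \<omega> \<in> A \<Longrightarrow> \<bar>f \<omega> - g \<omega>\<bar> \<le> e" and e: "e \<ge> 0"
  shows "\<bar>expectation f - expectation g\<bar> \<le> e + (B + B') * (1 - prob A)"
proof -
  have nn: "B \<ge> 0" "B' \<ge> 0" using f g not_empty by (meson abs_ge_zero ex_in_conv order_trans)+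
  have i: "integrable M f" "integrable M g"
    using f g by (auto intro!: integrable_const_bound[of f B] integrable_const_bound[of g B'])
  have iA: "integrable M (\<lambda>\<omega>. indicator (space M - A) \<omega> :: real)"
    using A by (intro integrable_real_indicator) (auto simp: emeasure_eq_measure)
  have "\<bar>expectation f - expectation g\<bar> = \<bar>expectation (\<lambda>\<omega>. f \<omega> - g \<omega>)\<bar>"
    using i by simp
  also have "\<dots> \<le> expectation (\<lambda>\<omega>. \<bar>f \<omega> - g \<omega>\<bar>)" by (rule integral_abs_bound)
  also have "\<dots> \<le> expectation (\<lambda>\<omega>. e + (B + B') * indicator (space M - A) \<omega>)"
  proof (rule integral_mono)
    show "integrable M (\<lambda>\<omega>. e + (B + B') * indicator (space M - A) \<omega>)"
      using iA by (intro Bochner_Integration.integrable_add integrable_mult_right) auto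
    fix \<omega> assume w: "\<omega> \<in> space M"
    show "\<bar>f \<omega> - g \<omega>\<bar> \<le> e + (B + B') * indicator (space M - A) \<omega>"
      using fg[of \<omega>] f[OF w] g[OF w] w nn e by (cases "\<omega> \<in> A") auto
  qed (use i in auto)
  also have "\<dots> = e + (B + B') * prob (space M - A)"
    using A iA by (subst Bochner_Integration.integral_add) (auto simp: prob_space)
  finally show ?thesis using prob_compl[OF A] by simp
qed

text \<open>A bounded continuous function is close to a trigonometric sum on a large box. The sum
  stays bounded off the box, and by tightness both laws put little mass there, so the limits for
  trigonometric sums carry over.\<close>

lemma (in prob_space) conv_in_law_trigI:
  fixes X :: "nat \<Rightarrow> 'a \<Rightarrow> real^2"
  assumes mu: "prob_space \<mu>" and sets_mu: "sets \<mu> = sets borel"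
    and X[measurable]: "\<And>N. X N \<in> borel_measurable M"
    and conv: "\<And>v c. (\<lambda>N. expectation (\<lambda>\<omega>. cos (v \<bullet> X N \<omega> + c))) \<longlonglongrightarrow> (\<integral>x. cos (v \<bullet> x + c) \<partial>\<mu>)"
    and tight: "\<And>d. d > 0 \<Longrightarrow> \<exists>R. eventually (\<lambda>N. prob {\<omega>\<in>space M. norm (X N \<omega>) \<le> R} \<ge> 1 - d) sequentially"
  shows "conv_in_law M X \<mu>"
  unfolding conv_in_law_def
proof (intro allI impI, elim conjE)
  interpret mu: prob_space \<mu> by fact
  have [measurable_cong]: "sets \<mu> = sets borel" by fact
  have trig: "(\<lambda>N. expectation (\<lambda>\<omega>. p (X N \<omega>))) \<longlonglongrightarrow> (\<integral>x. p x \<partial>\<mu>)" if "trig_sum p" for p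
    using that
  proof (induction)
    case (trig_cos a v c)
    then show ?case using tendsto_mult_left[OF conv, of a v c] by simp
  next
    case (trig_add f g)
    have i: "integrable M (\<lambda>\<omega>. h (X N \<omega>))" "integrable \<mu> h" if t: "trig_sum h" for h N
    proof -
      obtain C where C: "\<forall>x. \<bar>h x\<bar> \<le> C" using trig_sum_bounded[OF t] by blast
      note [measurable] = trig_sum_measurable[OF t]
      show "integrable M (\<lambda>\<omega>. h (X N \<omega>))" "integrable \<mu> h"
        using C by (auto intro!: integrable_const_bound[of _ C] mu.integrable_const_bound[of _ C])
    qed
    show ?case
      using tendsto_add[OF trig_add.IH] i[OF trig_add.hyps(1)] i[OF trig_add.hyps(2)] by simp
  qed
  fix g :: "real^2 \<Rightarrow> real"
  assume g: "continuous_on UNIV g" and "bounded (range g)"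
  then obtain B where B: "\<bar>g x\<bar> \<le> B" for x by (auto simp: bounded_iff)
  have [measurable]: "g \<in> borel_measurable borel" using g by (rule borel_measurable_continuous_onI)
  have B0: "B \<ge> 0" using B[of 0] by linarith
  show "(\<lambda>N. expectation (\<lambda>\<omega>. g (X N \<omega>))) \<longlonglongrightarrow> integral\<^sup>L \<mu> g"
  proof (rule tendstoI)
    fix e :: real assume e: "e > 0"
    \<comment> \<open>The two replacements of \<open>g\<close> by \<open>p\<close>, under the law of
      \<open>X N\<close> and under \<open>\<mu>\<close>, cost at most \<open>d * (2 + 2 * B)\<close>
      each; the limit for \<open>p\<close> costs one more \<open>d\<close>. Together this is
      \<open>d * (5 + 4 * B)\<close>.\<close>
    define d where "d = min 1 (e / (5 + 4 * B))"
    have d: "d > 0" "d \<le> 1" using e B0 by (auto simp: d_def)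
    have "d * (5 + 4 * B) \<le> e / (5 + 4 * B) * (5 + 4 * B)"
      using B0 by (intro mult_right_mono) (auto simp: d_def)
    then have de: "d * (5 + 4 * B) \<le> e" using B0 by simp
    from tight[of "d"] d obtain R1 where
      R1: "eventually (\<lambda>N. prob {\<omega>\<in>space M. norm (X N \<omega>) \<le> R1} \<ge> 1 - d) sequentially" by auto
    have "\<exists>n::nat. mu.prob {x\<in>space \<mu>. norm x \<le> real n} \<ge> 1 - d"
    proof -
      have "(\<lambda>n. mu.prob {x\<in>space \<mu>. norm x \<le> real n}) \<longlonglongrightarrow> mu.prob (\<Union>n. {x\<in>space \<mu>. norm x \<le> real n})"
        by (rule mu.finite_Lim_measure_incseq) (auto simp: incseq_def)
      also have "(\<Union>n. {x\<in>space \<mu>. norm x \<le> real n}) = space \<mu>"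
        using real_arch_simple by blast
      finally have "(\<lambda>n. mu.prob {x\<in>space \<mu>. norm x \<le> real n}) \<longlonglongrightarrow> 1" by (simp add: mu.prob_space)
      from order_tendstoD(1)[OF this, of "1 - d"] d
      have "eventually (\<lambda>n. 1 - d < mu.prob {x\<in>space \<mu>. norm x \<le> real n}) sequentially" by simp
      from eventually_happens'[OF sequentially_bot this] show ?thesis by (auto intro: less_imp_le)
    qed
    then obtain R2 where R2: "mu.prob {x\<in>space \<mu>. norm x \<le> real R2} \<ge> 1 - d" by auto
    define R where "R = max 1 (max R1 (real R2))"
    have R: "R > 0" "R \<ge> R1" "R \<ge> real R2" by (auto simp: R_def)
    obtain p where p: "trig_sum p" and pB: "\<And>x. \<bar>p x\<bar> \<le> B + d"
      and pg: "\<And>x. \<bar>x$1\<bar> \<le> R \<Longrightarrow> \<bar>x$2\<bar> \<le> R \<Longrightarrow> \<bar>g x - p x\<bar> \<le> d"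
      using trig_sum_approx[OF g B R(1) d(1)] by metis
    note [measurable] = trig_sum_measurable[OF p]
    have pg': "\<bar>g x - p x\<bar> \<le> d" if "norm x \<le> R" for x
      using pg that component_le_norm_cart order_trans by metis
    have "\<bar>mu.expectation g - mu.expectation p\<bar> \<le> d + (B + (B + d)) * (1 - mu.prob {x\<in>space \<mu>. norm x \<le> real R2})"
      using B pB R d by (intro mu.expectation_diff_le) (auto intro!: pg')
    also have "\<dots> \<le> d + (B + (B + d)) * d"
      using R2 B0 d by (intro add_left_mono mult_left_mono) auto
    also have "\<dots> \<le> d + (B + (B + 1)) * d" using d B0 by (intro add_left_mono mult_right_mono) auto
    finally have mu_diff: "\<bar>mu.expectation g - mu.expectation p\<bar> \<le> d * (2 + 2 * B)" by (simp add: algebra_simps)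
    from tendstoD[OF trig[OF p] d(1)] R1
    show "eventually (\<lambda>N. dist (expectation (\<lambda>\<omega>. g (X N \<omega>))) (integral\<^sup>L \<mu> g) < e) sequentially"
    proof eventually_elim
      case (elim N)
      have "\<bar>expectation (\<lambda>\<omega>. g (X N \<omega>)) - expectation (\<lambda>\<omega>. p (X N \<omega>))\<bar>
          \<le> d + (B + (B + d)) * (1 - prob {\<omega>\<in>space M. norm (X N \<omega>) \<le> R1})"
        using B pB R d by (intro expectation_diff_le) (auto intro!: pg')
      also have "\<dots> \<le> d + (B + (B + d)) * d"
        using elim B0 d by (intro add_left_mono mult_left_mono) auto
      also have "\<dots> \<le> d + (B + (B + 1)) * d" using d B0 by (intro add_left_mono mult_right_mono) auto
      finally have "\<bar>expectation (\<lambda>\<omega>. g (X N \<omega>)) - expectation (\<lambda>\<omega>. p (X N \<omega>))\<bar> \<le> d * (2 + 2 * B)"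
        by (simp add: algebra_simps)
      with mu_diff elim(1) have "dist (expectation (\<lambda>\<omega>. g (X N \<omega>))) (integral\<^sup>L \<mu> g) < d * (5 + 4 * B)"
        by (simp add: dist_real_def algebra_simps)
      with de show ?case by linarith
    qed
  qed
qed

section \<open>The bivariate normal distribution\<close>

text \<open>The real and imaginary parts of the standard normal characteristic function give the
  cosine and sine integrals; the latter vanishes, so the phase factors out. Mean and scale come from
  an affine substitution. Both are allowed because the bivariate case applies this twice.\<close>

lemma integral_cos_normal:
  assumes "s > 0"
  shows "(\<integral>y. cos (a * y + c) * normal_density m s y \<partial>lborel) = exp (- (a * s)\<^sup>2 / 2) * cos (a * m + c)"
    and "integrable lborel (\<lambda>y. cos (a * y + c) * normal_density m s y)"
proof -
  show "integrable lborel (\<lambda>y. cos (a * y + c) * normal_density m s y)"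
    by (rule Bochner_Integration.integrable_bound[OF integrable_normal_density[OF assms, of m]])
       (auto intro!: AE_I2 mult_left_le_one_le simp: abs_mult)
  have *: "(\<integral>y. cos (t * y + d) * std_normal_density y \<partial>lborel) = exp (- t\<^sup>2 / 2) * cos d" for t d
  proof -
    have i: "integrable lborel (\<lambda>y. cos (t * y) * std_normal_density y)"
      "integrable lborel (\<lambda>y. sin (t * y) * std_normal_density y)"
      by (rule Bochner_Integration.integrable_bound[OF integrable_normal_density[of 1 0]];
          auto intro!: AE_I2 mult_left_le_one_le simp: abs_mult)+
    interpret std: prob_space std_normal_distribution by (rule prob_space_normal_density) simp
    have ci: "integrable std_normal_distribution (\<lambda>x. iexp (t * x))"
      by (rule std.integrable_const_bound[of _ 1]) auto
    have "char std_normal_distribution t = complex_of_real (exp (- t\<^sup>2 / 2))"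
      by (simp add: char_std_normal_distribution)
    then have "Re (LINT x|std_normal_distribution. iexp (t * x)) = exp (- t\<^sup>2 / 2)"
      "Im (LINT x|std_normal_distribution. iexp (t * x)) = 0"
      by (simp_all add: char_def)
    then have "(LINT x|std_normal_distribution. cos (t * x)) = exp (- t\<^sup>2 / 2)"
      "(LINT x|std_normal_distribution. sin (t * x)) = 0"
      using integral_Re[OF ci] integral_Im[OF ci] by (simp_all add: Re_exp Im_exp)
    then have v: "(\<integral>x. cos (t * x) * std_normal_density x \<partial>lborel) = exp (- t\<^sup>2 / 2)"
      "(\<integral>x. sin (t * x) * std_normal_density x \<partial>lborel) = 0"
      by (simp_all add: integral_density mult.commute)
    have "(\<integral>y. cos (t * y + d) * std_normal_density y \<partial>lborel) =
      (\<integral>y. cos d * (cos (t * y) * std_normal_density y) - sin d * (sin (t * y) * std_normal_density y) \<partial>lborel)"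
      by (rule Bochner_Integration.integral_cong) (auto simp: cos_add algebra_simps)
    also have "\<dots> = cos d * exp (- t\<^sup>2 / 2)" using i v by simp
    finally show ?thesis by simp
  qed
  have "(\<integral>y. cos (a * y + c) * normal_density m s y \<partial>lborel) =
      \<bar>s\<bar> *\<^sub>R (\<integral>z. cos (a * (m + s * z) + c) * normal_density m s (m + s * z) \<partial>lborel)"
    using assms by (intro lborel_integral_real_affine) auto
  also have "\<dots> = (\<integral>z. \<bar>s\<bar> *\<^sub>R (cos (a * (m + s * z) + c) * normal_density m s (m + s * z)) \<partial>lborel)"
    by simp
  also have "\<dots> = (\<integral>z. cos ((a * s) * z + (a * m + c)) * std_normal_density z \<partial>lborel)"
    using assms
    by (intro Bochner_Integration.integral_cong)
       (auto simp: normal_density_def real_sqrt_mult power_mult_distrib algebra_simps)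
  also have "\<dots> = exp (- (a * s)\<^sup>2 / 2) * cos (a * m + c)" by (rule *)
  finally show "(\<integral>y. cos (a * y + c) * normal_density m s y \<partial>lborel) = exp (- (a * s)\<^sup>2 / 2) * cos (a * m + c)" .
qed

text \<open>Lebesgue measure is determined by the volumes of boxes. The identification with the
  product measure opens the way to Fubini's theorem.\<close>

lemma lborel_real2:
  "lborel = distr (lborel \<Otimes>\<^sub>M lborel) borel (\<lambda>(x, y). vector [x, y] :: real^2)"
proof (rule lborel_eqI)
  have *: "(\<lambda>(x, y). vector [x, y] :: real^2) = (\<lambda>z. fst z *\<^sub>R axis 1 1 + snd z *\<^sub>R axis 2 1)"
    by (auto simp: vec_eq_iff forall_2 axis_def)
  have m[measurable]: "(\<lambda>(x, y). vector [x, y] :: real^2) \<in> borel_measurable (lborel \<Otimes>\<^sub>M lborel)"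
    unfolding * by measurable
  fix l u :: "real^2" assume le: "\<And>b. b \<in> Basis \<Longrightarrow> l \<bullet> b \<le> u \<bullet> b"
  then have l: "l$1 \<le> u$1" "l$2 \<le> u$2"
    using le[of "axis 1 1"] le[of "axis 2 1"] by (auto simp: inner_axis axis_in_Basis_iff)
  have B: "(Basis :: (real^2) set) = {axis 1 1, axis 2 1}"
    by (auto simp: Basis_vec_def UNIV_2)
  have "emeasure (distr (lborel \<Otimes>\<^sub>M lborel) borel (\<lambda>(x, y). vector [x, y] :: real^2)) (box l u) =
     emeasure (lborel \<Otimes>\<^sub>M lborel) ((\<lambda>(x, y). vector [x, y] :: real^2) -` box l u \<inter> space (lborel \<Otimes>\<^sub>M lborel))"
    by (rule emeasure_distr[OF m]) auto
  also have "(\<lambda>(x, y). vector [x, y] :: real^2) -` box l u \<inter> space (lborel \<Otimes>\<^sub>M lborel)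
      = {l$1<..<u$1} \<times> {l$2<..<u$2}"
    by (auto simp: mem_box_cart forall_2 space_pair_measure)
  also have "emeasure (lborel \<Otimes>\<^sub>M lborel) ({l$1<..<u$1} \<times> {l$2<..<u$2}) = ennreal (u$1 - l$1) * ennreal (u$2 - l$2)"
    using l by (subst lborel.emeasure_pair_measure_Times) auto
  also have "\<dots> = (\<Prod>b\<in>Basis. (u - l) \<bullet> b)"
    using l by (simp add: B inner_axis axis_eq_axis ennreal_mult)
  finally show "emeasure (distr (lborel \<Otimes>\<^sub>M lborel) borel (\<lambda>(x, y). vector [x, y] :: real^2)) (box l u)
      = (\<Prod>b\<in>Basis. (u - l) \<bullet> b)" .
qed simp

text \<open>\<open>matrix_inv\<close> is defined by choice, so its properties become available only
  after the adjugate formula has been exhibited as a witness.\<close>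

lemma matrix_inv_real2:
  fixes A :: "real^2^2"
  assumes d: "det A \<noteq> 0"
  shows "matrix_inv A = vector [vector [A$2$2 / det A, - A$1$2 / det A],
    vector [- A$2$1 / det A, A$1$1 / det A]]" (is "_ = ?B")
proof -
  have dA: "A$1$1 * A$2$2 - A$1$2 * A$2$1 = det A" by (simp add: det_2)
  have 1: "A ** ?B = mat 1"
    using d dA by (simp add: vec_eq_iff forall_2 matrix_matrix_mult_def sum_2 mat_def)
      (simp add: field_simps)
  have 2: "?B ** A = mat 1" using 1 matrix_left_right_inverse by blast
  have "matrix_inv A = matrix_inv A ** (A ** ?B)" unfolding 1 by simp
  also have "\<dots> = ?B"
  proof -
    have "A ** matrix_inv A = mat 1 \<and> matrix_inv A ** A = mat 1"
      unfolding matrix_inv_def by (rule someI[of _ ?B]) (use 1 2 in blast)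
    then show ?thesis by (simp add: matrix_mul_assoc)
  qed
  finally show ?thesis .
qed

lemma quad_form_real2:
  "v \<bullet> ((A::real^2^2) *v v) = v$1 * (A$1$1 * v$1 + A$1$2 * v$2) + v$2 * (A$2$1 * v$1 + A$2$2 * v$2)"
  by (simp add: inner_real2 matrix_vector_mult_def sum_2)

lemma posdef_real2:
  fixes A :: "real^2^2"
  assumes sym: "A$1$2 = A$2$1" and pos: "\<And>v. v \<noteq> 0 \<Longrightarrow> v \<bullet> (A *v v) > 0"
  shows "A$1$1 > 0" "det A > 0"
proof -
  have "(vector [1, 0] :: real^2) \<noteq> 0" by (simp add: vec_eq_iff forall_2)
  from pos[OF this] show 1: "A$1$1 > 0" by (simp add: quad_form_real2)
  \<comment> \<open>A row of the adjugate: \<open>A\<close> maps it to (0, \<open>det A\<close>), so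
    its quadratic form is \<open>A$1$1 * det A\<close>.\<close>
  then have "(vector [- (A$1$2), A$1$1] :: real^2) \<noteq> 0" by (simp add: vec_eq_iff forall_2)
  from pos[OF this] have "A$1$1 * det A > 0" unfolding quad_form_real2
    by (simp add: det_2 sym algebra_simps)
  with 1 show "det A > 0" by (simp add: zero_less_mult_iff)
qed

text \<open>Completing the square in \<open>y\<close>: the first coordinate has variance
  \<open>S$1$1\<close>, and given \<open>x\<close> the second is normal around the regression line
  \<open>k * x\<close> with residual variance \<open>det S / S$1$1\<close>.\<close>

lemma normal2_factor:
  fixes S :: "real^2^2"
  assumes sym: "S$1$2 = S$2$1" and p: "S$1$1 > 0" and d: "det S > 0"
  defines "s \<equiv> sqrt (S$1$1)" and "t \<equiv> sqrt (det S / S$1$1)" and "k \<equiv> S$1$2 / S$1$1"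
  shows "exp (- (vector [x, y] \<bullet> (matrix_inv S *v vector [x, y])) / 2) / (2 * pi * sqrt (det S))
    = normal_density 0 s x * normal_density (k * x) t y"
proof -
  define P Q D where "P = S$1$1" and "Q = S$1$2" and "D = det S"
  have R: "S$2$2 = (D + Q\<^sup>2) / P"
    using p sym by (simp add: D_def P_def Q_def det_2 power2_eq_square)
  have PD: "P > 0" "D > 0" using p d by (auto simp: P_def D_def)
  have q: "vector [x, y] \<bullet> (matrix_inv S *v vector [x, y]) = x\<^sup>2 / P + (y - Q / P * x)\<^sup>2 / (D / P)"
  proof -
    have "vector [x, y] \<bullet> (matrix_inv S *v vector [x, y]) =
       ((D + Q\<^sup>2) / P * x\<^sup>2 - 2 * Q * x * y + P * y\<^sup>2) / D"
      using d PD by (subst matrix_inv_real2)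
         (auto simp: inner_real2 matrix_vector_mult_def sum_2 R sym[symmetric] D_def[symmetric]
           P_def[symmetric] Q_def[symmetric] power2_eq_square field_simps)
    also have "\<dots> = x\<^sup>2 / P + (y - Q / P * x)\<^sup>2 / (D / P)"
      using PD by (simp add: field_simps power2_eq_square)
    finally show ?thesis .
  qed
  have st: "s\<^sup>2 = P" "t\<^sup>2 = D / P" using PD by (auto simp: s_def t_def P_def D_def)
  have "sqrt (2 * pi * s\<^sup>2) * sqrt (2 * pi * t\<^sup>2) = 2 * pi * sqrt D"
    unfolding st using PD by (simp flip: real_sqrt_mult) (simp add: real_sqrt_mult)
  then have c: "1 / (2 * pi * sqrt D) = 1 / sqrt (2 * pi * s\<^sup>2) * (1 / sqrt (2 * pi * t\<^sup>2))"
    by simp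
  have "exp (- (x\<^sup>2 / P + (y - Q / P * x)\<^sup>2 / (D / P)) / 2) =
      exp (- (x - 0)\<^sup>2 / (2 * s\<^sup>2)) * exp (- (y - k * x)\<^sup>2 / (2 * t\<^sup>2))"
    unfolding st k_def P_def[symmetric] Q_def[symmetric] exp_add[symmetric]
    by (simp add: field_simps)
  note ex = this
  have "exp (- (x\<^sup>2 / P + (y - Q / P * x)\<^sup>2 / (D / P)) / 2) / (2 * pi * sqrt D)
    = exp (- (x\<^sup>2 / P + (y - Q / P * x)\<^sup>2 / (D / P)) / 2) * (1 / (2 * pi * sqrt D))"
    by simp
  also have "\<dots> = normal_density 0 s x * normal_density (k * x) t y"
    unfolding c ex normal_density_def by (simp only: mult_ac)
  finally show ?thesis
    unfolding q D_def[symmetric] .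
qed

text \<open>With the density factored, the inner integral over \<open>y\<close> is again a shifted
  cosine, now in \<open>x\<close>, and the same one-dimensional formula applies a second
  time.\<close>

lemma normal2_basic:
  fixes S :: "real^2^2"
  assumes sym: "S$1$2 = S$2$1" and p: "S$1$1 > 0" and d: "det S > 0"
  shows "(\<integral>x. cos (v \<bullet> x + c) \<partial>normal2 S) = exp (- (v \<bullet> (S *v v)) / 2) * cos c"
    and "prob_space (normal2 S)"
proof -
  define s t k where "s = sqrt (S$1$1)" and "t = sqrt (det S / S$1$1)" and "k = S$1$2 / S$1$1"
  have st: "s > 0" "t > 0" using p d by (auto simp: s_def t_def)
  define f where "f v = exp (- (v \<bullet> (matrix_inv S *v v)) / 2) / (2 * pi * sqrt (det S))" for v :: "real^2"
  have f0: "f v \<ge> 0" for v using d by (auto simp: f_def)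
  have fm[measurable]: "f \<in> borel_measurable borel"
    unfolding f_def
    by (intro borel_measurable_continuous_onI continuous_intros
         linear_continuous_on[OF matrix_vector_mul_bounded_linear]) (use d in auto)
  have ff: "f (vector [x, y]) = normal_density 0 s x * normal_density (k * x) t y" for x y
    unfolding f_def s_def t_def k_def by (rule normal2_factor[OF sym p d])
  have *: "(\<lambda>(x, y). vector [x, y] :: real^2) = (\<lambda>z. fst z *\<^sub>R axis 1 1 + snd z *\<^sub>R axis 2 1)"
    by (auto simp: vec_eq_iff forall_2 axis_def)
  have m[measurable]: "(\<lambda>(x, y). vector [x, y] :: real^2) \<in> borel_measurable (lborel \<Otimes>\<^sub>M lborel)"
    unfolding * by measurable
  have mk[measurable]: "(\<lambda>z. normal_density (k * fst z) t (snd z)) \<in> borel_measurable (lborel \<Otimes>\<^sub>M lborel)"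
    unfolding normal_density_def by measurable
  have one: "(\<integral>\<^sup>+x. f x \<partial>lborel) = 1"
  proof -
    have "(\<integral>\<^sup>+x. f x \<partial>lborel) = (\<integral>\<^sup>+z. f (case z of (x, y) \<Rightarrow> vector [x, y]) \<partial>(lborel \<Otimes>\<^sub>M lborel))"
      by (subst lborel_real2) (simp add: nn_integral_distr)
    also have "\<dots> = (\<integral>\<^sup>+x. (\<integral>\<^sup>+y. f (vector [x, y]) \<partial>lborel) \<partial>lborel)"
      by (subst lborel.nn_integral_fst[symmetric]) auto
    also have "\<dots> = (\<integral>\<^sup>+x. normal_density 0 s x * (\<integral>\<^sup>+y. normal_density (k * x) t y \<partial>lborel) \<partial>lborel)"
      by (simp add: ff ennreal_mult nn_integral_cmult)
    also have "\<dots> = 1"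
      using st nn_integral_eq_integral[OF integrable_normal_density]
      by (simp add: integral_normal_density)
    finally show ?thesis .
  qed
  show "prob_space (normal2 S)"
    unfolding normal2_def f_def[symmetric]
    by (rule prob_spaceI) (simp add: emeasure_density one)
  have int: "integrable (lborel \<Otimes>\<^sub>M lborel) (\<lambda>z. f (case z of (x, y) \<Rightarrow> vector [x, y]))"
  proof (rule integrableI_nonneg)
    show "(\<integral>\<^sup>+z. f (case z of (x, y) \<Rightarrow> vector [x, y]) \<partial>(lborel \<Otimes>\<^sub>M lborel)) < \<infinity>"
      using one by (subst (asm) lborel_real2) (simp add: nn_integral_distr)
  qed (use f0 in auto)
  have "(\<integral>x. cos (v \<bullet> x + c) \<partial>normal2 S) = (\<integral>x. f x * cos (v \<bullet> x + c) \<partial>lborel)"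
    unfolding normal2_def f_def[symmetric]
    by (subst integral_density) (auto simp: f0)
  also have "\<dots> = (\<integral>z. f (case z of (x, y) \<Rightarrow> vector [x, y]) * cos (v \<bullet> (case z of (x, y) \<Rightarrow> vector [x, y]) + c) \<partial>(lborel \<Otimes>\<^sub>M lborel))"
    by (subst lborel_real2) (simp add: integral_distr)
  also have "\<dots> = (\<integral>x. (\<integral>y. f (vector [x, y]) * cos (v \<bullet> vector [x, y] + c) \<partial>lborel) \<partial>lborel)"
  proof (subst lborel_pair.integral_fst'[symmetric])
    show "integrable (lborel \<Otimes>\<^sub>M lborel) (\<lambda>z. f (case z of (x, y) \<Rightarrow> vector [x, y]) * cos (v \<bullet> (case z of (x, y) \<Rightarrow> vector [x, y]) + c))"
      by (rule Bochner_Integration.integrable_bound[OF int])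
         (auto intro!: AE_I2 mult_right_le_one_le simp: abs_mult)
  qed simp
  also have "\<dots> = (\<integral>x. normal_density 0 s x * (\<integral>y. cos (v$2 * y + (v$1 * x + c)) * normal_density (k * x) t y \<partial>lborel) \<partial>lborel)"
  proof (rule Bochner_Integration.integral_cong[OF refl])
    fix x :: real
    have "(\<integral>y. f (vector [x, y]) * cos (v \<bullet> vector [x, y] + c) \<partial>lborel) =
      (\<integral>y. normal_density 0 s x * (cos (v$2 * y + (v$1 * x + c)) * normal_density (k * x) t y) \<partial>lborel)"
      by (rule Bochner_Integration.integral_cong) (simp_all add: ff inner_real2 algebra_simps)
    then show "(\<integral>y. f (vector [x, y]) * cos (v \<bullet> vector [x, y] + c) \<partial>lborel) =
        normal_density 0 s x * (\<integral>y. cos (v$2 * y + (v$1 * x + c)) * normal_density (k * x) t y \<partial>lborel)"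
      by simp
  qed
  also have "\<dots> = (\<integral>x. exp (- (v$2 * t)\<^sup>2 / 2) * (cos ((v$1 + v$2 * k) * x + c) * normal_density 0 s x) \<partial>lborel)"
  proof (rule Bochner_Integration.integral_cong[OF refl])
    fix x :: real
    have "v$2 * (k * x) + (v$1 * x + c) = (v$1 + v$2 * k) * x + c" by (simp add: algebra_simps)
    then show "normal_density 0 s x * (\<integral>y. cos (v$2 * y + (v$1 * x + c)) * normal_density (k * x) t y \<partial>lborel)
       = exp (- (v$2 * t)\<^sup>2 / 2) * (cos ((v$1 + v$2 * k) * x + c) * normal_density 0 s x)"
      by (simp only: integral_cos_normal(1)[OF st(2)]) (simp add: mult_ac)
  qed
  also have "\<dots> = exp (- (v$2 * t)\<^sup>2 / 2) * (exp (- ((v$1 + v$2 * k) * s)\<^sup>2 / 2) * cos c)"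
    using integral_cos_normal(1)[OF st(1), of "v$1 + v$2 * k" c 0] by simp
  also have "\<dots> = exp (- ((v$2 * t)\<^sup>2 + ((v$1 + v$2 * k) * s)\<^sup>2) / 2) * cos c"
    by (simp add: exp_add[symmetric] add_divide_distrib diff_divide_distrib)
  also have "(v$2 * t)\<^sup>2 + ((v$1 + v$2 * k) * s)\<^sup>2 = v \<bullet> (S *v v)"
  proof -
    have "t\<^sup>2 = det S / S$1$1" "s\<^sup>2 = S$1$1" using p d by (auto simp: s_def t_def)
    then show ?thesis
      using p by (simp add: power_mult_distrib k_def inner_real2 matrix_vector_mult_def sum_2 det_2 sym)
         (simp add: field_simps power2_eq_square)
  qed
  finally show "(\<integral>x. cos (v \<bullet> x + c) \<partial>normal2 S) = exp (- (v \<bullet> (S *v v)) / 2) * cos c" .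
qed

section \<open>First-order expansions\<close>

text \<open>From \<open>1 - x \<le> exp (- x)\<close> one gets
  \<open>exp x \<le> 1 / (1 - x)\<close>, which is at most \<open>1 + x + 2 * x\<^sup>2\<close> as
  long as x is at most 1/2.\<close>

lemma exp_minus_one_minus_bound:
  fixes x :: real
  assumes "\<bar>x\<bar> \<le> 1 / 2"
  shows "\<bar>exp x - 1 - x\<bar> \<le> 2 * x\<^sup>2"
proof -
  have l: "1 + x \<le> exp x" by (rule exp_ge_add_one_self)
  have "1 - x \<le> exp (- x)" using exp_ge_add_one_self[of "- x"] by simp
  then have "(1 - x) * exp x \<le> exp (- x) * exp x" by (intro mult_right_mono) auto
  then have "(1 - x) * exp x \<le> 1" by (simp add: exp_minus)
  moreover have "1 \<le> (1 - x) * (1 + x + 2 * x\<^sup>2)"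
  proof -
    have "(1 - x) * (1 + x + 2 * x\<^sup>2) = 1 + x\<^sup>2 * (1 - 2 * x)"
      by (simp add: algebra_simps power2_eq_square)
    moreover have "x\<^sup>2 * (1 - 2 * x) \<ge> 0" using assms by (intro mult_nonneg_nonneg) auto
    ultimately show ?thesis by linarith
  qed
  ultimately have "(1 - x) * exp x \<le> (1 - x) * (1 + x + 2 * x\<^sup>2)" by linarith
  then have "exp x \<le> 1 + x + 2 * x\<^sup>2" using assms by (simp add: mult_le_cancel_left)
  with l show ?thesis unfolding abs_le_iff using zero_le_power2[of x] by linarith
qed

section \<open>Bounded observables and the calculus of uniform expansions\<close>

locale step_stress =
  fixes x1 x2 tau1 tau2 :: real
  assumes tau1_pos: "0 < tau1" and tau12: "tau1 < tau2"
begin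

text \<open>Observables of the censored lifetime: constancy from \<open>tau2\<close> on says that
  the exact value of a censored lifetime is not seen. Boundedness makes every integral below exist
  and Hoeffding's inequality applicable.\<close>

definition bm :: "(real \<Rightarrow> real) \<Rightarrow> bool" where
  "bm f \<longleftrightarrow> f \<in> borel_measurable borel \<and> (\<exists>C. \<forall>t. \<bar>f t\<bar> \<le> C) \<and> (\<forall>t\<ge>tau2. f t = f tau2)"

lemma bm_measurable[measurable_dest]: "bm f \<Longrightarrow> f \<in> borel_measurable borel"
  by (simp add: bm_def)

lemma bm_bound: assumes "bm f" obtains C where "C \<ge> 1" "\<And>t. \<bar>f t\<bar> \<le> C"
proof -
  from assms obtain C where "\<forall>t. \<bar>f t\<bar> \<le> C" by (auto simp: bm_def)
  then have "\<bar>f t\<bar> \<le> max 1 C" for t by (meson max.coboundedI2)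
  with that[of "max 1 C"] show ?thesis by simp
qed

lemma bm_const[intro!, simp]: "bm (\<lambda>_. c)" by (auto simp: bm_def)

lemma bm_add[intro!]: assumes "bm f" "bm g" shows "bm (\<lambda>t. f t + g t)"
proof -
  obtain C where C: "\<And>t. \<bar>f t\<bar> \<le> C" using assms(1) bm_bound by metis
  obtain D where D: "\<And>t. \<bar>g t\<bar> \<le> D" using assms(2) bm_bound by metis
  have "\<bar>f t + g t\<bar> \<le> C + D" for t using C[of t] D[of t] by linarith
  moreover have "f t + g t = f tau2 + g tau2" if "t \<ge> tau2" for t
    using assms that unfolding bm_def by metis
  ultimately show ?thesis using assms unfolding bm_def by (intro conjI) (measurable, blast+)
qed

lemma bm_mult[intro!]: assumes "bm f" "bm g" shows "bm (\<lambda>t. f t * g t)"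
proof -
  obtain C where C: "\<And>t. \<bar>f t\<bar> \<le> C" using assms(1) bm_bound by metis
  obtain D where D: "\<And>t. \<bar>g t\<bar> \<le> D" using assms(2) bm_bound by metis
  have "\<bar>f t * g t\<bar> \<le> C * D" for t
    unfolding abs_mult using C[of t] D[of t] by (intro mult_mono) auto
  moreover have "f t * g t = f tau2 * g tau2" if "t \<ge> tau2" for t
    using assms that unfolding bm_def by metis
  ultimately show ?thesis using assms unfolding bm_def by (intro conjI) (measurable, blast+)
qed

lemma bm_uminus[intro!]: "bm f \<Longrightarrow> bm (\<lambda>t. - f t)"
  using bm_mult[of "\<lambda>_. -1" f] by simp

lemma bm_diff[intro!]: "bm f \<Longrightarrow> bm g \<Longrightarrow> bm (\<lambda>t. f t - g t)"
  using bm_add[of f "\<lambda>t. - g t"] by auto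

lemma bm_exp[intro!]: assumes "bm f" shows "bm (\<lambda>t. exp (f t))"
proof -
  obtain C where C: "\<And>t. \<bar>f t\<bar> \<le> C" using assms(1) bm_bound by metis
  have "\<bar>exp (f t)\<bar> \<le> exp C" for t using C[of t] by simp
  moreover have "exp (f t) = exp (f tau2)" if "t \<ge> tau2" for t
    using assms that unfolding bm_def by metis
  ultimately show ?thesis using assms unfolding bm_def by (intro conjI) (measurable, blast+)
qed

definition Inu :: "(real \<Rightarrow> real) \<Rightarrow> real" where
  "Inu f = (\<integral>t. indicator {0..<tau2} t * f t \<partial>lborel) + f tau2"

lemma bm_integrable: assumes "bm f" shows "integrable lborel (\<lambda>t. indicator {0..<tau2} t * f t)"
proof -
  obtain C where C: "C \<ge> 1" "\<And>t. \<bar>f t\<bar> \<le> C" using assms(1) bm_bound by metis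
  have "integrable lborel (\<lambda>t. C * indicator {0..<tau2} t)"
    by (intro integrable_mult_right integrable_real_indicator) (use tau1_pos tau12 in auto)
  then show ?thesis
    by (rule Bochner_Integration.integrable_bound)
       (use C assms in \<open>auto simp: bm_def split: split_indicator intro!: AE_I2 intro: order_trans\<close>)
qed

lemma Inu_add: "bm f \<Longrightarrow> bm g \<Longrightarrow> Inu (\<lambda>t. f t + g t) = Inu f + Inu g"
  using bm_integrable[of f] bm_integrable[of g] by (simp add: Inu_def distrib_left)

lemma Inu_cmult: "Inu (\<lambda>t. c * f t) = c * Inu f"
  by (simp add: Inu_def mult.left_commute distrib_left)

lemma Inu_diff: "bm f \<Longrightarrow> bm g \<Longrightarrow> Inu (\<lambda>t. f t - g t) = Inu f - Inu g"
  using bm_integrable[of f] bm_integrable[of g] by (simp add: Inu_def right_diff_distrib)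

lemma Inu_mono: assumes "bm f" "bm g" "\<And>t. f t \<le> g t" shows "Inu f \<le> Inu g"
  unfolding Inu_def using assms
  by (intro add_mono integral_mono bm_integrable) (auto intro: mult_left_mono)

lemma Inu_const: "Inu (\<lambda>_. c) = c * (tau2 + 1)"
  using tau1_pos tau12 by (simp add: Inu_def algebra_simps)

lemma Inu_bound: assumes "bm f" "\<And>t. \<bar>f t\<bar> \<le> C" shows "\<bar>Inu f\<bar> \<le> C * (tau2 + 1)"
proof -
  have "f t \<le> C" "- C \<le> f t" for t using assms(2)[of t] by linarith+
  then have "Inu f \<le> Inu (\<lambda>_. C)" "Inu (\<lambda>_. - C) \<le> Inu f"
    using assms(1) by (auto intro!: Inu_mono)
  then show ?thesis by (simp add: Inu_const abs_le_iff)
qed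

lemma Inu_nonneg: "bm f \<Longrightarrow> (\<And>t. 0 \<le> f t) \<Longrightarrow> 0 \<le> Inu f"
  using Inu_mono[of "\<lambda>_. 0" f] Inu_const[of 0] by simp

text \<open>Expansions that are uniform in the observation are closed under sums, products, exponentials
  and integration; this replaces differentiation under the integral sign.\<close>
definition has_jet :: "(real^2 \<Rightarrow> real \<Rightarrow> real) \<Rightarrow> real^2 \<Rightarrow> (real \<Rightarrow> real^2) \<Rightarrow> bool" where
  "has_jet F b D \<longleftrightarrow> (\<forall>b. bm (F b)) \<and> bm (\<lambda>t. D t $ 1) \<and> bm (\<lambda>t. D t $ 2) \<and>
     (\<exists>C r. r > 0 \<and> (\<forall>h. norm h \<le> r \<longrightarrow> (\<forall>t. \<bar>F (b + h) t - F b t - D t \<bullet> h\<bar> \<le> C * (norm h)\<^sup>2)))"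

text \<open>All bounds hold for every \<open>K'\<close> above \<open>K\<close>, so that two
  expansions can share one constant. The normalizations \<open>1 \<le> K\<close> and
  \<open>r \<le> 1\<close> allow higher powers of the increment and lower powers of the constant to
  be absorbed.\<close>

definition jet_bd :: "(real^2 \<Rightarrow> real \<Rightarrow> real) \<Rightarrow> real^2 \<Rightarrow> (real \<Rightarrow> real^2) \<Rightarrow> real \<Rightarrow> real \<Rightarrow> bool" where
  "jet_bd F b D K r \<longleftrightarrow> 1 \<le> K \<and> 0 < r \<and> r \<le> 1 \<and> (\<forall>K' h t. K \<le> K' \<longrightarrow> norm h \<le> r \<longrightarrow>
     \<bar>F b t\<bar> \<le> K' \<and> \<bar>D t \<bullet> h\<bar> \<le> K' * norm h \<and> \<bar>F (b + h) t - F b t - D t \<bullet> h\<bar> \<le> K' * (norm h)\<^sup>2)"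

lemma jet_bdD:
  assumes "jet_bd F b D K r"
  shows "1 \<le> K" "0 < r" "r \<le> 1"
    "K \<le> K' \<Longrightarrow> norm h \<le> r \<Longrightarrow> \<bar>F b t\<bar> \<le> K'"
    "K \<le> K' \<Longrightarrow> norm h \<le> r \<Longrightarrow> \<bar>D t \<bullet> h\<bar> \<le> K' * norm h"
    "K \<le> K' \<Longrightarrow> norm h \<le> r \<Longrightarrow> \<bar>F (b + h) t - F b t - D t \<bullet> h\<bar> \<le> K' * (norm h)\<^sup>2"
  using assms unfolding jet_bd_def by blast+

lemma has_jet_bound:
  assumes "has_jet F b D"
  obtains K r where "jet_bd F b D K r"
proof -
  from assms obtain C r where r: "r > 0"
    and C: "\<forall>h. norm h \<le> r \<longrightarrow> (\<forall>t. \<bar>F (b + h) t - F b t - D t \<bullet> h\<bar> \<le> C * (norm h)\<^sup>2)"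
    unfolding has_jet_def by blast
  have b: "bm (F b)" "bm (\<lambda>t. D t $ 1)" "bm (\<lambda>t. D t $ 2)" using assms by (auto simp: has_jet_def)
  obtain C0 where C0: "C0 \<ge> 1" "\<And>t. \<bar>F b t\<bar> \<le> C0" using b(1) bm_bound by metis
  obtain C1 where C1: "C1 \<ge> 1" "\<And>t. \<bar>D t $ 1\<bar> \<le> C1" using b(2) bm_bound by metis
  obtain C2 where C2: "C2 \<ge> 1" "\<And>t. \<bar>D t $ 2\<bar> \<le> C2" using b(3) bm_bound by metis
  have "jet_bd F b D (C0 + C1 + C2 + \<bar>C\<bar>) (min 1 r)"
    unfolding jet_bd_def
  proof (intro conjI allI impI)
    fix K' h t assume K': "C0 + C1 + C2 + \<bar>C\<bar> \<le> K'" and h: "norm (h :: real^2) \<le> min 1 r"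
    have "\<bar>D t \<bullet> h\<bar> \<le> norm (D t) * norm h" by (rule Cauchy_Schwarz_ineq2)
    also have "norm (D t) \<le> K'" using norm_real2_le[of "D t"] C0(1) C1(2)[of t] C2(2)[of t] K' by linarith
    finally have 1: "\<bar>D t \<bullet> h\<bar> \<le> K' * norm h" by (simp add: mult_right_mono)
    have "\<bar>F (b + h) t - F b t - D t \<bullet> h\<bar> \<le> C * (norm h)\<^sup>2" using C h by simp
    also have "\<dots> \<le> K' * (norm h)\<^sup>2" using C0(1) C1(1) C2(1) K' by (intro mult_right_mono) auto
    finally show "\<bar>F (b + h) t - F b t - D t \<bullet> h\<bar> \<le> K' * (norm h)\<^sup>2" .
    show "\<bar>D t \<bullet> h\<bar> \<le> K' * norm h" by (rule 1)
    show "\<bar>F b t\<bar> \<le> K'" using C0(2)[of t] C1(1) C2(1) K' by linarith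
  qed (use r C0 C1 C2 in auto)
  then show thesis by (rule that)
qed

lemma has_jetI:
  assumes "\<And>b. bm (F b)" "bm (\<lambda>t. D t $ 1)" "bm (\<lambda>t. D t $ 2)" "r > 0"
    "\<And>h t. norm h \<le> r \<Longrightarrow> \<bar>F (b + h) t - F b t - D t \<bullet> h\<bar> \<le> C * (norm h)\<^sup>2"
  shows "has_jet F b D"
  using assms unfolding has_jet_def by blast

lemma has_jet_bm: assumes "has_jet F b D"
  shows "bm (F b')" "bm (\<lambda>t. D t $ 1)" "bm (\<lambda>t. D t $ 2)"
  using assms by (auto simp: has_jet_def)

lemma has_jet_const: "bm f \<Longrightarrow> has_jet (\<lambda>b. f) b (\<lambda>t. 0)"
  by (rule has_jetI[where r=1 and C=0]) auto

lemma has_jet_linear: "has_jet (\<lambda>b t. b \<bullet> a) b (\<lambda>t. a)"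
  by (rule has_jetI[where r=1 and C=0]) (auto simp: inner_simps inner_commute)

lemma has_jet_add:
  assumes F: "has_jet F b D" and G: "has_jet G b E"
  shows "has_jet (\<lambda>b t. F b t + G b t) b (\<lambda>t. D t + E t)"
proof -
  obtain K r where K: "jet_bd F b D K r" by (rule has_jet_bound[OF F])
  note K = jet_bdD[OF K]
  obtain L s where L: "jet_bd G b E L s" by (rule has_jet_bound[OF G])
  note L = jet_bdD[OF L]
  show ?thesis
  proof (rule has_jetI[where r="min r s" and C="K + L"])
    fix h :: "real^2" and t assume "norm h \<le> min r s"
    then show "\<bar>F (b + h) t + G (b + h) t - (F b t + G b t) - (D t + E t) \<bullet> h\<bar> \<le> (K + L) * (norm h)\<^sup>2"
      using K(6)[of K h t] L(6)[of L h t] by (auto simp: inner_simps distrib_right)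
  qed (use K(1-3) L(1-3) has_jet_bm[OF F] has_jet_bm[OF G] in auto)
qed

lemma has_jet_mult:
  assumes F: "has_jet F b D" and G: "has_jet G b E"
  shows "has_jet (\<lambda>b t. F b t * G b t) b (\<lambda>t. F b t *\<^sub>R E t + G b t *\<^sub>R D t)"
proof -
  obtain K r where K: "jet_bd F b D K r" by (rule has_jet_bound[OF F])
  note K = jet_bdD[OF K]
  obtain L s where L: "jet_bd G b E L s" by (rule has_jet_bound[OF G])
  note L = jet_bdD[OF L]
  define M where "M = max K L"
  have M: "M \<ge> 1" "K \<le> M" "L \<le> M" using K(1-3) L(1-3) by (auto simp: M_def)
  show ?thesis
  proof (rule has_jetI[where r="min r s" and C="6 * M\<^sup>2"])
    fix h :: "real^2" and t assume h: "norm h \<le> min r s"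
    define n where "n = norm h"
    have n: "0 \<le> n" "n \<le> 1" using h K(1-3) by (auto simp: n_def intro: mult_left_le)
    define A p a where "A = F b t" and "p = D t \<bullet> h" and "a = F (b + h) t - F b t - D t \<bullet> h"
    define B q c where "B = G b t" and "q = E t \<bullet> h" and "c = G (b + h) t - G b t - E t \<bullet> h"
    have bd: "\<bar>A\<bar> \<le> M" "\<bar>p\<bar> \<le> M * n" "\<bar>a\<bar> \<le> M * n\<^sup>2" "\<bar>B\<bar> \<le> M" "\<bar>q\<bar> \<le> M * n" "\<bar>c\<bar> \<le> M * n\<^sup>2"
      using K(4-6)[OF M(2), of h t] L(4-6)[OF M(3), of h t] h
      by (auto simp: A_def p_def a_def B_def q_def c_def n_def)
    have Mn: "M * n \<le> M" "M * n\<^sup>2 \<le> M" using M n mult_left_le[of n n] by (auto simp: power2_eq_square intro!: mult_left_le)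
    have sm: "\<bar>A + p\<bar> \<le> 2 * M" "\<bar>B + q + c\<bar> \<le> 3 * M" using bd Mn by linarith+
    have "F (b + h) t * G (b + h) t - F b t * G b t - (F b t *\<^sub>R E t + G b t *\<^sub>R D t) \<bullet> h
        = (A + p + a) * (B + q + c) - A * B - (A * q + B * p)"
      by (simp add: A_def p_def a_def B_def q_def c_def inner_simps)
    \<comment> \<open>Only second-order terms are left. They contribute \<open>M\<^sup>2\<close>,
      \<open>2 * M\<^sup>2\<close> and \<open>3 * M\<^sup>2\<close>, which explains the constant
      6.\<close>
    also have "\<dots> = p * q + (A + p) * c + a * (B + q + c)" by (simp add: algebra_simps)
    finally have "\<bar>F (b + h) t * G (b + h) t - F b t * G b t - (F b t *\<^sub>R E t + G b t *\<^sub>R D t) \<bullet> h\<bar>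
       \<le> \<bar>p\<bar> * \<bar>q\<bar> + \<bar>A + p\<bar> * \<bar>c\<bar> + \<bar>a\<bar> * \<bar>B + q + c\<bar>"
      by (simp add: abs_mult[symmetric])
    also have "\<dots> \<le> (M * n) * (M * n) + (2 * M) * (M * n\<^sup>2) + (M * n\<^sup>2) * (3 * M)"
    proof (intro add_mono)
      show "\<bar>p\<bar> * \<bar>q\<bar> \<le> (M * n) * (M * n)" by (rule mult_mono) (use bd M n in auto)
      show "\<bar>A + p\<bar> * \<bar>c\<bar> \<le> (2 * M) * (M * n\<^sup>2)" by (rule mult_mono) (use bd sm M n in auto)
      show "\<bar>a\<bar> * \<bar>B + q + c\<bar> \<le> (M * n\<^sup>2) * (3 * M)" by (rule mult_mono) (use bd sm M n in auto)
    qed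
    also have "\<dots> = 6 * M\<^sup>2 * (norm h)\<^sup>2" by (simp add: n_def power2_eq_square)
    finally show "\<bar>F (b + h) t * G (b + h) t - F b t * G b t - (F b t *\<^sub>R E t + G b t *\<^sub>R D t) \<bullet> h\<bar>
       \<le> 6 * M\<^sup>2 * (norm h)\<^sup>2" .
  qed (use K(1-3) L(1-3) has_jet_bm[OF F] has_jet_bm[OF G] in auto)
qed

lemma has_jet_exp:
  assumes F: "has_jet F b D"
  shows "has_jet (\<lambda>b t. exp (F b t)) b (\<lambda>t. exp (F b t) *\<^sub>R D t)"
proof -
  obtain K r where K: "jet_bd F b D K r" by (rule has_jet_bound[OF F])
  note K = jet_bdD[OF K]
  \<comment> \<open>The radius \<open>1 / (4 * K)\<close> keeps the whole increment of the exponent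
    below 1/2, as \<open>exp_minus_one_minus_bound\<close> demands. The constant 9 is 8 from that
    bound plus 1 from the remainder of \<open>F\<close>.\<close>
  show ?thesis
  proof (rule has_jetI[where r="min r (1 / (4 * K))" and C="exp K * (9 * K\<^sup>2)"])
    fix h :: "real^2" and t assume h: "norm h \<le> min r (1 / (4 * K))"
    define n where "n = norm h"
    have n: "0 \<le> n" "n \<le> 1" using h K(1-3) by (auto simp: n_def)
    have Kn: "K * n \<le> 1 / 4" using h K(1-3) by (auto simp: n_def field_simps)
    define A p a where "A = F b t" and "p = D t \<bullet> h" and "a = F (b + h) t - F b t - D t \<bullet> h"
    have bd: "\<bar>A\<bar> \<le> K" "\<bar>p\<bar> \<le> K * n" "\<bar>a\<bar> \<le> K * n\<^sup>2"
      using K(4-6)[of K h t] h by (auto simp: A_def p_def a_def n_def)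
    have Kn2: "K * n\<^sup>2 \<le> K * n" using K(1-3) n by (auto simp: power2_eq_square mult_left_le)
    define x where "x = p + a"
    have x: "\<bar>x\<bar> \<le> 2 * (K * n)" using bd Kn2 by (auto simp: x_def)
    have "\<bar>exp x - 1 - x\<bar> \<le> 2 * x\<^sup>2" using x Kn by (intro exp_minus_one_minus_bound) auto
    also have "x\<^sup>2 \<le> (2 * (K * n))\<^sup>2" using x abs_le_square_iff[of x "2 * (K * n)"] K(1) n by auto
    finally have ex: "\<bar>exp x - 1 - x\<bar> \<le> 8 * K\<^sup>2 * n\<^sup>2" by (simp add: power_mult_distrib)
    have "K * n\<^sup>2 \<le> K\<^sup>2 * n\<^sup>2" using K(1-3) by (intro mult_right_mono) (auto simp: power2_eq_square)
    then have a': "\<bar>a\<bar> \<le> K\<^sup>2 * n\<^sup>2" using bd by linarith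
    have "exp (F (b + h) t) - exp (F b t) - (exp (F b t) *\<^sub>R D t) \<bullet> h = exp A * ((exp x - 1 - x) + a)"
      by (simp add: A_def p_def a_def x_def algebra_simps flip: exp_add)
    then have "\<bar>exp (F (b + h) t) - exp (F b t) - (exp (F b t) *\<^sub>R D t) \<bullet> h\<bar> = exp A * \<bar>(exp x - 1 - x) + a\<bar>"
      by (simp add: abs_mult)
    also have "\<dots> \<le> exp K * (9 * K\<^sup>2 * n\<^sup>2)"
      using bd ex a' by (intro mult_mono) auto
    finally show "\<bar>exp (F (b + h) t) - exp (F b t) - (exp (F b t) *\<^sub>R D t) \<bullet> h\<bar> \<le> exp K * (9 * K\<^sup>2) * (norm h)\<^sup>2"
      by (simp add: n_def mult.assoc)
  qed (use K(1-3) has_jet_bm[OF F] in auto)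
qed

lemma has_jet_cong:
  "has_jet F b D \<Longrightarrow> (\<And>b t. F b t = F' b t) \<Longrightarrow> (\<And>t. D t = D' t) \<Longrightarrow> has_jet F' b D'"
  by (subgoal_tac "F = F' \<and> D = D'") (auto intro!: ext)

lemma has_jet_cmult: "has_jet F b D \<Longrightarrow> has_jet (\<lambda>b t. c * F b t) b (\<lambda>t. c *\<^sub>R D t)"
  by (rule has_jet_cong[OF has_jet_mult[OF has_jet_const[of "\<lambda>_. c"]]]) auto

lemma has_jet_diff:
  "has_jet F b D \<Longrightarrow> has_jet G b E \<Longrightarrow> has_jet (\<lambda>b t. F b t - G b t) b (\<lambda>t. D t - E t)"
  by (rule has_jet_cong[OF has_jet_add[OF _ has_jet_cmult[of G b E "-1"]]]) auto

text \<open>Functions of the parameter alone are treated as expansions that do not depend on the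
  observation. In this way the loss of a fixed sample belongs to the same calculus.\<close>

lemma has_jet_eval:
  assumes "has_jet F b D" shows "has_jet (\<lambda>b _. F b s) b (\<lambda>_. D s)"
proof -
  obtain K r where K: "jet_bd F b D K r" by (rule has_jet_bound[OF assms])
  show ?thesis
    by (rule has_jetI[where r=r and C=K]) (auto intro!: jet_bdD(6)[OF K] jet_bdD(2)[OF K])
qed

lemma has_jet_sum:
  "(\<And>i. i \<in> I \<Longrightarrow> has_jet (F i) b (D i)) \<Longrightarrow> has_jet (\<lambda>b t. \<Sum>i\<in>I. F i b t) b (\<lambda>t. \<Sum>i\<in>I. D i t)"
  by (induction I rule: infinite_finite_induct) (auto intro: has_jet_const has_jet_add)

lemma has_jet_Inu:
  assumes F: "has_jet F b D"
  shows "has_jet (\<lambda>b _. Inu (F b)) b (\<lambda>_. vector [Inu (\<lambda>t. D t $ 1), Inu (\<lambda>t. D t $ 2)])"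
proof -
  obtain K r where K: "jet_bd F b D K r" by (rule has_jet_bound[OF F])
  note K = jet_bdD[OF K]
  note bm = has_jet_bm[OF F]
  show ?thesis
  proof (rule has_jetI[where r=r and C="K * (tau2 + 1)"])
    fix h :: "real^2" and t :: real assume h: "norm h \<le> r"
    have b: "bm (\<lambda>t. D t \<bullet> h)" unfolding inner_real2 using bm by auto
    have "Inu (F (b + h)) - Inu (F b) - (vector [Inu (\<lambda>t. D t $ 1), Inu (\<lambda>t. D t $ 2)] :: real^2) \<bullet> h
      = Inu (F (b + h)) - Inu (F b) - Inu (\<lambda>t. D t \<bullet> h)"
    proof -
      have "Inu (\<lambda>t. D t \<bullet> h) = Inu (\<lambda>t. h $ 1 * D t $ 1 + h $ 2 * D t $ 2)"
        by (simp add: inner_real2 mult.commute)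
      also have "\<dots> = h $ 1 * Inu (\<lambda>t. D t $ 1) + h $ 2 * Inu (\<lambda>t. D t $ 2)"
        using bm by (subst Inu_add) (auto simp: Inu_cmult)
      finally show ?thesis by (simp add: inner_real2 mult.commute)
    qed
    also have "\<dots> = Inu (\<lambda>t. F (b + h) t - F b t - D t \<bullet> h)"
      using bm b by (subst Inu_diff Inu_diff; auto)+
    also have "\<bar>\<dots>\<bar> \<le> (K * (norm h)\<^sup>2) * (tau2 + 1)"
      using K(6)[of K h] h bm b by (intro Inu_bound) auto
    finally show "\<bar>Inu (F (b + h)) - Inu (F b) - (vector [Inu (\<lambda>t. D t $ 1), Inu (\<lambda>t. D t $ 2)] :: real^2) \<bullet> h\<bar>
       \<le> K * (tau2 + 1) * (norm h)\<^sup>2" by (simp add: mult_ac)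
  qed (use K(1-3) in auto)
qed

lemma has_jet_min_zero:
  assumes F: "has_jet (\<lambda>b _. F b) b (\<lambda>_. g)" and d: "d > 0" and min: "\<And>h. norm h < d \<Longrightarrow> F b \<le> F (b + h)"
  shows "g = 0"
proof (rule ccontr)
  assume g: "g \<noteq> 0"
  obtain K r where K: "jet_bd (\<lambda>b _. F b) b (\<lambda>_. g) K r" by (rule has_jet_bound[OF F])
  note K = jet_bdD[OF K]
  \<comment> \<open>Step length along the negative gradient: the step must stay inside the radius of
    the expansion and inside the region of minimality, and the quadratic remainder may eat at most
    half of the linear decrease.\<close>
  define s where "s = min (min (r / norm g) (d / (2 * norm g))) (1 / (2 * K))"
  have s: "s > 0" "s * norm g \<le> r" "s * norm g < d" "s * K \<le> 1 / 2"
  proof -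
    show "s > 0" using K(1-3) d g by (auto simp: s_def)
    have "s \<le> r / norm g" "s \<le> d / (2 * norm g)" "s \<le> 1 / (2 * K)" by (auto simp: s_def)
    then have "s * norm g \<le> r" "s * norm g \<le> d / 2" "s * K \<le> 1 / 2"
      using g K(1-3) by (auto simp: field_simps)
    then show "s * norm g \<le> r" "s * norm g < d" "s * K \<le> 1 / 2" using d by auto
  qed
  define h where "h = - s *\<^sub>R g"
  have h: "norm h = s * norm g" using s by (simp add: h_def)
  have "F b \<le> F (b + h)" by (rule min) (use h s in simp)
  moreover have "\<bar>F (b + h) - F b - g \<bullet> h\<bar> \<le> K * (norm h)\<^sup>2" using K(6)[of K h] s h by simp
  ultimately have "0 \<le> g \<bullet> h + K * (norm h)\<^sup>2" by linarith
  also have "\<dots> = - s * (norm g)\<^sup>2 + (s * K) * s * (norm g)\<^sup>2"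
    unfolding h by (simp add: h_def dot_square_norm power_mult_distrib power2_eq_square)
  also have "\<dots> \<le> - s * (norm g)\<^sup>2 + (1 / 2) * s * (norm g)\<^sup>2"
    using s by (intro add_left_mono mult_right_mono) auto
  also have "\<dots> < 0" using s g by simp
  finally show False by simp
qed

end

section \<open>The censored lifetime model\<close>

context step_stress
begin

text \<open>\<open>r1\<close> and \<open>r2\<close> indicate a failure in the first and second
  phase; \<open>X\<close> and \<open>Y\<close> are the times spent in each. Clipping at 0 keeps them
  bounded on the whole line; negative times have probability zero.\<close>

definition r1 :: "real \<Rightarrow> real" where "r1 t = (if t < tau1 then 1 else 0)"
definition r2 :: "real \<Rightarrow> real" where "r2 t = (if tau1 \<le> t \<and> t < tau2 then 1 else 0)"
definition X :: "real \<Rightarrow> real" where "X t = max 0 (min t tau1)"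
definition Y :: "real \<Rightarrow> real" where "Y t = max 0 (min t tau2 - tau1)"

lemma bm_r1[intro!]: "bm r1" and bm_r2[intro!]: "bm r2"
  using tau12 unfolding bm_def r1_def r2_def by (auto intro!: exI[of _ 1])

lemma X_bounds: "0 \<le> X t" "X t \<le> tau1" and Y_bounds: "0 \<le> Y t" "Y t \<le> tau2 - tau1"
  using tau1_pos tau12 by (auto simp: X_def Y_def)

lemma bm_X[intro!]: "bm X" and bm_Y[intro!]: "bm Y"
proof -
  have "\<bar>X t\<bar> \<le> tau1" "\<bar>Y t\<bar> \<le> tau2 - tau1" for t using X_bounds[of t] Y_bounds[of t] by auto
  moreover have "X \<in> borel_measurable borel" "Y \<in> borel_measurable borel"
    unfolding X_def[abs_def] Y_def[abs_def] by measurable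
  moreover have "\<forall>t\<ge>tau2. X t = X tau2" "\<forall>t\<ge>tau2. Y t = Y tau2" using tau12 by (auto simp: X_def Y_def)
  ultimately show "bm X" "bm Y" unfolding bm_def by blast+
qed

text \<open>Design vectors: \<open>b \<bullet> e1\<close> and \<open>b \<bullet> e2\<close> are the
  logarithms of the mean lifetimes, so \<open>exp (- (b \<bullet> e1))\<close> and
  \<open>exp (- (b \<bullet> e2))\<close> are the failure rates.\<close>

definition e1 :: "real^2" where "e1 = vector [1, x1]"
definition e2 :: "real^2" where "e2 = vector [1, x2]"

lemma e_simps[simp]: "e1 $ 1 = 1" "e1 $ 2 = x1" "e2 $ 1 = 1" "e2 $ 2 = x2"
  by (auto simp: e1_def e2_def)

text \<open>\<open>G b\<close> is the logarithm of the density of the censored lifetime with respect to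
  Lebesgue measure on \<open>[0, tau2)\<close> plus a unit mass at \<open>tau2\<close>, and \<open>u b\<close> is its score.\<close>
definition G :: "real^2 \<Rightarrow> real \<Rightarrow> real" where
  "G b t = - (r1 t * (b \<bullet> e1)) - r2 t * (b \<bullet> e2) - exp (- (b \<bullet> e1)) * X t - exp (- (b \<bullet> e2)) * Y t"

definition u :: "real^2 \<Rightarrow> real \<Rightarrow> real^2" where
  "u b t = (exp (- (b \<bullet> e1)) * X t - r1 t) *\<^sub>R e1 + (exp (- (b \<bullet> e2)) * Y t - r2 t) *\<^sub>R e2"

lemma bm_G[intro!]: "bm (G b)" unfolding G_def[abs_def] by auto

lemma bm_u[intro!]: "bm (\<lambda>t. u b t $ i)"
  unfolding u_def vector_add_component vector_scaleR_component by auto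

lemma bm_inner[intro!]:
  fixes f :: "real \<Rightarrow> real^2"
  shows "bm (\<lambda>t. f t $ 1) \<Longrightarrow> bm (\<lambda>t. f t $ 2) \<Longrightarrow> bm (\<lambda>t. f t \<bullet> v)"
  unfolding inner_real2 by auto

lemma has_jet_expm: "has_jet (\<lambda>b t. exp (- (b \<bullet> e)) * f t) b (\<lambda>t. - (exp (- (b \<bullet> e)) * f t) *\<^sub>R e)"
  if "bm f"
  by (rule has_jet_cong[OF has_jet_mult[OF has_jet_exp[OF has_jet_cmult[OF has_jet_linear[of e], where c="-1"]] has_jet_const[OF that]]])
     auto

lemma has_jet_G: "has_jet G b (u b)"
proof -
  have "has_jet (\<lambda>b t. (-1) * (r1 t * (b \<bullet> e1) + (r2 t * (b \<bullet> e2) + (exp (- (b \<bullet> e1)) * X t + exp (- (b \<bullet> e2)) * Y t)))) b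
     (\<lambda>t. (-1) *\<^sub>R ((r1 t *\<^sub>R e1 + (b \<bullet> e1) *\<^sub>R 0) + ((r2 t *\<^sub>R e2 + (b \<bullet> e2) *\<^sub>R 0) +
       ((- (exp (- (b \<bullet> e1)) * X t) *\<^sub>R e1) + (- (exp (- (b \<bullet> e2)) * Y t) *\<^sub>R e2)))))"
    by (intro has_jet_cmult has_jet_add has_jet_expm has_jet_mult[OF has_jet_const has_jet_linear]) auto
  then show ?thesis
    by (rule has_jet_cong) (auto simp: G_def u_def algebra_simps)
qed

text \<open>The derivative of the score stays anonymous because it cancels in
  \<open>psi_jet\<close>.\<close>

lemma has_jet_u: obtains W where "has_jet (\<lambda>b t. u b t $ i) b W"
proof -
  have "has_jet (\<lambda>b t. (e1 $ i) * (exp (- (b \<bullet> e1)) * X t - r1 t) + (e2 $ i) * (exp (- (b \<bullet> e2)) * Y t - r2 t)) b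
     (\<lambda>t. (e1 $ i) *\<^sub>R ((- (exp (- (b \<bullet> e1)) * X t) *\<^sub>R e1) - 0) + (e2 $ i) *\<^sub>R ((- (exp (- (b \<bullet> e2)) * Y t) *\<^sub>R e2) - 0))"
    by (intro has_jet_cmult has_jet_add has_jet_diff has_jet_expm has_jet_const) auto
  then show thesis
    by (intro that) (rule has_jet_cong[OF _ _ refl], auto simp: u_def algebra_simps)
qed

lemma has_jet_dens: "has_jet (\<lambda>b t. exp (c * G b t)) b (\<lambda>t. exp (c * G b t) *\<^sub>R c *\<^sub>R u b t)"
  by (intro has_jet_exp has_jet_cmult has_jet_G)

section \<open>Explicit integration over the two phases\<close>

lemma Inu_FTC:
  assumes bm: "bm p"
    and f: "\<And>t. 0 \<le> t \<Longrightarrow> t < tau1 \<Longrightarrow> p t = f t" and g: "\<And>t. tau1 \<le> t \<Longrightarrow> t < tau2 \<Longrightarrow> p t = g t"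
    and F: "\<And>x. DERIV F x :> f x" and H: "\<And>x. DERIV H x :> g x"
    and cf: "\<And>x. isCont f x" and cg: "\<And>x. isCont g x"
  shows "Inu p = (F tau1 - F 0) + (H tau2 - H tau1) + p tau2"
proof -
  have t: "0 \<le> tau1" "tau1 \<le> tau2" using tau1_pos tau12 by auto
  have 1: "has_bochner_integral lborel (\<lambda>x. f x * indicator {0..tau1} x) (F tau1 - F 0)"
    by (rule has_bochner_integral_FTC_Icc_real[OF t(1) F cf])
  have 2: "has_bochner_integral lborel (\<lambda>x. g x * indicator {tau1..tau2} x) (H tau2 - H tau1)"
    by (rule has_bochner_integral_FTC_Icc_real[OF t(2) H cg])
  have "(\<integral>t. indicator {0..<tau2} t * p t \<partial>lborel) =
     (\<integral>t. f t * indicator {0..tau1} t + g t * indicator {tau1..tau2} t \<partial>lborel)"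
  proof (rule integral_cong_AE)
    show "(\<lambda>t. indicator {0..<tau2} t * p t) \<in> borel_measurable lborel"
      using bm_integrable[OF bm] by simp
    show "(\<lambda>t. f t * indicator {0..tau1} t + g t * indicator {tau1..tau2} t) \<in> borel_measurable lborel"
      using 1 2 by (auto simp: has_bochner_integral_iff)
    show "AE t in lborel. indicator {0..<tau2} t * p t = f t * indicator {0..tau1} t + g t * indicator {tau1..tau2} t"
      using AE_lborel_singleton[of tau1] AE_lborel_singleton[of tau2]
      by eventually_elim (use t in \<open>auto simp: f g split: split_indicator\<close>)
  qed
  also have "\<dots> = (F tau1 - F 0) + (H tau2 - H tau1)"
    using 1 2 by (auto simp: has_bochner_integral_iff)
  finally show ?thesis by (simp add: Inu_def)
qed

text \<open>Antiderivative of a quadratic polynomial times \<open>exp (- (k * t))\<close>. In each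
  phase a product of two score components times a power of the density has this form.\<close>

definition prim :: "real \<Rightarrow> real \<Rightarrow> real \<Rightarrow> real \<Rightarrow> real \<Rightarrow> real" where
  "prim k p q r t = - exp (- (k * t)) * (p / k + q * (t / k + 1 / k^2) + r * (t^2 / k + 2 * t / k^2 + 2 / k^3))"

lemma DERIV_prim:
  assumes "k \<noteq> 0"
  shows "DERIV (prim k p q r) t :> (p + q * t + r * t\<^sup>2) * exp (- (k * t))"
  unfolding prim_def[abs_def]
  using assms
  by (auto intro!: derivative_eq_intros simp: field_simps power2_eq_square power3_eq_cube)

lemma Inu_quad:
  assumes bm: "bm f" and k: "k1 \<noteq> 0" "k2 \<noteq> 0"
    and f: "\<And>t. 0 \<le> t \<Longrightarrow> t < tau1 \<Longrightarrow> f t = (p1 + q1 * t + s1 * t\<^sup>2) * exp (- (k1 * t))"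
    and g: "\<And>t. tau1 \<le> t \<Longrightarrow> t < tau2 \<Longrightarrow> f t = (p2 + q2 * t + s2 * t\<^sup>2) * exp (- (k2 * t))"
  shows "Inu f = (prim k1 p1 q1 s1 tau1 - prim k1 p1 q1 s1 0) +
    (prim k2 p2 q2 s2 tau2 - prim k2 p2 q2 s2 tau1) + f tau2"
  by (rule Inu_FTC[OF bm f g DERIV_prim[OF k(1)] DERIV_prim[OF k(2)]]) auto

lemma G_cases:
  "0 \<le> t \<Longrightarrow> t < tau1 \<Longrightarrow> G b t = - (b \<bullet> e1) - exp (- (b \<bullet> e1)) * t"
  "tau1 \<le> t \<Longrightarrow> t < tau2 \<Longrightarrow> G b t = - (b \<bullet> e2) - exp (- (b \<bullet> e1)) * tau1 - exp (- (b \<bullet> e2)) * (t - tau1)"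
  "tau2 \<le> t \<Longrightarrow> G b t = - exp (- (b \<bullet> e1)) * tau1 - exp (- (b \<bullet> e2)) * (tau2 - tau1)"
  using tau1_pos tau12 by (auto simp: G_def r1_def r2_def X_def Y_def)

lemma u_cases:
  "0 \<le> t \<Longrightarrow> t < tau1 \<Longrightarrow> u b t = (exp (- (b \<bullet> e1)) * t - 1) *\<^sub>R e1"
  "tau1 \<le> t \<Longrightarrow> t < tau2 \<Longrightarrow> u b t = (exp (- (b \<bullet> e1)) * tau1) *\<^sub>R e1 + (exp (- (b \<bullet> e2)) * (t - tau1) - 1) *\<^sub>R e2"
  "tau2 \<le> t \<Longrightarrow> u b t = (exp (- (b \<bullet> e1)) * tau1) *\<^sub>R e1 + (exp (- (b \<bullet> e2)) * (tau2 - tau1)) *\<^sub>R e2"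
  using tau1_pos tau12 by (auto simp: u_def r1_def r2_def X_def Y_def)

text \<open>The masses of the two phases and of the atom telescope. Having this for every
  \<open>b\<close>, and not just at the truth, is what lets \<open>xi_0\<close> differentiate it in
  the parameter.\<close>

lemma Inu_dens_1: "Inu (\<lambda>t. exp (G b t)) = 1"
proof -
  define m1 m2 where "m1 = exp (- (b \<bullet> e1))" and "m2 = exp (- (b \<bullet> e2))"
  have m: "m1 > 0" "m2 > 0" by (auto simp: m1_def m2_def)
  have ed: "exp (a - c) = exp a * exp (- c)" for a c :: real
    by (simp flip: exp_add)
  have e2: "exp (- (m2 * (t - tau1))) = exp (m2 * tau1) * exp (- (m2 * t))" for t
    by (simp add: algebra_simps flip: exp_add)
  define q where "q = m2 * (exp (- (m1 * tau1)) * exp (m2 * tau1))"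
  have "Inu (\<lambda>t. exp (G b t)) = (prim m1 m1 0 0 tau1 - prim m1 m1 0 0 0) +
     (prim m2 q 0 0 tau2 - prim m2 q 0 0 tau1) + exp (G b tau2)"
    by (rule Inu_quad) (use m in \<open>auto simp: G_cases m1_def[symmetric] m2_def[symmetric] ed e2 q_def\<close>)
  also have "\<dots> = 1"
    using m by (simp add: G_cases prim_def m1_def[symmetric] m2_def[symmetric] ed e2 q_def)
      (simp add: exp_minus)
  finally show ?thesis .
qed

section \<open>The estimating function and its moments\<close>

definition xi :: "real \<Rightarrow> real^2 \<Rightarrow> real^2" where
  "xi \<beta> b = (\<chi> i. Inu (\<lambda>t. u b t $ i * exp ((\<beta> + 1) * G b t)))"

text \<open>Gradient of the loss of one observation, divided by \<open>\<beta> + 1\<close>. At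
  \<open>\<beta> = 0\<close> it is minus the score because \<open>xi 0 b = 0\<close>, so the
  likelihood and the divergence share one estimating equation.\<close>

definition psi :: "real \<Rightarrow> real^2 \<Rightarrow> real \<Rightarrow> real^2" where
  "psi \<beta> b t = xi \<beta> b - exp (\<beta> * G b t) *\<^sub>R u b t"

definition Jm :: "real \<Rightarrow> real^2 \<Rightarrow> real^2^2" where
  "Jm \<gamma> b = (\<chi> i j. Inu (\<lambda>t. u b t $ i * u b t $ j * exp ((\<gamma> + 1) * G b t)))"

definition Km :: "real \<Rightarrow> real^2 \<Rightarrow> real^2^2" where
  "Km \<beta> b = Jm (2 * \<beta>) b - (\<chi> i j. xi \<beta> b $ i * xi \<beta> b $ j)"

lemma bm_psi[intro!]: "bm (\<lambda>t. psi \<beta> b t $ i)"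
  unfolding psi_def vector_minus_component vector_scaleR_component by auto

text \<open>The score has mean zero: the total mass is constant in the parameter, hence minimal
  everywhere, so its first-order term vanishes.\<close>

lemma xi_0: "xi 0 b = 0"
proof -
  have "has_jet (\<lambda>b _. Inu (\<lambda>t. exp (1 * G b t))) b (\<lambda>_. xi 0 b)"
    by (rule has_jet_cong[OF has_jet_Inu[OF has_jet_dens[of 1]]])
       (auto simp: xi_def vec_eq_iff forall_2 mult.commute)
  from has_jet_min_zero[OF this, of 1] show ?thesis by (simp add: Inu_dens_1)
qed

text \<open>Differentiating \<open>xi\<close> produces the exponent \<open>\<beta> + 1\<close> where
  the sample part produces \<open>\<beta>\<close>. After integration against the density the terms
  with the derivative \<open>W\<close> of the score cancel, and the factors
  \<open>\<beta> + 1\<close> and \<open>\<beta>\<close> differ by one, which leaves exactly one copy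
  of the integrand of \<open>Jm\<close>.\<close>

lemma psi_jet:
  obtains D where "has_jet (\<lambda>b t. psi \<beta> b t $ i) b D"
    "\<And>j. Inu (\<lambda>t. D t $ j * exp (G b t)) = Jm \<beta> b $ i $ j"
proof -
  obtain W where W: "has_jet (\<lambda>b t. u b t $ i) b W" by (rule has_jet_u)
  define P where "P c t = u b t $ i *\<^sub>R exp (c * G b t) *\<^sub>R c *\<^sub>R u b t + exp (c * G b t) *\<^sub>R W t" for c t
  have P: "has_jet (\<lambda>b t. u b t $ i * exp (c * G b t)) b (P c)" for c
    unfolding P_def by (intro has_jet_mult W has_jet_dens)
  define v where "v = (vector [Inu (\<lambda>t. P (\<beta> + 1) t $ 1), Inu (\<lambda>t. P (\<beta> + 1) t $ 2)] :: real^2)"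
  have v: "v $ j = Inu (\<lambda>t. P (\<beta> + 1) t $ j)" for j
    using exhaust_2[of j] by (auto simp: v_def)
  have "has_jet (\<lambda>b t. Inu (\<lambda>t. u b t $ i * exp ((\<beta> + 1) * G b t)) - u b t $ i * exp (\<beta> * G b t)) b
     (\<lambda>t. v - P \<beta> t)"
    unfolding v_def by (intro has_jet_diff has_jet_Inu P)
  then have 1: "has_jet (\<lambda>b t. psi \<beta> b t $ i) b (\<lambda>t. v - P \<beta> t)"
    by (rule has_jet_cong) (auto simp: psi_def xi_def)
  have bW: "bm (\<lambda>t. W t $ j)" for j using exhaust_2[of j] has_jet_bm[OF W] by auto
  have bP: "bm (\<lambda>t. P c t $ j)" for c j
    unfolding P_def using bW by (auto simp: vector_add_component)
  have 2: "Inu (\<lambda>t. (v - P \<beta> t) $ j * exp (G b t)) = Jm \<beta> b $ i $ j" for j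
  proof -
    have "Inu (\<lambda>t. (v - P \<beta> t) $ j * exp (G b t)) = Inu (\<lambda>t. v $ j * exp (G b t) - P \<beta> t $ j * exp (G b t))"
      by (simp add: algebra_simps)
    also have "\<dots> = v $ j - Inu (\<lambda>t. P \<beta> t $ j * exp (G b t))"
      by (subst Inu_diff) (auto simp: Inu_cmult Inu_dens_1 intro: bP)
    also have "\<dots> = Inu (\<lambda>t. P (\<beta> + 1) t $ j - P \<beta> t $ j * exp (G b t))"
      unfolding v by (subst Inu_diff) (auto intro: bP)
    also have "(\<lambda>t. P (\<beta> + 1) t $ j - P \<beta> t $ j * exp (G b t)) = (\<lambda>t. u b t $ i * u b t $ j * exp ((\<beta> + 1) * G b t))"
      by (auto simp: P_def distrib_right exp_add algebra_simps)
    finally show ?thesis by (simp add: Jm_def)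
  qed
  show thesis by (rule that[OF 1 2])
qed

lemma Inu_psi: "Inu (\<lambda>t. psi \<beta> b t $ i * exp (G b t)) = 0"
proof -
  have "Inu (\<lambda>t. psi \<beta> b t $ i * exp (G b t)) =
    Inu (\<lambda>t. xi \<beta> b $ i * exp (G b t) - u b t $ i * exp ((\<beta> + 1) * G b t))"
    by (simp add: psi_def algebra_simps exp_add)
  also have "\<dots> = 0"
    by (subst Inu_diff) (auto simp: Inu_cmult Inu_dens_1 xi_def)
  finally show ?thesis .
qed

lemma Inu_psi_psi: "Inu (\<lambda>t. psi \<beta> b t $ i * psi \<beta> b t $ j * exp (G b t)) = Km \<beta> b $ i $ j"
proof -
  have "Inu (\<lambda>t. psi \<beta> b t $ i * psi \<beta> b t $ j * exp (G b t)) =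
    Inu (\<lambda>t. (u b t $ i * u b t $ j * exp ((2 * \<beta> + 1) * G b t) + (xi \<beta> b $ i * xi \<beta> b $ j) * exp (G b t))
       - (xi \<beta> b $ i * (u b t $ j * exp ((\<beta> + 1) * G b t)) + xi \<beta> b $ j * (u b t $ i * exp ((\<beta> + 1) * G b t))))"
  proof (rule arg_cong[where f=Inu], rule ext)
    fix t
    have e: "exp ((2 * \<beta> + 1) * G b t) = exp (\<beta> * G b t) * exp (\<beta> * G b t) * exp (G b t)"
      "exp ((\<beta> + 1) * G b t) = exp (\<beta> * G b t) * exp (G b t)"
      by (simp_all add: algebra_simps flip: exp_add)
    show "psi \<beta> b t $ i * psi \<beta> b t $ j * exp (G b t) =
       (u b t $ i * u b t $ j * exp ((2 * \<beta> + 1) * G b t) + (xi \<beta> b $ i * xi \<beta> b $ j) * exp (G b t))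
       - (xi \<beta> b $ i * (u b t $ j * exp ((\<beta> + 1) * G b t)) + xi \<beta> b $ j * (u b t $ i * exp ((\<beta> + 1) * G b t)))"
      unfolding e by (simp add: psi_def algebra_simps)
  qed
  also have "\<dots> = (Jm (2 * \<beta>) b $ i $ j + (xi \<beta> b $ i * xi \<beta> b $ j)) -
     (xi \<beta> b $ i * xi \<beta> b $ j + xi \<beta> b $ j * xi \<beta> b $ i)"
  proof (subst Inu_diff)
    show "Inu (\<lambda>t. u b t $ i * u b t $ j * exp ((2 * \<beta> + 1) * G b t) + (xi \<beta> b $ i * xi \<beta> b $ j) * exp (G b t)) -
      Inu (\<lambda>t. xi \<beta> b $ i * (u b t $ j * exp ((\<beta> + 1) * G b t)) + xi \<beta> b $ j * (u b t $ i * exp ((\<beta> + 1) * G b t))) =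
      (Jm (2 * \<beta>) b $ i $ j + (xi \<beta> b $ i * xi \<beta> b $ j)) - (xi \<beta> b $ i * xi \<beta> b $ j + xi \<beta> b $ j * xi \<beta> b $ i)"
      by (subst Inu_add; (subst Inu_add)?; auto simp only: Inu_cmult Inu_dens_1 Jm_def xi_def vec_lambda_beta
            intro!: bm_mult bm_add bm_exp bm_G bm_const bm_u)
  qed auto
  finally show ?thesis by (simp add: Km_def)
qed

end

section \<open>Explicit covariance matrices\<close>

context step_stress
begin

text \<open>At the atom the value itself is forced to vanish. Elsewhere only almost everywhere
  vanishing follows; continuity upgrades it, since a positive value would persist on an interval of
  positive length.\<close>

lemma Inu_zeroD:
  assumes bm: "bm f" and nn: "\<And>t. 0 \<le> f t" and z: "Inu f = 0"
  shows "f tau2 = 0"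
    and "\<And>a b t. 0 \<le> a \<Longrightarrow> b \<le> tau2 \<Longrightarrow> continuous_on {a<..<b} f \<Longrightarrow> a < t \<Longrightarrow> t < b \<Longrightarrow> f t = 0"
proof -
  have "(\<integral>t. indicator {0..<tau2} t * f t \<partial>lborel) \<ge> 0"
    by (intro integral_nonneg_AE AE_I2) (simp add: nn)
  then have zz: "(\<integral>t. indicator {0..<tau2} t * f t \<partial>lborel) = 0" and "f tau2 = 0"
    using z nn[of tau2] by (auto simp: Inu_def)
  then show "f tau2 = 0" by simp
  have ae: "AE t in lborel. indicator {0..<tau2} t * f t = 0"
    using integral_nonneg_eq_0_iff_AE[OF bm_integrable[OF bm]] nn zz by simp
  fix a b t assume ab: "0 \<le> a" "b \<le> tau2" and cont: "continuous_on {a<..<b} f" and t: "a < t" "t < b"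
  show "f t = 0"
  proof (rule ccontr)
    assume "f t \<noteq> 0"
    then have pos: "f t > 0" using nn[of t] by simp
    have "isCont f t" using cont t by (simp add: continuous_on_eq_continuous_at)
    then have "(f \<longlongrightarrow> f t) (nhds t)" by (simp add: isCont_def tendsto_at_iff_tendsto_nhds)
    then have "eventually (\<lambda>s. f s > 0) (nhds t)" using order_tendstoD(1) pos by blast
    then obtain d where d: "d > 0" "\<And>s. dist s t < d \<Longrightarrow> f s > 0"
      by (auto simp: eventually_nhds_metric)
    define lo hi where "lo = max a (t - d)" and "hi = min b (t + d)"
    have lh: "lo < hi" using t d by (auto simp: lo_def hi_def)
    have P: "f s > 0 \<and> 0 \<le> s \<and> s < tau2" if "s \<in> {lo<..<hi}" for s
      using that ab d(2)[of s] by (auto simp: lo_def hi_def dist_real_def)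
    from ae have "AE s in lborel. s \<notin> {lo<..<hi}"
      by (rule eventually_mono) (use P in fastforce)
    then have "emeasure lborel {lo<..<hi} = 0" by (subst (asm) AE_iff_measurable[of "{lo<..<hi}"]) auto
    then show False using lh by simp
  qed
qed

text \<open>Such a matrix is a Gram matrix, so its definiteness becomes the question whether
  \<open>f t \<bullet> v\<close> can vanish throughout.\<close>

lemma quad_form_Inu:
  fixes f :: "real \<Rightarrow> real^2" and A :: "real^2^2"
  assumes b: "bm (\<lambda>t. f t $ 1)" "bm (\<lambda>t. f t $ 2)" "bm w"
    and A: "\<And>i j. A $ i $ j = Inu (\<lambda>t. f t $ i * f t $ j * w t)"
  shows "v \<bullet> (A *v v) = Inu (\<lambda>t. (f t \<bullet> v)\<^sup>2 * w t)"
proof -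
  have bb: "bm (\<lambda>t. f t $ i * f t $ j * w t)" for i j :: 2
    using b exhaust_2[of i] exhaust_2[of j] by auto
  have "Inu (\<lambda>t. (f t \<bullet> v)\<^sup>2 * w t) = Inu (\<lambda>t. (v$1 * v$1) * (f t $ 1 * f t $ 1 * w t) +
     ((v$1 * v$2) * (f t $ 1 * f t $ 2 * w t) + ((v$2 * v$1) * (f t $ 2 * f t $ 1 * w t) + (v$2 * v$2) * (f t $ 2 * f t $ 2 * w t))))"
    by (rule arg_cong[where f=Inu], rule ext) (simp add: inner_real2 power2_eq_square algebra_simps)
  also have "\<dots> = (v$1 * v$1) * A$1$1 + ((v$1 * v$2) * A$1$2 + ((v$2 * v$1) * A$2$1 + (v$2 * v$2) * A$2$2))"
  proof -
    have c: "bm (\<lambda>t. k * (f t $ i * f t $ j * w t))" for k and i j :: 2 using bb[of i j] by (rule bm_mult[OF bm_const])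
    show ?thesis
      unfolding A
      by (simp only: Inu_add[OF c bm_add[OF c bm_add[OF c c]]] Inu_add[OF c bm_add[OF c c]] Inu_add[OF c c] Inu_cmult)
  qed
  finally show ?thesis by (simp add: quad_form_real2 algebra_simps)
qed

lemma Jm_quad: "v \<bullet> (Jm \<gamma> b *v v) = Inu (\<lambda>t. (u b t \<bullet> v)\<^sup>2 * exp ((\<gamma> + 1) * G b t))"
  by (rule quad_form_Inu) (auto simp: Jm_def)

lemma Km_quad: "v \<bullet> (Km \<beta> b *v v) = Inu (\<lambda>t. (psi \<beta> b t \<bullet> v)\<^sup>2 * exp (G b t))"
  by (rule quad_form_Inu) (auto simp: Inu_psi_psi)

lemma Jm_sym: "Jm \<gamma> b $ i $ j = Jm \<gamma> b $ j $ i"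
  by (simp add: Jm_def mult.commute[of "u b _ $ i"])

lemma Km_sym: "Km \<gamma> b $ i $ j = Km \<gamma> b $ j $ i"
  by (simp add: Km_def Jm_sym[of _ _ i j] mult.commute)

text \<open>For distinct stress levels the two design vectors form a basis of the plane; this is the
  identifiability of the parameter.\<close>

lemma vec_zeroI:
  assumes "x1 \<noteq> x2" "e1 \<bullet> v = 0" "e2 \<bullet> v = 0" shows "v = 0"
proof -
  have "v$1 + x1 * v$2 = 0" "v$1 + x2 * v$2 = 0" using assms by (auto simp: inner_real2)
  moreover have "(x1 - x2) * v$2 = (v$1 + x1 * v$2) - (v$1 + x2 * v$2)" by (simp add: algebra_simps)
  ultimately have "(x1 - x2) * v$2 = 0" by simp
  then show ?thesis using assms(1) \<open>v$1 + x1 * v$2 = 0\<close> by (auto simp: vec_eq_iff forall_2)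
qed

lemma cont_regions:
  "continuous_on {0<..<tau1} (G b)" "continuous_on {tau1<..<tau2} (G b)"
  "continuous_on {0<..<tau1} (\<lambda>t. u b t \<bullet> v)" "continuous_on {tau1<..<tau2} (\<lambda>t. u b t \<bullet> v)"
proof -
  have "continuous_on {0<..<tau1} (\<lambda>t. - (b \<bullet> e1) - exp (- (b \<bullet> e1)) * t)"
    by (intro continuous_intros)
  then show "continuous_on {0<..<tau1} (G b)"
    by (subst continuous_on_cong[OF refl G_cases(1)]) auto
  have "continuous_on {tau1<..<tau2} (\<lambda>t. - (b \<bullet> e2) - exp (- (b \<bullet> e1)) * tau1 - exp (- (b \<bullet> e2)) * (t - tau1))"
    by (intro continuous_intros)
  then show "continuous_on {tau1<..<tau2} (G b)"
    by (subst continuous_on_cong[OF refl G_cases(2)]) auto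
  have "continuous_on {0<..<tau1} (\<lambda>t. ((exp (- (b \<bullet> e1)) * t - 1) *\<^sub>R e1) \<bullet> v)"
    by (intro continuous_intros)
  then show "continuous_on {0<..<tau1} (\<lambda>t. u b t \<bullet> v)"
    by (subst continuous_on_cong[OF refl]) (auto simp: u_cases)
  have "continuous_on {tau1<..<tau2} (\<lambda>t. ((exp (- (b \<bullet> e1)) * tau1) *\<^sub>R e1 + (exp (- (b \<bullet> e2)) * (t - tau1) - 1) *\<^sub>R e2) \<bullet> v)"
    by (intro continuous_intros)
  then show "continuous_on {tau1<..<tau2} (\<lambda>t. u b t \<bullet> v)"
    by (subst continuous_on_cong[OF refl]) (auto simp: u_cases)
qed

text \<open>In the first phase \<open>u b t \<bullet> v\<close> is a nonconstant affine function of
  \<open>t\<close> times \<open>e1 \<bullet> v\<close>. It cannot vanish at the two times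
  \<open>tau1 / 2\<close> and \<open>tau1 / 3\<close> unless \<open>e1 \<bullet> v = 0\<close>. The
  value at the atom then forces \<open>e2 \<bullet> v = 0\<close>.\<close>

lemma Jm_pos:
  assumes x: "x1 \<noteq> x2" and v: "v \<noteq> 0"
  shows "v \<bullet> (Jm \<gamma> b *v v) > 0"
proof -
  define f where "f t = (u b t \<bullet> v)\<^sup>2 * exp ((\<gamma> + 1) * G b t)" for t
  have bm: "bm f" unfolding f_def power2_eq_square by auto
  have "Inu f \<ge> 0" by (rule Inu_nonneg[OF bm]) (simp add: f_def)
  moreover have "Inu f \<noteq> 0"
  proof
    assume z: "Inu f = 0"
    note Z = Inu_zeroD[OF bm _ z]
    have "f t = 0" if "0 < t" "t < tau1" for t
      by (rule Z(2)[of 0 tau1]) (use that tau12 in \<open>auto simp: f_def intro!: continuous_intros cont_regions\<close>)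
    then have 1: "(exp (- (b \<bullet> e1)) * t - 1) * (e1 \<bullet> v) = 0" if "0 < t" "t < tau1" for t
      using that by (fastforce simp: f_def u_cases)
    have e1: "e1 \<bullet> v = 0"
    proof (rule ccontr)
      assume "e1 \<bullet> v \<noteq> 0"
      then have "exp (- (b \<bullet> e1)) * (tau1 / 2) = 1" "exp (- (b \<bullet> e1)) * (tau1 / 3) = 1"
        using 1[of "tau1 / 2"] 1[of "tau1 / 3"] tau1_pos by auto
      then show False by simp
    qed
    have "f tau2 = 0" by (rule Z(1)) (simp add: f_def)
    then have "e2 \<bullet> v = 0" using e1 tau12 by (auto simp: f_def u_cases inner_simps)
    with e1 vec_zeroI x v show False by blast
  qed
  ultimately show ?thesis unfolding Jm_quad f_def[symmetric] by simp
qed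

text \<open>If \<open>w\<close> were nonzero, the vanishing derivative would give
  \<open>\<beta> * (m * (t - s)) = 1 + \<beta>\<close> on the whole interval. Comparing two times
  yields \<open>\<beta> = 0\<close>, and the equation then reads 0 = 1.\<close>

lemma const_exp_poly_zero:
  fixes a b w c m \<beta> :: real
  assumes ab: "a < b" and m: "m > 0" and be: "\<beta> \<ge> 0"
    and eq: "\<And>t. a < t \<Longrightarrow> t < b \<Longrightarrow> w * (m * (t - s) - 1) * exp (- (\<beta> * m * t)) = c"
  shows "w = 0"
proof (rule ccontr)
  assume w: "w \<noteq> 0"
  have d: "\<beta> * (m * (t - s)) = 1 + \<beta>" if t: "a < t" "t < b" for t
  proof -
    let ?f = "\<lambda>t. w * (m * (t - s) - 1) * exp (- (\<beta> * m * t))"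
    have "(?f has_real_derivative w * m * (1 + \<beta> - \<beta> * (m * (t - s))) * exp (- (\<beta> * m * t))) (at t)"
      by (auto intro!: derivative_eq_intros simp: algebra_simps)
    moreover have "(?f has_real_derivative 0) (at t)"
    proof (rule has_field_derivative_transform_within_open[of "\<lambda>_. c" _ _ "{a<..<b}"])
      show "((\<lambda>_. c) has_field_derivative 0) (at t)" by simp
    qed (use t eq in auto)
    ultimately have "w * m * (1 + \<beta> - \<beta> * (m * (t - s))) * exp (- (\<beta> * m * t)) = 0"
      using DERIV_unique by blast
    then show ?thesis using w m by simp
  qed
  define t1 t2 where "t1 = a + (b - a) / 3" and "t2 = a + (b - a) / 2"
  have t: "a < t1" "t1 < b" "a < t2" "t2 < b" "t1 \<noteq> t2" using ab by (auto simp: t1_def t2_def field_simps)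
  have "\<beta> * (m * (t1 - s)) = \<beta> * (m * (t2 - s))" using d[of t1] d[of t2] t by simp
  then have "\<beta> = 0" using m t by auto
  then show False using d[of t1] t by simp
qed

text \<open>\<open>Km\<close> is a covariance, so degeneracy means only that
  \<open>exp (\<beta> * G b t) * (u b t \<bullet> v)\<close> is constant rather than zero. The first
  phase excludes this unless \<open>e1 \<bullet> v = 0\<close>; then the constant is 0, and the
  second phase can be treated with \<open>c = 0\<close>.\<close>

lemma Km_pos:
  assumes x: "x1 \<noteq> x2" and v: "v \<noteq> 0" and be: "\<beta> \<ge> 0"
  shows "v \<bullet> (Km \<beta> b *v v) > 0"
proof -
  define m1 m2 where "m1 = exp (- (b \<bullet> e1))" and "m2 = exp (- (b \<bullet> e2))"
  define f where "f t = (psi \<beta> b t \<bullet> v)\<^sup>2 * exp (G b t)" for t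
  have bm: "bm f" unfolding f_def power2_eq_square by auto
  have f: "f t = (xi \<beta> b \<bullet> v - exp (\<beta> * G b t) * (u b t \<bullet> v))\<^sup>2 * exp (G b t)" for t
    by (simp add: f_def psi_def inner_simps)
  have "Inu f \<ge> 0" by (rule Inu_nonneg[OF bm]) (simp add: f_def)
  moreover have "Inu f \<noteq> 0"
  proof
    assume z: "Inu f = 0"
    note Z = Inu_zeroD[OF bm _ z]
    have "f t = 0" if "0 < t" "t < tau1" for t
      by (rule Z(2)[of 0 tau1]) (use that tau12 in \<open>auto simp: f intro!: continuous_intros cont_regions\<close>)
    then have "exp (\<beta> * G b t) * (u b t \<bullet> v) = xi \<beta> b \<bullet> v" if "0 < t" "t < tau1" for t
      using that by (fastforce simp: f)
    then have 1: "exp (\<beta> * (- (b \<bullet> e1) - m1 * t)) * ((m1 * t - 1) * (e1 \<bullet> v)) = xi \<beta> b \<bullet> v" if "0 < t" "t < tau1" for t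
      using that by (auto simp: G_cases u_cases m1_def)
    have "e1 \<bullet> v = 0"
    proof (rule const_exp_poly_zero[OF tau1_pos, where m=m1 and \<beta>=\<beta> and s=0])
      fix t assume t: "0 < t" "t < tau1"
      have "exp (\<beta> * (- (b \<bullet> e1) - m1 * t)) = exp (- (\<beta> * (b \<bullet> e1))) * exp (- (\<beta> * m1 * t))"
        by (simp add: algebra_simps flip: exp_add)
      then show "(e1 \<bullet> v) * (m1 * (t - 0) - 1) * exp (- (\<beta> * m1 * t)) = (xi \<beta> b \<bullet> v) / exp (- (\<beta> * (b \<bullet> e1)))"
        using 1[OF t] by (simp add: field_simps)
    qed (use be in \<open>auto simp: m1_def\<close>)
    moreover from this have c0: "xi \<beta> b \<bullet> v = 0" using 1[of "tau1 / 2"] tau1_pos by simp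
    moreover have "e2 \<bullet> v = 0"
    proof (rule const_exp_poly_zero[OF tau12, where m=m2 and \<beta>=\<beta> and s=tau1 and c=0])
      fix t assume t: "tau1 < t" "t < tau2"
      have "f t = 0"
        by (rule Z(2)[of tau1 tau2]) (use t tau1_pos in \<open>auto simp: f intro!: continuous_intros cont_regions\<close>)
      then have "u b t \<bullet> v = 0" using c0 by (auto simp: f)
      then have "(m2 * (t - tau1) - 1) * (e2 \<bullet> v) = 0"
        using t \<open>e1 \<bullet> v = 0\<close> by (auto simp: u_cases inner_simps m2_def)
      then show "(e2 \<bullet> v) * (m2 * (t - tau1) - 1) * exp (- (\<beta> * m2 * t)) = 0" by (metis mult.commute mult_zero_left)
    qed (use be in \<open>auto simp: m2_def\<close>)
    ultimately show False using vec_zeroI x v by blast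
  qed
  ultimately show ?thesis unfolding Km_quad f_def[symmetric] by simp
qed

section \<open>Closed forms of the matrix entries\<close>

lemma prim_scaled:
  assumes "m > 0" "g > 0"
  shows "prim (g * m) (C * p) (C * (q * m)) (C * (r * m\<^sup>2)) t =
    - (C / m) * exp (- (g * m * t)) * (p / g + q * (g * m * t + 1) / g\<^sup>2 + r * ((g * m * t)\<^sup>2 + 2 * (g * m * t) + 2) / g^3)"
  using assms by (simp add: prim_def field_simps power2_eq_square power3_eq_cube)

text \<open>The factors 1 are kept so that both components match the pattern \<open>U c d\<close> of
  \<open>Inu_score_explicit\<close>, with (c, d) equal to (1, 1) and to (x1, x2).\<close>

lemma u_component:
  "u b t $ 1 = 1 * (exp (- (b \<bullet> e1)) * X t - r1 t) + 1 * (exp (- (b \<bullet> e2)) * Y t - r2 t)"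
  "u b t $ 2 = x1 * (exp (- (b \<bullet> e1)) * X t - r1 t) + x2 * (exp (- (b \<bullet> e2)) * Y t - r2 t)"
  by (auto simp: u_def)

lemma Inu_poly_explicit:
  fixes b :: "real^2" and g :: real
  assumes g: "g > 0"
  defines "m1 \<equiv> exp (- (b \<bullet> e1))" and "m2 \<equiv> exp (- (b \<bullet> e2))"
  assumes bm: "bm f"
   and f1: "\<And>t. 0 \<le> t \<Longrightarrow> t < tau1 \<Longrightarrow> f t = p1 + q1 * (m1 * t) + s1 * (m1 * t)\<^sup>2"
   and f2: "\<And>t. tau1 \<le> t \<Longrightarrow> t < tau2 \<Longrightarrow> f t = p2 + q2 * (m2 * t) + s2 * (m2 * t)\<^sup>2"
  shows "Inu (\<lambda>t. f t * exp (g * G b t)) =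
     exp (- ((g - 1) * (b \<bullet> e1))) *
       ((p1 / g + q1 / g\<^sup>2 + s1 * 2 / g^3)
        - exp (- (g * m1 * tau1)) * (p1 / g + q1 * (g * m1 * tau1 + 1) / g\<^sup>2 + s1 * ((g * m1 * tau1)\<^sup>2 + 2 * (g * m1 * tau1) + 2) / g^3))
     + exp (- ((g - 1) * (b \<bullet> e2))) * exp (- (g * (m1 * tau1 - m2 * tau1))) *
       (exp (- (g * m2 * tau1)) * (p2 / g + q2 * (g * m2 * tau1 + 1) / g\<^sup>2 + s2 * ((g * m2 * tau1)\<^sup>2 + 2 * (g * m2 * tau1) + 2) / g^3)
        - exp (- (g * m2 * tau2)) * (p2 / g + q2 * (g * m2 * tau2 + 1) / g\<^sup>2 + s2 * ((g * m2 * tau2)\<^sup>2 + 2 * (g * m2 * tau2) + 2) / g^3))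
     + f tau2 * exp (- (g * (m1 * tau1 + m2 * (tau2 - tau1))))"
proof -
  have m: "m1 > 0" "m2 > 0" by (auto simp: m1_def m2_def)
  define C1 C2 where "C1 = exp (- (g * (b \<bullet> e1)))"
    and "C2 = exp (- (g * (b \<bullet> e2))) * exp (- (g * (m1 * tau1 - m2 * tau1)))"
  have e1: "exp (g * G b t) = C1 * exp (- (g * m1 * t))" if "0 \<le> t" "t < tau1" for t
    using that by (simp add: G_cases C1_def m1_def algebra_simps flip: exp_add)
  have e2: "exp (g * G b t) = C2 * exp (- (g * m2 * t))" if "tau1 \<le> t" "t < tau2" for t
    using that unfolding C2_def by (simp add: G_cases m1_def m2_def algebra_simps flip: exp_add)
  have e3: "exp (g * G b tau2) = exp (- (g * (m1 * tau1 + m2 * (tau2 - tau1))))"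
    by (simp add: G_cases m1_def m2_def algebra_simps)
  have "Inu (\<lambda>t. f t * exp (g * G b t)) =
     (prim (g * m1) (C1 * p1) (C1 * (q1 * m1)) (C1 * (s1 * m1\<^sup>2)) tau1 - prim (g * m1) (C1 * p1) (C1 * (q1 * m1)) (C1 * (s1 * m1\<^sup>2)) 0) +
     (prim (g * m2) (C2 * p2) (C2 * (q2 * m2)) (C2 * (s2 * m2\<^sup>2)) tau2 - prim (g * m2) (C2 * p2) (C2 * (q2 * m2)) (C2 * (s2 * m2\<^sup>2)) tau1)
     + f tau2 * exp (g * G b tau2)"
  proof (rule Inu_quad)
    fix t
    show "0 \<le> t \<Longrightarrow> t < tau1 \<Longrightarrow> f t * exp (g * G b t) =
      (C1 * p1 + C1 * (q1 * m1) * t + C1 * (s1 * m1\<^sup>2) * t\<^sup>2) * exp (- (g * m1 * t))"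
      by (simp add: f1 e1 power_mult_distrib algebra_simps)
    show "tau1 \<le> t \<Longrightarrow> t < tau2 \<Longrightarrow> f t * exp (g * G b t) =
      (C2 * p2 + C2 * (q2 * m2) * t + C2 * (s2 * m2\<^sup>2) * t\<^sup>2) * exp (- (g * m2 * t))"
      by (simp add: f2 e2 power_mult_distrib algebra_simps)
  qed (use bm m g in auto)
  \<comment> \<open>Integration divides by the rate and lowers its power from \<open>g\<close> to
    \<open>g - 1\<close>; with \<open>g = \<gamma> + 1\<close> this is the factor lambda to the
    power minus gamma of the closed forms.\<close>
  moreover have "C1 / m1 = exp (- ((g - 1) * (b \<bullet> e1)))"
    unfolding C1_def m1_def by (simp add: algebra_simps flip: exp_diff)
  moreover have "C2 / m2 = exp (- ((g - 1) * (b \<bullet> e2))) * exp (- (g * (m1 * tau1 - m2 * tau1)))"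
  proof -
    have "exp (- (g * (b \<bullet> e2))) / m2 = exp (- ((g - 1) * (b \<bullet> e2)))"
      unfolding m2_def by (simp add: algebra_simps flip: exp_diff)
    then show ?thesis unfolding C2_def by (simp only: times_divide_eq_left[symmetric])
  qed
  ultimately show ?thesis
    unfolding prim_scaled[OF m(1) g] prim_scaled[OF m(2) g] e3
    by (simp add: right_diff_distrib)
qed

lemma score_poly:
  fixes b :: "real^2"
  defines "m1 \<equiv> exp (- (b \<bullet> e1))" and "m2 \<equiv> exp (- (b \<bullet> e2))"
  defines "U \<equiv> \<lambda>c d t. c * (m1 * X t - r1 t) + d * (m2 * Y t - r2 t)"
  shows "0 \<le> t \<Longrightarrow> t < tau1 \<Longrightarrow> U c d t = - c + c * (m1 * t)"
    "tau1 \<le> t \<Longrightarrow> t < tau2 \<Longrightarrow> U c d t = (c * m1 * tau1 - d - d * m2 * tau1) + d * (m2 * t)"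
    "U c d tau2 = c * m1 * tau1 + d * m2 * (tau2 - tau1)"
  using tau1_pos tau12 by (auto simp: U_def X_def Y_def r1_def r2_def algebra_simps)

text \<open>All entries at once. For (c, d) = (1, 1) the quantity \<open>P c d\<close> is L and
  \<open>W c d\<close> is (tau2 + h) / lambda2; for (c, d) = (x1, x2) they are the starred L and
  D.\<close>

lemma Inu_score_explicit:
  fixes b :: "real^2" and g :: real
  assumes g: "g > 0"
  defines "m1 \<equiv> exp (- (b \<bullet> e1))" and "m2 \<equiv> exp (- (b \<bullet> e2))"
  defines "U \<equiv> \<lambda>c d t. c * (m1 * X t - r1 t) + d * (m2 * Y t - r2 t)"
  defines "k \<equiv> g * m1 * tau1" and "d1 \<equiv> g * m2 * tau1" and "d2 \<equiv> g * m2 * tau2"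
  defines "P \<equiv> \<lambda>c d. c * m1 * tau1 - d - d * m2 * tau1" and "W \<equiv> \<lambda>c d. c * m1 * tau1 + d * m2 * (tau2 - tau1)"
  defines "Q1 \<equiv> exp (- ((g - 1) * (b \<bullet> e1)))"
  defines "Q2 \<equiv> exp (- ((g - 1) * (b \<bullet> e2))) * exp (- (g * (m1 * tau1 - m2 * tau1)))"
  defines "S \<equiv> exp (- (g * (m1 * tau1 + m2 * (tau2 - tau1))))"
  shows "Inu (\<lambda>t. U c d t * U c' d' t * exp (g * G b t)) =
     c * c' * (Q1 / g * (exp (- k) * (- 1 - (k\<^sup>2 + 2 * k + 2) / g\<^sup>2 + 2 * (k + 1) / g) + 1 + 2 / g\<^sup>2 - 2 / g))
     + Q2 * (P c d * P c' d' * (exp (- d1) - exp (- d2)) / g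
         + d * d' * (exp (- d1) * (d1\<^sup>2 + 2 * d1 + 2) - exp (- d2) * (d2\<^sup>2 + 2 * d2 + 2)) / g^3
         + (P c d * d' + P c' d' * d) * (exp (- d1) * (d1 + 1) - exp (- d2) * (d2 + 1)) / g\<^sup>2)
     + W c d * W c' d' * S"
  and "Inu (\<lambda>t. U c d t * exp (g * G b t)) =
     c * (- (1 - exp (- k)) * Q1 / g + (1 - exp (- k) * (k + 1)) * Q1 / g\<^sup>2)
     + Q2 * (P c d * (exp (- d1) - exp (- d2)) / g
         + d * (exp (- d1) * (d1 + 1) - exp (- d2) * (d2 + 1)) / g\<^sup>2)
     + W c d * S"
proof -
  have sp: "0 \<le> t \<Longrightarrow> t < tau1 \<Longrightarrow> U c d t = - c + c * (m1 * t)"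
    "tau1 \<le> t \<Longrightarrow> t < tau2 \<Longrightarrow> U c d t = (c * m1 * tau1 - d - d * m2 * tau1) + d * (m2 * t)"
    "U c d tau2 = c * m1 * tau1 + d * m2 * (tau2 - tau1)" for c d t
    unfolding U_def m1_def m2_def by (rule score_poly; assumption)+
  have bmU: "bm (U c d)" for c d unfolding U_def by auto
  have P2: "W c d = U c d tau2" for c d using sp(3) by (simp add: W_def)
  have "Inu (\<lambda>t. U c d t * U c' d' t * exp (g * G b t)) =
     Q1 * ((c * c' / g + (- 2 * (c * c')) / g\<^sup>2 + (c * c') * 2 / g^3)
        - exp (- k) * (c * c' / g + (- 2 * (c * c')) * (k + 1) / g\<^sup>2 + (c * c') * (k\<^sup>2 + 2 * k + 2) / g^3))
     + Q2 * (exp (- d1) * (P c d * P c' d' / g + (P c d * d' + P c' d' * d) * (d1 + 1) / g\<^sup>2 + (d * d') * (d1\<^sup>2 + 2 * d1 + 2) / g^3)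
        - exp (- d2) * (P c d * P c' d' / g + (P c d * d' + P c' d' * d) * (d2 + 1) / g\<^sup>2 + (d * d') * (d2\<^sup>2 + 2 * d2 + 2) / g^3))
     + W c d * W c' d' * S"
    unfolding Q1_def Q2_def S_def k_def d1_def d2_def P2 m1_def m2_def
    by (rule Inu_poly_explicit[OF g])
       (use bmU in \<open>auto simp: sp P_def m1_def[symmetric] m2_def[symmetric] power2_eq_square algebra_simps\<close>)
  also have "\<dots> = c * c' * (Q1 / g * (exp (- k) * (- 1 - (k\<^sup>2 + 2 * k + 2) / g\<^sup>2 + 2 * (k + 1) / g) + 1 + 2 / g\<^sup>2 - 2 / g))
     + Q2 * (P c d * P c' d' * (exp (- d1) - exp (- d2)) / g
         + d * d' * (exp (- d1) * (d1\<^sup>2 + 2 * d1 + 2) - exp (- d2) * (d2\<^sup>2 + 2 * d2 + 2)) / g^3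
         + (P c d * d' + P c' d' * d) * (exp (- d1) * (d1 + 1) - exp (- d2) * (d2 + 1)) / g\<^sup>2)
     + W c d * W c' d' * S"
  proof -
    have "Q1 * ((c * c' / g + (- 2 * (c * c')) / g\<^sup>2 + (c * c') * 2 / g^3)
        - exp (- k) * (c * c' / g + (- 2 * (c * c')) * (k + 1) / g\<^sup>2 + (c * c') * (k\<^sup>2 + 2 * k + 2) / g^3))
      = c * c' * (Q1 / g * (exp (- k) * (- 1 - (k\<^sup>2 + 2 * k + 2) / g\<^sup>2 + 2 * (k + 1) / g) + 1 + 2 / g\<^sup>2 - 2 / g))"
      using g by (simp add: field_simps power2_eq_square power3_eq_cube)
    moreover have "exp (- d1) * (A / g + B * (d1 + 1) / g\<^sup>2 + C * (d1\<^sup>2 + 2 * d1 + 2) / g^3)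
        - exp (- d2) * (A / g + B * (d2 + 1) / g\<^sup>2 + C * (d2\<^sup>2 + 2 * d2 + 2) / g^3) =
       A * (exp (- d1) - exp (- d2)) / g + C * (exp (- d1) * (d1\<^sup>2 + 2 * d1 + 2) - exp (- d2) * (d2\<^sup>2 + 2 * d2 + 2)) / g^3
       + B * (exp (- d1) * (d1 + 1) - exp (- d2) * (d2 + 1)) / g\<^sup>2" for A B C
      by (simp add: diff_divide_distrib add_divide_distrib algebra_simps)
    ultimately show ?thesis by (simp only:)
  qed
  finally show "Inu (\<lambda>t. U c d t * U c' d' t * exp (g * G b t)) = \<dots>" .
  have "Inu (\<lambda>t. U c d t * exp (g * G b t)) =
     Q1 * (((- c) / g + c / g\<^sup>2 + 0 * 2 / g^3)
        - exp (- k) * ((- c) / g + c * (k + 1) / g\<^sup>2 + 0 * (k\<^sup>2 + 2 * k + 2) / g^3))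
     + Q2 * (exp (- d1) * (P c d / g + d * (d1 + 1) / g\<^sup>2 + 0 * (d1\<^sup>2 + 2 * d1 + 2) / g^3)
        - exp (- d2) * (P c d / g + d * (d2 + 1) / g\<^sup>2 + 0 * (d2\<^sup>2 + 2 * d2 + 2) / g^3))
     + W c d * S"
    unfolding Q1_def Q2_def S_def k_def d1_def d2_def P2 m1_def m2_def
    by (rule Inu_poly_explicit[OF g])
       (use bmU in \<open>auto simp: sp P_def m1_def[symmetric] m2_def[symmetric] algebra_simps\<close>)
  also have "\<dots> = c * (- (1 - exp (- k)) * Q1 / g + (1 - exp (- k) * (k + 1)) * Q1 / g\<^sup>2)
     + Q2 * (P c d * (exp (- d1) - exp (- d2)) / g
         + d * (exp (- d1) * (d1 + 1) - exp (- d2) * (d2 + 1)) / g\<^sup>2)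
     + W c d * S"
    by (simp add: diff_divide_distrib add_divide_distrib algebra_simps)
  finally show "Inu (\<lambda>t. U c d t * exp (g * G b t)) = \<dots>" .
qed

lemma shift_terms:
  assumes "m1 > 0" "m2 > 0"
  shows "exp (- ((m1 * tau1 - m2 * tau1) / m2) * g / inverse m2) = exp (- (g * (m1 * tau1 - m2 * tau1)))"
    and "exp (- (tau2 + (m1 * tau1 - m2 * tau1) / m2) * g / inverse m2) = exp (- (g * (m1 * tau1 + m2 * (tau2 - tau1))))"
    and "(tau2 + (m1 * tau1 - m2 * tau1) / m2) / inverse m2 = m1 * tau1 + m2 * (tau2 - tau1)"
  using assms by (simp_all add: field_simps)

lemma Jm_eq_Jmat:
  assumes "\<gamma> \<ge> 0"
  shows "Jm \<gamma> (vector [a0, a1]) = Jmat x1 x2 tau1 tau2 a0 a1 \<gamma>"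
proof -
  define b :: "real^2" where "b = vector [a0, a1]"
  have be: "b \<bullet> e1 = a0 + a1 * x1" "b \<bullet> e2 = a0 + a1 * x2" by (auto simp: b_def inner_real2)
  have l: "lam a0 a1 x1 = inverse (exp (- (b \<bullet> e1)))" "lam a0 a1 x2 = inverse (exp (- (b \<bullet> e2)))"
    by (simp_all only: lam_def be[symmetric] exp_minus inverse_inverse_eq)
  have pw: "lam a0 a1 x1 powr \<gamma> = inverse (exp (- (\<gamma> * (b \<bullet> e1))))" "lam a0 a1 x2 powr \<gamma> = inverse (exp (- (\<gamma> * (b \<bullet> e2))))"
    by (simp_all only: lam_def be[symmetric] powr_def exp_minus inverse_inverse_eq ln_exp exp_not_eq_zero if_False)
  have g: "\<gamma> + 1 > 0" using assms by simp
  note I = Inu_score_explicit(1)[OF g, where b=b]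
  define m1 m2 where "m1 = exp (- (b \<bullet> e1))" and "m2 = exp (- (b \<bullet> e2))"
  have m: "m1 > 0" "m2 > 0" by (auto simp: m1_def m2_def)
  note l' = l[folded m1_def m2_def]
  have h: "hsh (lam a0 a1 x1) (lam a0 a1 x2) tau1 = (m1 * tau1 - m2 * tau1) / m2"
    using m by (simp add: hsh_def l' field_simps)
  note E = shift_terms[OF m]
  \<comment> \<open>With the powers of the rates abbreviated and the shift eliminated, both sides
    are polynomial in the remaining exponentials and inverses, and normalization decides the
    equality.\<close>
  define g q1 q2 where g_def: "g = \<gamma> + 1" and q_def: "q1 = exp (- (\<gamma> * (b \<bullet> e1)))" "q2 = exp (- (\<gamma> * (b \<bullet> e2)))"
  have "Jm \<gamma> b = Jmat x1 x2 tau1 tau2 a0 a1 \<gamma>"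
    unfolding Jm_def vec_eq_iff forall_2 vec_lambda_beta u_component I
    unfolding Jmat_def Let_def Bf_def A0_def A1_def A2_def h pw
    unfolding l' m1_def[symmetric] m2_def[symmetric] E add_diff_cancel_right'
    unfolding q_def[symmetric] g_def[symmetric]
    by (simp add: divide_inverse inverse_mult_distrib power_mult_distrib power2_eq_square power3_eq_cube algebra_simps)
  then show ?thesis by (simp add: b_def)
qed

lemma xi_eq_xivec:
  assumes "\<beta> \<ge> 0"
  shows "xi \<beta> (vector [a0, a1]) = xivec x1 x2 tau1 tau2 a0 a1 \<beta>"
proof -
  define b :: "real^2" where "b = vector [a0, a1]"
  have be: "b \<bullet> e1 = a0 + a1 * x1" "b \<bullet> e2 = a0 + a1 * x2" by (auto simp: b_def inner_real2)
  have l: "lam a0 a1 x1 = inverse (exp (- (b \<bullet> e1)))" "lam a0 a1 x2 = inverse (exp (- (b \<bullet> e2)))"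
    by (simp_all only: lam_def be[symmetric] exp_minus inverse_inverse_eq)
  have pw: "lam a0 a1 x1 powr \<beta> = inverse (exp (- (\<beta> * (b \<bullet> e1))))" "lam a0 a1 x2 powr \<beta> = inverse (exp (- (\<beta> * (b \<bullet> e2))))"
    by (simp_all only: lam_def be[symmetric] powr_def exp_minus inverse_inverse_eq ln_exp exp_not_eq_zero if_False)
  have g: "\<beta> + 1 > 0" using assms by simp
  note I = Inu_score_explicit(2)[OF g, where b=b]
  define m1 m2 where "m1 = exp (- (b \<bullet> e1))" and "m2 = exp (- (b \<bullet> e2))"
  have m: "m1 > 0" "m2 > 0" by (auto simp: m1_def m2_def)
  note l' = l[folded m1_def m2_def]
  have h: "hsh (lam a0 a1 x1) (lam a0 a1 x2) tau1 = (m1 * tau1 - m2 * tau1) / m2"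
    using m by (simp add: hsh_def l' field_simps)
  note E = shift_terms[OF m]
  define g q1 q2 where g_def: "g = \<beta> + 1" and q_def: "q1 = exp (- (\<beta> * (b \<bullet> e1)))" "q2 = exp (- (\<beta> * (b \<bullet> e2)))"
  have "xi \<beta> b = xivec x1 x2 tau1 tau2 a0 a1 \<beta>"
    unfolding xi_def vec_eq_iff forall_2 vec_lambda_beta u_component I
    unfolding xivec_def Let_def Mf_def A0_def A1_def h pw
    unfolding l' m1_def[symmetric] m2_def[symmetric] E add_diff_cancel_right'
    unfolding q_def[symmetric] g_def[symmetric]
    by (simp add: divide_inverse inverse_mult_distrib power_mult_distrib power2_eq_square power3_eq_cube algebra_simps)
  then show ?thesis by (simp add: b_def)
qed

lemma Km_eq_Kmat:
  assumes "\<beta> \<ge> 0"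
  shows "Km \<beta> (vector [a0, a1]) = Kmat x1 x2 tau1 tau2 a0 a1 \<beta>"
  using assms by (simp add: Km_def Kmat_def Jm_eq_Jmat xi_eq_xivec)

end

section \<open>Limit theorems for the sample\<close>

context prob_space
begin

lemma prob_Int_ge:
  assumes "A \<in> events" "prob A \<ge> 1 - d / 2" "B \<in> events" "prob B \<ge> 1 - d / 2"
  shows "prob (A \<inter> B) \<ge> 1 - d"
proof -
  have "prob (A \<union> B) + prob (A \<inter> B) = prob A + prob B"
    using assms measure_Un3[of A M B] by (simp add: fmeasurable_def emeasure_eq_measure)
  then show ?thesis using assms prob_le_1[of "A \<union> B"] by linarith
qed

text \<open>\<open>whp P\<close>: the inner probability of \<open>P N\<close> tends to one; no measurability of \<open>P N\<close> is needed.\<close>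
definition whp :: "(nat \<Rightarrow> 'a \<Rightarrow> bool) \<Rightarrow> bool" where
  "whp P \<longleftrightarrow> (\<forall>d>0. \<forall>\<^sub>F N in sequentially. \<exists>A\<in>events. prob A \<ge> 1 - d \<and> (\<forall>\<omega>\<in>A. P N \<omega>))"

lemma whp_mono:
  assumes P: "whp P" and PQ: "\<forall>\<^sub>F N in sequentially. \<forall>\<omega>\<in>space M. P N \<omega> \<longrightarrow> Q N \<omega>"
  shows "whp Q"
  unfolding whp_def
proof (intro allI impI)
  fix d :: real assume "d > 0"
  with P have "\<forall>\<^sub>F N in sequentially. \<exists>A\<in>events. prob A \<ge> 1 - d \<and> (\<forall>\<omega>\<in>A. P N \<omega>)" by (simp add: whp_def)
  with PQ show "\<forall>\<^sub>F N in sequentially. \<exists>A\<in>events. prob A \<ge> 1 - d \<and> (\<forall>\<omega>\<in>A. Q N \<omega>)"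
    by eventually_elim (meson sets.sets_into_space subsetD)
qed

lemma whp_conj:
  assumes P: "whp P" and Q: "whp Q"
  shows "whp (\<lambda>N \<omega>. P N \<omega> \<and> Q N \<omega>)"
  unfolding whp_def
proof (intro allI impI)
  fix d :: real assume "d > 0"
  then have "d / 2 > 0" by simp
  with P Q have "\<forall>\<^sub>F N in sequentially. \<exists>A\<in>events. prob A \<ge> 1 - d / 2 \<and> (\<forall>\<omega>\<in>A. P N \<omega>)"
    "\<forall>\<^sub>F N in sequentially. \<exists>A\<in>events. prob A \<ge> 1 - d / 2 \<and> (\<forall>\<omega>\<in>A. Q N \<omega>)"
    unfolding whp_def by blast+
  then show "\<forall>\<^sub>F N in sequentially. \<exists>A\<in>events. prob A \<ge> 1 - d \<and> (\<forall>\<omega>\<in>A. P N \<omega> \<and> Q N \<omega>)"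
  proof eventually_elim
    case (elim N)
    then obtain A B where AB: "A \<in> events" "prob A \<ge> 1 - d / 2" "\<forall>\<omega>\<in>A. P N \<omega>"
       "B \<in> events" "prob B \<ge> 1 - d / 2" "\<forall>\<omega>\<in>B. Q N \<omega>" by blast
    have "prob (A \<inter> B) \<ge> 1 - d" using AB by (intro prob_Int_ge)
    then show ?case using AB by (intro bexI[of _ "A \<inter> B"]) auto
  qed
qed

lemma whp_ev: assumes "\<forall>\<^sub>F N in sequentially. \<forall>\<omega>\<in>space M. P N \<omega>" shows "whp P"
  unfolding whp_def
proof (intro allI impI)
  fix d :: real assume d: "d > 0"
  from assms show "\<forall>\<^sub>F N in sequentially. \<exists>A\<in>events. prob A \<ge> 1 - d \<and> (\<forall>\<omega>\<in>A. P N \<omega>)"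
    by eventually_elim (use d in \<open>auto intro!: bexI[of _ "space M"] simp: prob_space\<close>)
qed

lemma whp_finite:
  assumes "finite I" "\<And>i. i \<in> I \<Longrightarrow> whp (P i)"
  shows "whp (\<lambda>N \<omega>. \<forall>i\<in>I. P i N \<omega>)"
  using assms
proof (induction I)
  case empty
  show ?case by (rule whp_ev) simp
next
  case (insert x F)
  then have "whp (\<lambda>N \<omega>. P x N \<omega> \<and> (\<forall>i\<in>F. P i N \<omega>))" by (intro whp_conj) auto
  then show ?case by simp
qed

lemma whp_AE: assumes "AE \<omega> in M. \<forall>N. P N \<omega>" shows "whp P"
  unfolding whp_def
proof (intro allI impI always_eventually)
  fix d :: real and N assume d: "d > 0"
  from assms have "AE \<omega> in M. P N \<omega>" by eventually_elim blast
  then obtain B where B: "{\<omega>\<in>space M. \<not> P N \<omega>} \<subseteq> B" "emeasure M B = 0" "B \<in> events" by (rule AE_E)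
  have "prob B = 0" using B by (simp add: measure_def)
  then have "prob (space M - B) = 1" using B by (simp add: prob_compl)
  then show "\<exists>A\<in>events. prob A \<ge> 1 - d \<and> (\<forall>\<omega>\<in>A. P N \<omega>)"
    using B d by (intro bexI[of _ "space M - B"]) auto
qed

lemma whp_probI:
  assumes "(\<lambda>N. prob {\<omega>\<in>space M. \<not> P N \<omega>}) \<longlonglongrightarrow> 0" "\<And>N. {\<omega>\<in>space M. \<not> P N \<omega>} \<in> events"
  shows "whp P"
  unfolding whp_def
proof (intro allI impI)
  fix d :: real assume d: "d > 0"
  from order_tendstoD(2)[OF assms(1) d]
  show "\<forall>\<^sub>F N in sequentially. \<exists>A\<in>events. prob A \<ge> 1 - d \<and> (\<forall>\<omega>\<in>A. P N \<omega>)"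
  proof eventually_elim
    case (elim N)
    have "prob (space M - {\<omega>\<in>space M. \<not> P N \<omega>}) \<ge> 1 - d" using elim assms(2)[of N] by (simp add: prob_compl)
    then show ?case using assms(2)[of N] by (intro bexI[of _ "space M - {\<omega>\<in>space M. \<not> P N \<omega>}"]) auto
  qed
qed

text \<open>A Slutsky argument for bounded functions: outside an event of probability at least
  \<open>1 - d\<close> the difference is at most \<open>2 * B\<close>, so choosing \<open>d\<close>
  of size \<open>e / (2 * (1 + 2 * B))\<close> suffices.\<close>

lemma whp_expectation_diff:
  fixes f g :: "nat \<Rightarrow> 'a \<Rightarrow> real"
  assumes [measurable]: "\<And>N. f N \<in> borel_measurable M" "\<And>N. g N \<in> borel_measurable M"
    and f: "\<And>N \<omega>. \<bar>f N \<omega>\<bar> \<le> B" and g: "\<And>N \<omega>. \<bar>g N \<omega>\<bar> \<le> B"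
    and fg: "\<And>e. e > 0 \<Longrightarrow> whp (\<lambda>N \<omega>. \<bar>f N \<omega> - g N \<omega>\<bar> \<le> e)"
    and lim: "(\<lambda>N. expectation (g N)) \<longlonglongrightarrow> l"
  shows "(\<lambda>N. expectation (f N)) \<longlonglongrightarrow> l"
proof -
  have B0: "B \<ge> 0" using f[of undefined undefined] by linarith
  have "(\<lambda>N. expectation (f N) - expectation (g N)) \<longlonglongrightarrow> 0"
  proof (rule tendstoI)
    fix e :: real assume e: "e > 0"
    define d where "d = e / (2 * (1 + 2 * B))"
    have d: "d > 0" using e B0 by (simp add: d_def)
    from fg[OF d] d have "\<forall>\<^sub>F N in sequentially. \<exists>A\<in>events. prob A \<ge> 1 - d \<and> (\<forall>\<omega>\<in>A. \<bar>f N \<omega> - g N \<omega>\<bar> \<le> d)"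
      unfolding whp_def by blast
    then show "\<forall>\<^sub>F N in sequentially. dist (expectation (f N) - expectation (g N)) 0 < e"
    proof eventually_elim
      case (elim N)
      then obtain A where A: "A \<in> events" "prob A \<ge> 1 - d" "\<And>\<omega>. \<omega> \<in> A \<Longrightarrow> \<bar>f N \<omega> - g N \<omega>\<bar> \<le> d" by blast
      have "\<bar>expectation (f N) - expectation (g N)\<bar> \<le> d + (B + B) * (1 - prob A)"
        by (rule expectation_diff_le) (use A f g d in auto)
      also have "\<dots> \<le> d + (B + B) * d" using A B0 by (intro add_left_mono mult_left_mono) auto
      also have "\<dots> = (1 + 2 * B) * d" by (simp add: algebra_simps)
      also have "\<dots> = e / 2"
      proof -
        define k where "k = 1 + 2 * B"
        have "k > 0" using B0 by (simp add: k_def)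
        then show ?thesis unfolding d_def k_def[symmetric] by simp
      qed
      also have "\<dots> < e" using e by simp
      finally show ?case by (simp add: dist_real_def)
    qed
  qed
  from tendsto_add[OF this lim] show ?thesis by simp
qed

end

section \<open>Sampling under the true parameter\<close>

locale step_stress_sample = step_stress x1 x2 tau1 tau2 + prob_space M
  for x1 x2 tau1 tau2 :: real and M :: "'a measure" +
  fixes T :: "nat \<Rightarrow> 'a \<Rightarrow> real" and b0 :: "real^2"
  assumes T_indep: "indep_vars (\<lambda>_. borel) T UNIV"
    and T_dist: "\<And>i. distributed M lborel (T i) (\<lambda>t. ennreal (life_dens x1 x2 tau1 (b0 $ 1) (b0 $ 2) t))"
begin

lemma T_meas[measurable]: "T i \<in> borel_measurable M"
  using T_dist[of i] by (auto simp: distributed_def)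

lemma life_dens_G: "0 \<le> t \<Longrightarrow> t < tau2 \<Longrightarrow> life_dens x1 x2 tau1 (b0 $ 1) (b0 $ 2) t = exp (G b0 t)"
  and life_dens_nonneg: "life_dens x1 x2 tau1 (b0 $ 1) (b0 $ 2) t \<ge> 0"
proof -
  have be: "b0 \<bullet> e1 = b0$1 + b0$2 * x1" "b0 \<bullet> e2 = b0$1 + b0$2 * x2" by (auto simp: inner_real2)
  show "life_dens x1 x2 tau1 (b0 $ 1) (b0 $ 2) t \<ge> 0"
    by (auto simp: life_dens_def Let_def f1_def f2_def lam_def)
  define l1 l2 where "l1 = exp (b0 \<bullet> e1)" and "l2 = exp (b0 \<bullet> e2)"
  have l: "l1 > 0" "l2 > 0" "lam (b0 $ 1) (b0 $ 2) x1 = l1" "lam (b0 $ 1) (b0 $ 2) x2 = l2"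
     "exp (- (b0 \<bullet> e1)) = 1 / l1" "exp (- (b0 \<bullet> e2)) = 1 / l2"
    unfolding lam_def l1_def l2_def be[symmetric] by (simp_all only: exp_gt_zero exp_minus inverse_eq_divide)
  assume t: "0 \<le> t" "t < tau2"
  show "life_dens x1 x2 tau1 (b0 $ 1) (b0 $ 2) t = exp (G b0 t)"
  proof (cases "t < tau1")
    case True
    have "exp (G b0 t) = exp (- (b0 \<bullet> e1)) * exp (- t / l1)"
    proof -
      have "G b0 t = - (b0 \<bullet> e1) + (- t / l1)" using True t l by (simp add: G_cases)
      then show ?thesis by (simp only: exp_add)
    qed
    then show ?thesis using True t l by (simp add: life_dens_def Let_def f1_def)
  next
    case False
    \<comment> \<open>The shift makes the exponent the cumulative hazard: the full first phase
      contributes \<open>tau1 / l1\<close>, the rest accrues at rate \<open>1 / l2\<close>.\<close>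
    have "- (t + hsh l1 l2 tau1) / l2 = - (1 / l1) * tau1 - (1 / l2) * (t - tau1)"
      using l(1,2) by (simp add: hsh_def field_simps)
    then have "G b0 t = - (b0 \<bullet> e2) + (- (t + hsh l1 l2 tau1) / l2)"
      using False t l by (simp add: G_cases)
    then have "exp (G b0 t) = exp (- (b0 \<bullet> e2)) * exp (- (t + hsh l1 l2 tau1) / l2)"
      by (simp only: exp_add)
    then show ?thesis using False t l tau1_pos by (simp add: life_dens_def Let_def f2_def)
  qed
qed

lemma life_dens_meas[measurable]: "life_dens x1 x2 tau1 (b0 $ 1) (b0 $ 2) \<in> borel_measurable borel"
  unfolding life_dens_def[abs_def] Let_def f1_def f2_def by measurable

text \<open>The total mass one is inherited from the law of \<open>T 0\<close>, without integrating
  the density.\<close>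

lemma life_dens_integrable: "integrable lborel (life_dens x1 x2 tau1 (b0 $ 1) (b0 $ 2))"
  and life_dens_integral: "integral\<^sup>L lborel (life_dens x1 x2 tau1 (b0 $ 1) (b0 $ 2)) = 1"
proof -
  have "(\<integral>\<^sup>+t. ennreal (life_dens x1 x2 tau1 (b0 $ 1) (b0 $ 2) t) \<partial>lborel) = 1"
    using distributed_nn_integral[OF T_dist[of 0], of "\<lambda>_. 1"] by (simp add: emeasure_space_1)
  then have "has_bochner_integral lborel (life_dens x1 x2 tau1 (b0 $ 1) (b0 $ 2)) 1"
    by (intro has_bochner_integral_nn_integral) (auto simp: life_dens_nonneg)
  then show "integrable lborel (life_dens x1 x2 tau1 (b0 $ 1) (b0 $ 2))"
    "integral\<^sup>L lborel (life_dens x1 x2 tau1 (b0 $ 1) (b0 $ 2)) = 1"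
    by (auto simp: has_bochner_integral_iff)
qed

text \<open>The mass beyond \<open>tau2\<close> is read off from both total masses being one.\<close>
lemma expectation_T:
  assumes bm: "bm f"
  shows "expectation (\<lambda>\<omega>. f (T i \<omega>)) = Inu (\<lambda>t. f t * exp (G b0 t))"
proof -
  define p where "p = life_dens x1 x2 tau1 (b0 $ 1) (b0 $ 2)"
  define I where "I = (\<integral>t. indicator {tau2..} t * p t \<partial>lborel)"
  have ip: "integrable lborel (\<lambda>t. indicator {tau2..} t * p t)"
    using integrable_mult_indicator[OF _ life_dens_integrable, of "{tau2..}"] by (simp add: p_def)
  have split: "(\<integral>t. p t * g t \<partial>lborel) = (\<integral>t. indicator {0..<tau2} t * (g t * exp (G b0 t)) \<partial>lborel) + g tau2 * I"
    if g: "bm g" for g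
  proof -
    have "(\<integral>t. p t * g t \<partial>lborel) =
        (\<integral>t. indicator {0..<tau2} t * (g t * exp (G b0 t)) + g tau2 * (indicator {tau2..} t * p t) \<partial>lborel)"
    proof (rule Bochner_Integration.integral_cong[OF refl])
      fix t
      have "g t = g tau2" if "t \<ge> tau2" using g that unfolding bm_def by blast
      moreover have "p t = 0" if "t < 0" using that by (simp add: p_def life_dens_def)
      moreover have "p t = exp (G b0 t)" if "0 \<le> t" "t < tau2" using that life_dens_G by (simp add: p_def)
      ultimately show "p t * g t = indicator {0..<tau2} t * (g t * exp (G b0 t)) + g tau2 * (indicator {tau2..} t * p t)"
        using tau1_pos tau12 by (cases "t < 0"; cases "t < tau2") (auto split: split_indicator)
    qed
    also have "\<dots> = (\<integral>t. indicator {0..<tau2} t * (g t * exp (G b0 t)) \<partial>lborel) + g tau2 * I"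
      unfolding I_def using ip g
      by (subst Bochner_Integration.integral_add) (auto intro!: bm_integrable)
    finally show ?thesis .
  qed
  have "(\<integral>t. p t * 1 \<partial>lborel) = 1" using life_dens_integral by (simp add: p_def)
  with split[of "\<lambda>_. 1"] have "(\<integral>t. indicator {0..<tau2} t * exp (G b0 t) \<partial>lborel) + I = 1" by simp
  with Inu_dens_1[of b0] have I: "I = exp (G b0 tau2)" by (simp add: Inu_def)
  have "expectation (\<lambda>\<omega>. f (T i \<omega>)) = (\<integral>t. p t * f t \<partial>lborel)"
    unfolding p_def using bm T_dist[of i]
    by (intro distributed_integral[symmetric]) (auto simp: life_dens_nonneg)
  also have "\<dots> = Inu (\<lambda>t. f t * exp (G b0 t))"
    unfolding split[OF bm] I by (simp add: Inu_def)
  finally show ?thesis .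
qed

text \<open>At 0 and at \<open>tau1\<close> the exposure of the phase just begun is zero, so a
  failure there contributes a power of the rate without exponential damping. Excluding these times
  is what makes the loss coercive.\<close>

lemma T_AE: "AE \<omega> in M. \<forall>i. T i \<omega> > 0 \<and> T i \<omega> \<noteq> tau1"
proof (subst AE_all_countable, intro allI)
  fix i
  have "AE t in lborel. ennreal (life_dens x1 x2 tau1 (b0 $ 1) (b0 $ 2) t) > 0 \<longrightarrow> t > 0 \<and> t \<noteq> tau1"
    using AE_lborel_singleton[of tau1] AE_lborel_singleton[of 0]
    by eventually_elim (auto simp: life_dens_def Let_def not_less split: if_splits)
  then have "AE t in density lborel (\<lambda>t. ennreal (life_dens x1 x2 tau1 (b0 $ 1) (b0 $ 2) t)). t > 0 \<and> t \<noteq> tau1"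
    by (subst AE_density) auto
  moreover have "distr M lborel (T i) = density lborel (\<lambda>t. ennreal (life_dens x1 x2 tau1 (b0 $ 1) (b0 $ 2) t))"
    using T_dist[of i] by (simp add: distributed_def)
  ultimately have "AE t in distr M lborel (T i). t > 0 \<and> t \<noteq> tau1" by (simp only:)
  then show "AE \<omega> in M. T i \<omega> > 0 \<and> T i \<omega> \<noteq> tau1"
    by (subst (asm) AE_distr_iff) auto
qed

lemma hoeffding_T:
  assumes bm: "bm f" and C: "C > 0" "\<And>t. \<bar>f t\<bar> \<le> C" and N: "N > 0" and e: "e \<ge> 0"
  shows "prob {\<omega>\<in>space M. \<bar>(\<Sum>i<N. f (T i \<omega>)) - real N * Inu (\<lambda>t. f t * exp (G b0 t))\<bar> \<ge> e}
    \<le> 2 * exp (- e\<^sup>2 / (2 * C\<^sup>2 * real N))"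
proof -
  have ind: "indep_vars (\<lambda>_. borel) (\<lambda>i \<omega>. f (T i \<omega>)) {..<N}"
    by (rule indep_vars_compose2[OF indep_vars_subset[OF T_indep]]) (use bm in auto)
  interpret H: Hoeffding_ineq M "{..<N}" "\<lambda>i \<omega>. f (T i \<omega>)" "\<lambda>_. - C" "\<lambda>_. C" "\<Sum>i<N. expectation (\<lambda>\<omega>. f (T i \<omega>))"
  proof (unfold_locales)
    fix i show "AE x in M. f (T i x) \<in> {- C..C}"
      using C(2) by (auto simp: abs_le_iff minus_le_iff)
  qed (use ind in auto)
  have "(\<Sum>i<N. (C - - C)\<^sup>2) > 0" using C N by simp
  from H.Hoeffding_ineq_abs_ge[OF e this]
  have "prob {\<omega>\<in>space M. \<bar>(\<Sum>i<N. f (T i \<omega>)) - real N * Inu (\<lambda>t. f t * exp (G b0 t))\<bar> \<ge> e}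
    \<le> 2 * exp (- 2 * e\<^sup>2 / (\<Sum>i<N. (C - - C)\<^sup>2))"
    by (simp add: expectation_T[OF bm])
  also have "- 2 * e\<^sup>2 / (\<Sum>i<N. (C - - C)\<^sup>2) = - e\<^sup>2 / (2 * C\<^sup>2 * real N)"
    using C N by (simp add: field_simps power2_eq_square)
  finally show ?thesis .
qed

definition avg :: "(real \<Rightarrow> real) \<Rightarrow> nat \<Rightarrow> 'a \<Rightarrow> real" where
  "avg f N \<omega> = (\<Sum>i<N. f (T i \<omega>)) / real N"

lemma LLN:
  assumes bm: "bm f" and e: "e > 0"
  shows "whp (\<lambda>N \<omega>. \<bar>avg f N \<omega> - Inu (\<lambda>t. f t * exp (G b0 t))\<bar> < e)"
proof (rule whp_probI)
  note [measurable] = bm_measurable[OF bm]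
  obtain C where C: "C \<ge> 1" "\<And>t. \<bar>f t\<bar> \<le> C" using bm_bound[OF bm] by metis
  define m where "m = Inu (\<lambda>t. f t * exp (G b0 t))"
  show "{\<omega>\<in>space M. \<not> \<bar>avg f N \<omega> - Inu (\<lambda>t. f t * exp (G b0 t))\<bar> < e} \<in> events" for N
    unfolding avg_def by measurable
  have ev: "\<forall>\<^sub>F N in sequentially. prob {\<omega>\<in>space M. \<not> \<bar>avg f N \<omega> - m\<bar> < e}
      \<le> 2 * exp (- (e\<^sup>2 / (2 * C\<^sup>2)) * real N)"
    using eventually_gt_at_top[of 0]
  proof eventually_elim
    case (elim N)
    have *: "\<bar>S - real N * m\<bar> = real N * \<bar>S / real N - m\<bar>" for S
    proof -
      have "S - real N * m = real N * (S / real N - m)" using elim by (simp add: field_simps)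
      then show ?thesis by (simp only: abs_mult abs_of_nat)
    qed
    have "{\<omega>\<in>space M. \<not> \<bar>avg f N \<omega> - m\<bar> < e} = {\<omega>\<in>space M. \<bar>(\<Sum>i<N. f (T i \<omega>)) - real N * m\<bar> \<ge> real N * e}"
      unfolding avg_def * using elim by auto
    also have "prob \<dots> \<le> 2 * exp (- (real N * e)\<^sup>2 / (2 * C\<^sup>2 * real N))"
      unfolding m_def using hoeffding_T[OF bm, of C N "real N * e"] C elim e by simp
    also have "- (real N * e)\<^sup>2 / (2 * C\<^sup>2 * real N) = - (e\<^sup>2 / (2 * C\<^sup>2)) * real N"
      using elim by (simp add: power2_eq_square)
    finally show ?case .
  qed
  have lim: "(\<lambda>N. 2 * exp (- (e\<^sup>2 / (2 * C\<^sup>2)) * real N)) \<longlonglongrightarrow> 0"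
  proof -
    have "filterlim (\<lambda>N. (e\<^sup>2 / (2 * C\<^sup>2)) * real N) at_top sequentially"
      using e C by (intro filterlim_tendsto_pos_mult_at_top[OF tendsto_const] filterlim_real_sequentially) auto
    then have "(\<lambda>N. exp (- ((e\<^sup>2 / (2 * C\<^sup>2)) * real N))) \<longlonglongrightarrow> 0"
      by (intro filterlim_compose[OF exp_at_bot] filterlim_uminus_at_bot_at_top[THEN filterlim_compose])
    from tendsto_mult_left[OF this, of 2] show ?thesis by simp
  qed
  show "(\<lambda>N. prob {\<omega>\<in>space M. \<not> \<bar>avg f N \<omega> - Inu (\<lambda>t. f t * exp (G b0 t))\<bar> < e}) \<longlonglongrightarrow> 0"
    unfolding m_def[symmetric]
    by (rule real_tendsto_sandwich[OF always_eventually ev tendsto_const lim]) simp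
qed

text \<open>For deviations of size \<open>R * sqrt (real N)\<close> Hoeffding's bound does not
  depend on \<open>N\<close>, so one \<open>R\<close> serves all sample sizes.\<close>

lemma root_N_tight:
  assumes bm: "bm f" and m: "Inu (\<lambda>t. f t * exp (G b0 t)) = 0" and d: "d > 0"
  obtains R where "R > 0" "\<And>N. N > 0 \<Longrightarrow> prob {\<omega>\<in>space M. \<bar>sqrt (real N) * avg f N \<omega>\<bar> \<ge> R} \<le> d"
proof -
  obtain C where C: "C \<ge> 1" "\<And>t. \<bar>f t\<bar> \<le> C" using bm_bound[OF bm] by metis
  have "filterlim (\<lambda>R. (1 / (2 * C\<^sup>2)) * R\<^sup>2) at_top at_top"
    using C by (intro filterlim_tendsto_pos_mult_at_top[OF tendsto_const] filterlim_pow_at_top filterlim_ident) auto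
  then have "((\<lambda>R. exp (- ((1 / (2 * C\<^sup>2)) * R\<^sup>2))) \<longlongrightarrow> 0) at_top"
    by (intro filterlim_compose[OF exp_at_bot] filterlim_uminus_at_bot_at_top[THEN filterlim_compose])
  from order_tendstoD(2)[OF this, of "d / 2"] d
  have "\<forall>\<^sub>F R in at_top. exp (- ((1 / (2 * C\<^sup>2)) * R\<^sup>2)) < d / 2" by simp
  from eventually_happens'[OF _ eventually_conj[OF this eventually_gt_at_top[of 0]]]
  obtain R where R: "R > 0" "exp (- ((1 / (2 * C\<^sup>2)) * R\<^sup>2)) < d / 2" by auto
  show thesis
  proof (rule that[OF R(1)])
    fix N :: nat assume N: "N > 0"
    have "sqrt (real N) * avg f N \<omega> = (\<Sum>i<N. f (T i \<omega>)) / sqrt (real N)" for \<omega>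
      using N by (simp add: avg_def field_simps)
    then have "{\<omega>\<in>space M. \<bar>sqrt (real N) * avg f N \<omega>\<bar> \<ge> R} =
       {\<omega>\<in>space M. \<bar>(\<Sum>i<N. f (T i \<omega>)) - real N * Inu (\<lambda>t. f t * exp (G b0 t))\<bar> \<ge> R * sqrt (real N)}"
      using N by (simp add: m abs_divide pos_le_divide_eq)
    also have "prob \<dots> \<le> 2 * exp (- (R * sqrt (real N))\<^sup>2 / (2 * C\<^sup>2 * real N))"
      using hoeffding_T[OF bm, of C N "R * sqrt (real N)"] C N R by simp
    also have "- (R * sqrt (real N))\<^sup>2 / (2 * C\<^sup>2 * real N) = - ((1 / (2 * C\<^sup>2)) * R\<^sup>2)"
      using N by (simp add: power_mult_distrib)
    finally show "prob {\<omega>\<in>space M. \<bar>sqrt (real N) * avg f N \<omega>\<bar> \<ge> R} \<le> d" using R by simp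
  qed
qed

text \<open>The central limit theorem is stated for sums of unit variance; the test function
  \<open>cos (sqrt s * y + c)\<close> undoes this normalization.\<close>

lemma CLT_cos:
  assumes bm: "bm f" and m: "Inu (\<lambda>t. f t * exp (G b0 t)) = 0"
    and s: "Inu (\<lambda>t. (f t)\<^sup>2 * exp (G b0 t)) = s" "s > 0"
  shows "(\<lambda>N. expectation (\<lambda>\<omega>. cos (sqrt (real N) * avg f N \<omega> + c))) \<longlonglongrightarrow> exp (- s / 2) * cos c"
proof -
  note [measurable] = bm_measurable[OF bm]
  have bm2: "bm (\<lambda>t. (f t)\<^sup>2)" unfolding power2_eq_square using bm by auto
  obtain C where C: "C \<ge> 1" "\<And>t. \<bar>f t\<bar> \<le> C" using bm_bound[OF bm] by metis
  obtain C2 where C2: "C2 \<ge> 1" "\<And>t. \<bar>(f t)\<^sup>2\<bar> \<le> C2" using bm_bound[OF bm2] by metis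
  have mean: "expectation (\<lambda>\<omega>. f (T i \<omega>)) = 0" for i using expectation_T[OF bm] m by simp
  have ind: "indep_vars (\<lambda>_. borel) (\<lambda>i \<omega>. f (T i \<omega>)) UNIV"
    by (rule indep_vars_compose2[OF T_indep]) auto
  have si: "integrable M (\<lambda>\<omega>. (f (T i \<omega>))\<^sup>2)" for i
    by (rule integrable_const_bound[of _ C2]) (use C2 in auto)
  have var: "variance (\<lambda>\<omega>. f (T i \<omega>)) = (sqrt s)\<^sup>2" for i
    using mean[of i] expectation_T[OF bm2, of i] s by simp
  have "distr M lborel (T i) = distr M lborel (T 0)" for i
    using T_dist[of i] T_dist[of 0] by (simp add: distributed_def)
  then have "distr (distr M lborel (T i)) borel f = distr (distr M lborel (T 0)) borel f" for i by metis
  then have di: "distr M borel (\<lambda>\<omega>. f (T i \<omega>)) = distr M borel (\<lambda>\<omega>. f (T 0 \<omega>))" for i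
    by (simp add: distr_distr comp_def)
  have "weak_conv_m (\<lambda>n. distr M borel (\<lambda>x. (\<Sum>i<n. f (T i x)) / sqrt (n * (sqrt s)\<^sup>2))) std_normal_distribution"
    by (rule central_limit_theorem_zero_mean[OF ind mean _ si var di]) (use s in simp)
  moreover have "weak_conv_m F mm \<Longrightarrow> (\<And>n. real_distribution (F n)) \<Longrightarrow> real_distribution mm \<Longrightarrow>
     (\<lambda>n. integral\<^sup>L (F n) (\<lambda>y. cos (sqrt s * y + c))) \<longlonglongrightarrow> integral\<^sup>L mm (\<lambda>y. cos (sqrt s * y + c))" for F mm
    by (rule weak_conv_imp_integral_bdd_continuous_conv[where B=1]) auto
  ultimately have lim: "(\<lambda>n. integral\<^sup>L (distr M borel (\<lambda>x. (\<Sum>i<n. f (T i x)) / sqrt (n * (sqrt s)\<^sup>2))) (\<lambda>y. cos (sqrt s * y + c)))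
      \<longlonglongrightarrow> integral\<^sup>L std_normal_distribution (\<lambda>y. cos (sqrt s * y + c))"
    using real_distribution_distr real_dist_normal_dist by simp
  have "integral\<^sup>L std_normal_distribution (\<lambda>y. cos (sqrt s * y + c)) = exp (- s / 2) * cos c"
    using integral_cos_normal(1)[of 1 "sqrt s" c 0] s by (simp add: integral_density mult.commute)
  moreover have "integral\<^sup>L (distr M borel (\<lambda>x. (\<Sum>i<n. f (T i x)) / sqrt (n * (sqrt s)\<^sup>2))) (\<lambda>y. cos (sqrt s * y + c))
     = expectation (\<lambda>\<omega>. cos (sqrt (real n) * avg f n \<omega> + c))" for n
  proof -
    have "sqrt s * ((\<Sum>i<n. f (T i x)) / sqrt (n * (sqrt s)\<^sup>2)) = sqrt (real n) * avg f n x" for x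
    proof -
      have "S / sqrt (real n) = sqrt (real n) * (S / real n)" for S
        by (cases "n = 0") (simp_all add: field_simps)
      then show ?thesis using s by (simp add: avg_def real_sqrt_mult)
    qed
    then show ?thesis by (simp add: integral_distr)
  qed
  ultimately show ?thesis using lim by simp
qed

end

section \<open>Asymptotic normality of roots of the score equations\<close>

lemma abs_cos_diff_le: "\<bar>cos x - cos y\<bar> \<le> \<bar>x - y :: real\<bar>"
proof -
  have "\<bar>cos x - cos y\<bar> = 2 * \<bar>sin ((x + y) / 2)\<bar> * \<bar>sin ((y - x) / 2)\<bar>"
    by (simp add: cos_diff_cos abs_mult)
  also have "\<dots> \<le> 2 * 1 * \<bar>(y - x) / 2\<bar>"
    by (intro mult_mono abs_sin_x_le_abs_x) auto
  finally show ?thesis by simp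
qed

text \<open>What is of smaller order than a stochastically bounded sequence tends to zero in
  probability: on the event \<open>S N \<omega> \<le> R\<close> use the hypothesis with
  \<open>r = e / R\<close>.\<close>

lemma (in prob_space) whp_negligible:
  fixes S Q :: "nat \<Rightarrow> 'a \<Rightarrow> real"
  assumes tight: "\<And>d. d > 0 \<Longrightarrow> \<exists>R>0. \<forall>\<^sub>F N in sequentially. \<exists>A\<in>events. prob A \<ge> 1 - d \<and> (\<forall>\<omega>\<in>A. S N \<omega> \<le> R)"
    and Q: "\<And>r. r > 0 \<Longrightarrow> whp (\<lambda>N \<omega>. Q N \<omega> \<le> r * S N \<omega>)" and e: "e > 0"
  shows "whp (\<lambda>N \<omega>. Q N \<omega> \<le> e)"
  unfolding whp_def
proof (intro allI impI)
  fix d :: real assume d: "d > 0"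
  then obtain R where R: "R > 0"
    and t: "\<forall>\<^sub>F N in sequentially. \<exists>A\<in>events. prob A \<ge> 1 - d / 2 \<and> (\<forall>\<omega>\<in>A. S N \<omega> \<le> R)"
    using tight[of "d / 2"] by auto
  have "whp (\<lambda>N \<omega>. Q N \<omega> \<le> e / R * S N \<omega>)" by (rule Q) (use e R in simp)
  then have "\<forall>\<^sub>F N in sequentially. \<exists>A\<in>events. prob A \<ge> 1 - d / 2 \<and> (\<forall>\<omega>\<in>A. Q N \<omega> \<le> e / R * S N \<omega>)"
    using d unfolding whp_def by simp
  with t show "\<forall>\<^sub>F N in sequentially. \<exists>A\<in>events. prob A \<ge> 1 - d \<and> (\<forall>\<omega>\<in>A. Q N \<omega> \<le> e)"
  proof eventually_elim
    case (elim N)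
    then obtain A B where AB: "A \<in> events" "prob A \<ge> 1 - d / 2" "\<forall>\<omega>\<in>A. S N \<omega> \<le> R"
       "B \<in> events" "prob B \<ge> 1 - d / 2" "\<forall>\<omega>\<in>B. Q N \<omega> \<le> e / R * S N \<omega>" by blast
    have "prob (A \<inter> B) \<ge> 1 - d" using AB by (intro prob_Int_ge)
    moreover have "Q N \<omega> \<le> e" if "\<omega> \<in> A \<inter> B" for \<omega>
    proof -
      have "Q N \<omega> \<le> e / R * S N \<omega>" using AB that by blast
      also have "\<dots> \<le> e / R * R" using AB that e R by (intro mult_left_mono) auto
      finally show ?thesis using R by simp
    qed
    ultimately show ?case using AB by (intro bexI[of _ "A \<inter> B"]) auto
  qed
qed

context step_stress
begin

text \<open>Uniformity in the observation lets the remainder survive averaging with the same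
  constant, whatever the sample.\<close>

lemma jet_avg:
  fixes s :: "nat \<Rightarrow> real"
  assumes K: "jet_bd F b D K r" and h: "norm h \<le> r" and N: "N > 0"
  shows "\<bar>(\<Sum>i<N. F (b + h) (s i)) / N - (\<Sum>i<N. F b (s i)) / N
      - ((\<Sum>i<N. D (s i) $ 1) / N * h $ 1 + (\<Sum>i<N. D (s i) $ 2) / N * h $ 2)\<bar> \<le> K * (norm h)\<^sup>2"
proof -
  have "(\<Sum>i<N. F (b + h) (s i)) / N - (\<Sum>i<N. F b (s i)) / N
      - ((\<Sum>i<N. D (s i) $ 1) / N * h $ 1 + (\<Sum>i<N. D (s i) $ 2) / N * h $ 2)
    = (\<Sum>i<N. F (b + h) (s i) - F b (s i) - D (s i) \<bullet> h) / N"
    by (simp add: inner_real2 sum_subtractf sum.distrib sum_distrib_right[symmetric] diff_divide_distrib add_divide_distrib)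
  also have "\<bar>\<dots>\<bar> \<le> (\<Sum>i<N. K * (norm h)\<^sup>2) / N"
  proof -
    have "\<bar>\<Sum>i<N. F (b + h) (s i) - F b (s i) - D (s i) \<bullet> h\<bar> \<le> (\<Sum>i<N. K * (norm h)\<^sup>2)"
      by (rule order_trans[OF sum_abs sum_mono]) (use jet_bdD(6)[OF K order_refl h] in auto)
    from divide_right_mono[OF this, of "real N"] show ?thesis by (simp only: abs_divide abs_of_nat of_nat_0_le_iff simp_thms)
  qed
  also have "\<dots> = K * (norm h)\<^sup>2" using N by simp
  finally show ?thesis .
qed

end

context step_stress_sample
begin

lemma psi_expansion:
  assumes cons: "conv_in_prob M ahat b0" and meas[measurable]: "\<And>N. ahat N \<in> borel_measurable M"
    and foc: "whp (\<lambda>N \<omega>. \<forall>i. (\<Sum>j<N. psi \<beta> (ahat N \<omega>) (T j \<omega>) $ i) = 0)"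
    and r: "r > 0"
  shows "whp (\<lambda>N \<omega>. \<bar>avg (\<lambda>t. psi \<beta> b0 t $ i) N \<omega> + (Jm \<beta> b0 *v (ahat N \<omega> - b0)) $ i\<bar> \<le> r * norm (ahat N \<omega> - b0))"
proof -
  obtain D where D: "has_jet (\<lambda>b t. psi \<beta> b t $ i) b0 D"
    and J: "\<And>j. Inu (\<lambda>t. D t $ j * exp (G b0 t)) = Jm \<beta> b0 $ i $ j" by (rule psi_jet) blast
  obtain K s where K: "jet_bd (\<lambda>b t. psi \<beta> b t $ i) b0 D K s" by (rule has_jet_bound[OF D])
  note K' = jet_bdD(1,2)[OF K]
  \<comment> \<open>The tolerance \<open>r\<close> is divided: consistency puts the estimator within
    \<open>m\<close>, where the quadratic remainder costs at most \<open>r / 2\<close>, and the law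
    of large numbers for each of the two partial derivatives costs \<open>r / 4\<close>.\<close>
  define m where "m = min s (r / (2 * K))"
  have m: "m > 0" "m \<le> s" "K * m \<le> r / 2" using K' r by (auto simp: m_def min_def field_simps)
  have "whp (\<lambda>N \<omega>. \<not> m < dist (ahat N \<omega>) b0)"
    using cons m(1) by (intro whp_probI) (auto simp: conv_in_prob_def)
  moreover have "whp (\<lambda>N \<omega>. \<bar>avg (\<lambda>t. D t $ 1) N \<omega> - Inu (\<lambda>t. D t $ 1 * exp (G b0 t))\<bar> < r / 4)"
    by (rule LLN) (use has_jet_bm[OF D] r in auto)
  moreover have "whp (\<lambda>N \<omega>. \<bar>avg (\<lambda>t. D t $ 2) N \<omega> - Inu (\<lambda>t. D t $ 2 * exp (G b0 t))\<bar> < r / 4)"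
    by (rule LLN) (use has_jet_bm[OF D] r in auto)
  ultimately have "whp (\<lambda>N \<omega>. (\<forall>i. (\<Sum>j<N. psi \<beta> (ahat N \<omega>) (T j \<omega>) $ i) = 0) \<and> \<not> m < dist (ahat N \<omega>) b0 \<and>
      \<bar>avg (\<lambda>t. D t $ 1) N \<omega> - Jm \<beta> b0 $ i $ 1\<bar> < r / 4 \<and> \<bar>avg (\<lambda>t. D t $ 2) N \<omega> - Jm \<beta> b0 $ i $ 2\<bar> < r / 4)"
    unfolding J by (intro whp_conj foc)
  then show ?thesis
  proof (rule whp_mono, intro eventually_mono[OF eventually_gt_at_top[of 0]] ballI impI, elim conjE)
    fix N :: nat and \<omega>
    define h where "h = ahat N \<omega> - b0"
    assume N: "0 < N" and z: "\<forall>i. (\<Sum>j<N. psi \<beta> (ahat N \<omega>) (T j \<omega>) $ i) = 0"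
      and d: "\<not> m < dist (ahat N \<omega>) b0"
      and D1: "\<bar>avg (\<lambda>t. D t $ 1) N \<omega> - Jm \<beta> b0 $ i $ 1\<bar> < r / 4"
      and D2: "\<bar>avg (\<lambda>t. D t $ 2) N \<omega> - Jm \<beta> b0 $ i $ 2\<bar> < r / 4"
    have h: "norm h \<le> m" using d by (simp add: h_def dist_norm)
    have bh: "b0 + h = ahat N \<omega>" by (simp add: h_def)
    have hs: "norm h \<le> s" using h m by linarith
    have z0: "(\<Sum>j<N. psi \<beta> (b0 + h) (T j \<omega>) $ i) = 0" using z bh by simp
    from jet_avg[OF K hs N, of "\<lambda>i. T i \<omega>", unfolded z0]
    have "\<bar>- (avg (\<lambda>t. psi \<beta> b0 t $ i) N \<omega> + (avg (\<lambda>t. D t $ 1) N \<omega> * h $ 1 + avg (\<lambda>t. D t $ 2) N \<omega> * h $ 2))\<bar> \<le> K * (norm h)\<^sup>2"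
      by (simp add: avg_def)
    then have 1: "\<bar>avg (\<lambda>t. psi \<beta> b0 t $ i) N \<omega> + (avg (\<lambda>t. D t $ 1) N \<omega> * h $ 1 + avg (\<lambda>t. D t $ 2) N \<omega> * h $ 2)\<bar> \<le> K * (norm h)\<^sup>2"
      by (simp only: abs_minus_cancel)
    have 2: "K * (norm h)\<^sup>2 \<le> r / 2 * norm h"
    proof -
      have "K * (norm h)\<^sup>2 = (K * norm h) * norm h" by (simp add: power2_eq_square)
      also have "\<dots> \<le> r / 2 * norm h"
      proof (rule mult_right_mono)
        have "K * norm h \<le> K * m" using h K' by (intro mult_left_mono) auto
        then show "K * norm h \<le> r / 2" using m by linarith
      qed simp
      finally show ?thesis .
    qed
    have 3: "\<bar>(avg (\<lambda>t. D t $ j) N \<omega> - Jm \<beta> b0 $ i $ j) * h $ j\<bar> \<le> r / 4 * norm h" if "j = 1 \<or> j = 2" for j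
      unfolding abs_mult using that D1 D2 r component_le_norm_cart[of h j] by (intro mult_mono) auto
    have "(Jm \<beta> b0 *v h) $ i = Jm \<beta> b0 $ i $ 1 * h $ 1 + Jm \<beta> b0 $ i $ 2 * h $ 2"
      by (simp add: matrix_vector_mult_def sum_2)
    then have "avg (\<lambda>t. psi \<beta> b0 t $ i) N \<omega> + (Jm \<beta> b0 *v h) $ i =
      (avg (\<lambda>t. psi \<beta> b0 t $ i) N \<omega> + (avg (\<lambda>t. D t $ 1) N \<omega> * h $ 1 + avg (\<lambda>t. D t $ 2) N \<omega> * h $ 2))
      - (avg (\<lambda>t. D t $ 1) N \<omega> - Jm \<beta> b0 $ i $ 1) * h $ 1 - (avg (\<lambda>t. D t $ 2) N \<omega> - Jm \<beta> b0 $ i $ 2) * h $ 2"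
      by (simp add: algebra_simps)
    then show "\<bar>avg (\<lambda>t. psi \<beta> b0 t $ i) N \<omega> + (Jm \<beta> b0 *v (ahat N \<omega> - b0)) $ i\<bar> \<le> r * norm (ahat N \<omega> - b0)"
      unfolding h_def[symmetric] using 1 2 3[OF disjI1[OF refl]] 3[OF disjI2[OF refl]] by linarith
  qed
qed

text \<open>Let \<open>Z\<close> be the scaled error and \<open>S\<close> the scaled mean of
  \<open>psi\<close> at the truth. Linearization makes \<open>S + J *v Z\<close> small compared with
  \<open>Z\<close>; as \<open>J\<close> is invertible, \<open>Z\<close> is then dominated by
  \<open>S\<close>, which is tight, so \<open>S + J *v Z\<close> tends to zero in probability.
  Linear statistics of \<open>Z\<close> therefore behave like linear statistics of
  \<open>S\<close>.\<close>

lemma asymptotic_normality: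
  assumes x: "x1 \<noteq> x2" and be: "\<beta> \<ge> 0"
    and cons: "conv_in_prob M ahat b0" and meas[measurable]: "\<And>N. ahat N \<in> borel_measurable M"
    and foc: "whp (\<lambda>N \<omega>. \<forall>i. (\<Sum>j<N. psi \<beta> (ahat N \<omega>) (T j \<omega>) $ i) = 0)"
  shows "conv_in_law M (\<lambda>N \<omega>. sqrt (real N) *\<^sub>R (ahat N \<omega> - b0))
    (normal2 (matrix_inv (Jm \<beta> b0) ** Km \<beta> b0 ** matrix_inv (Jm \<beta> b0)))"
proof -
  define J K I where "J = Jm \<beta> b0" and "K = Km \<beta> b0" and "I = matrix_inv J"
  define Sg where "Sg = I ** K ** I"
  have Jsym: "J$1$2 = J$2$1" and Ksym: "K$1$2 = K$2$1"
    unfolding J_def K_def by (rule Jm_sym Km_sym)+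
  have Jpos: "v \<noteq> 0 \<Longrightarrow> v \<bullet> (J *v v) > 0" and Kpos: "v \<noteq> 0 \<Longrightarrow> v \<bullet> (K *v v) > 0" for v
    unfolding J_def K_def using Jm_pos[OF x] Km_pos[OF x _ be] by auto
  have dJ: "det J > 0" by (rule posdef_real2(2)[OF Jsym Jpos])
  have Iinv: "J ** I = mat 1" "I ** J = mat 1"
  proof -
    have "invertible J" using dJ by (simp add: invertible_det_nz)
    then have "J ** I = mat 1 \<and> I ** J = mat 1"
      unfolding I_def matrix_inv_def invertible_def by (rule someI_ex)
    then show "J ** I = mat 1" "I ** J = mat 1" by auto
  qed
  have Isym: "I$1$2 = I$2$1" unfolding I_def using dJ Jsym by (subst (1 2) matrix_inv_real2) auto
  have symI: "(I *v a) \<bullet> c = a \<bullet> (I *v c)" for a c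
    using Isym by (simp add: inner_real2 matrix_vector_mult_def sum_2 algebra_simps)
  have Sq: "v \<bullet> (Sg *v v) = (I *v v) \<bullet> (K *v (I *v v))" for v
    by (simp add: Sg_def symI matrix_vector_mul_assoc[symmetric])
  have Inz: "I *v v \<noteq> 0" if "v \<noteq> 0" for v
  proof
    assume "I *v v = 0"
    then have "J *v (I *v v) = 0" by simp
    then show False using that Iinv by (simp add: matrix_vector_mul_assoc)
  qed
  have Spos: "v \<noteq> 0 \<Longrightarrow> v \<bullet> (Sg *v v) > 0" for v unfolding Sq using Kpos Inz by blast
  have Ssym: "Sg$1$2 = Sg$2$1"
    using Isym Ksym by (simp add: Sg_def matrix_matrix_mult_def sum_2 algebra_simps)
  note N2 = normal2_basic[OF Ssym posdef_real2[OF Ssym Spos]]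
  obtain k where k: "k > 0" "\<And>a. norm (I *v a) \<le> norm a * k"
    using bounded_linear.pos_bounded[OF matrix_vector_mul_bounded_linear[of I]] by blast
  define Z where "Z N \<omega> = sqrt (real N) *\<^sub>R (ahat N \<omega> - b0)" for N \<omega>
  define S where "S N \<omega> = (\<chi> i. sqrt (real N) * avg (\<lambda>t. psi \<beta> b0 t $ i) N \<omega>)" for N \<omega>
  have [measurable]: "Z N \<in> borel_measurable M" for N unfolding Z_def by measurable
  have [measurable]: "(\<lambda>t. psi \<beta> b0 t $ i) \<in> borel_measurable borel" for i
    by (rule bm_measurable) auto
  have [measurable]: "avg (\<lambda>t. psi \<beta> b0 t $ i) N \<in> borel_measurable M" for i N
    unfolding avg_def by measurable
  have JZ: "whp (\<lambda>N \<omega>. norm (S N \<omega> + J *v Z N \<omega>) \<le> r * norm (Z N \<omega>))" if r: "r > 0" for r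
  proof -
    have r2: "r / 2 > 0" using r by simp
    show ?thesis
    proof (rule whp_mono[OF whp_conj[OF psi_expansion[OF cons meas foc r2, of 1] psi_expansion[OF cons meas foc r2, of 2]]],
        intro always_eventually allI ballI impI, elim conjE)
      fix N \<omega>
      assume a: "\<bar>avg (\<lambda>t. psi \<beta> b0 t $ 1) N \<omega> + (Jm \<beta> b0 *v (ahat N \<omega> - b0)) $ 1\<bar> \<le> r / 2 * norm (ahat N \<omega> - b0)"
        "\<bar>avg (\<lambda>t. psi \<beta> b0 t $ 2) N \<omega> + (Jm \<beta> b0 *v (ahat N \<omega> - b0)) $ 2\<bar> \<le> r / 2 * norm (ahat N \<omega> - b0)"
      have c: "(S N \<omega> + J *v Z N \<omega>) $ i = sqrt (real N) * (avg (\<lambda>t. psi \<beta> b0 t $ i) N \<omega> + (Jm \<beta> b0 *v (ahat N \<omega> - b0)) $ i)" for i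
        by (simp add: S_def Z_def J_def matrix_vector_mult_scaleR distrib_left)
      have "norm (S N \<omega> + J *v Z N \<omega>) \<le> \<bar>(S N \<omega> + J *v Z N \<omega>) $ 1\<bar> + \<bar>(S N \<omega> + J *v Z N \<omega>) $ 2\<bar>"
        by (rule norm_real2_le)
      also have "\<dots> \<le> sqrt (real N) * (r / 2 * norm (ahat N \<omega> - b0)) + sqrt (real N) * (r / 2 * norm (ahat N \<omega> - b0))"
        unfolding c abs_mult using a by (intro add_mono mult_mono) auto
      also have "\<dots> = r * norm (Z N \<omega>)" by (simp add: Z_def)
      finally show "norm (S N \<omega> + J *v Z N \<omega>) \<le> r * norm (Z N \<omega>)" .
    qed
  qed
  \<comment> \<open>\<open>k\<close> bounds the norm of the inverse of \<open>J\<close>. With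
    \<open>r \<le> 1 / (2 * k)\<close> the error term becomes at most half of \<open>norm z\<close>
    after inversion and is absorbed on the left.\<close>
  have ZS: "norm z \<le> 2 * k * norm s" if "norm (s + J *v z) \<le> r * norm z" "r \<le> 1 / (2 * k)" for s z :: "real^2" and r
  proof -
    have "norm (J *v z) \<le> norm (s + J *v z) + norm s"
      using norm_triangle_ineq4[of "s + J *v z" s] by simp
    also have "\<dots> \<le> 1 / (2 * k) * norm z + norm s"
      using that mult_right_mono[OF that(2), of "norm z"] by auto
    finally have "norm (J *v z) * k \<le> (1 / (2 * k) * norm z + norm s) * k" using k by (intro mult_right_mono) auto
    also have "\<dots> = norm z / 2 + norm s * k" using k by (simp add: field_simps)
    finally have "norm (J *v z) * k \<le> norm z / 2 + norm s * k" .
    moreover have "norm z \<le> norm (J *v z) * k"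
      using k(2)[of "J *v z"] Iinv by (simp add: matrix_vector_mul_assoc)
    ultimately show ?thesis unfolding mult.assoc mult.commute[of k] by linarith
  qed
  have tightS: "\<exists>R>0. \<forall>\<^sub>F N in sequentially. \<exists>A\<in>events. prob A \<ge> 1 - d \<and> (\<forall>\<omega>\<in>A. norm (S N \<omega>) \<le> R)" if d: "d > 0" for d
  proof -
    have d2: "d / 2 > 0" using d by simp
    obtain R1 where R1: "R1 > 0" "\<And>N. N > 0 \<Longrightarrow> prob {\<omega>\<in>space M. \<bar>sqrt (real N) * avg (\<lambda>t. psi \<beta> b0 t $ 1) N \<omega>\<bar> \<ge> R1} \<le> d / 2"
      by (rule root_N_tight[OF bm_psi Inu_psi d2]) blast
    obtain R2 where R2: "R2 > 0" "\<And>N. N > 0 \<Longrightarrow> prob {\<omega>\<in>space M. \<bar>sqrt (real N) * avg (\<lambda>t. psi \<beta> b0 t $ 2) N \<omega>\<bar> \<ge> R2} \<le> d / 2"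
      by (rule root_N_tight[OF bm_psi Inu_psi d2]) blast
    have "\<exists>A\<in>events. prob A \<ge> 1 - d \<and> (\<forall>\<omega>\<in>A. norm (S N \<omega>) \<le> R1 + R2)" if N: "N > 0" for N
    proof -
      define A B where "A = {\<omega>\<in>space M. \<bar>sqrt (real N) * avg (\<lambda>t. psi \<beta> b0 t $ 1) N \<omega>\<bar> \<ge> R1}"
        and "B = {\<omega>\<in>space M. \<bar>sqrt (real N) * avg (\<lambda>t. psi \<beta> b0 t $ 2) N \<omega>\<bar> \<ge> R2}"
      have AB: "A \<in> events" "B \<in> events" unfolding A_def B_def by measurable
      have "prob (A \<union> B) \<le> prob A + prob B" using AB by (rule measure_Un_le)
      also have "\<dots> \<le> d" using R1(2)[OF N] R2(2)[OF N] by (simp add: A_def B_def)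
      finally have "prob (space M - (A \<union> B)) \<ge> 1 - d" using AB by (subst prob_compl) auto
      moreover have "norm (S N \<omega>) \<le> R1 + R2" if "\<omega> \<in> space M - (A \<union> B)" for \<omega>
        using that norm_real2_le[of "S N \<omega>"] by (auto simp: A_def B_def S_def not_le)
      ultimately show ?thesis using AB by (intro bexI[of _ "space M - (A \<union> B)"]) auto
    qed
    then show ?thesis
      using R1(1) R2(1) by (intro exI[of _ "R1 + R2"] conjI eventually_mono[OF eventually_gt_at_top[of 0]]) auto
  qed
  have neg: "whp (\<lambda>N \<omega>. norm (S N \<omega> + J *v Z N \<omega>) \<le> e)" if e: "e > 0" for e
  proof (rule whp_negligible[OF tightS _ e])
    fix r :: real assume r: "r > 0"
    \<comment> \<open>The first bound permits the absorption in \<open>ZS\<close>; the second turns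
      the resulting factor \<open>q * (2 * k)\<close> into at most \<open>r\<close>.\<close>
    define q where "q = min (1 / (2 * k)) (r / (2 * k))"
    have q: "q > 0" "q \<le> 1 / (2 * k)" "q * (2 * k) \<le> r" using k r by (auto simp: q_def min_def field_simps)
    show "whp (\<lambda>N \<omega>. norm (S N \<omega> + J *v Z N \<omega>) \<le> r * norm (S N \<omega>))"
    proof (rule whp_mono[OF JZ[OF q(1)]], intro always_eventually allI ballI impI)
      fix N \<omega> assume a: "norm (S N \<omega> + J *v Z N \<omega>) \<le> q * norm (Z N \<omega>)"
      also have "\<dots> \<le> q * (2 * k * norm (S N \<omega>))"
        using ZS[OF a q(2)] q(1) by (intro mult_left_mono) auto
      also have "\<dots> = (q * (2 * k)) * norm (S N \<omega>)" by simp
      also have "\<dots> \<le> r * norm (S N \<omega>)" using q(3) by (rule mult_right_mono) simp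
      finally show "norm (S N \<omega> + J *v Z N \<omega>) \<le> r * norm (S N \<omega>)" .
    qed
  qed
  have "conv_in_law M Z (normal2 Sg)"
  proof (rule conv_in_law_trigI)
    show "prob_space (normal2 Sg)" by (rule N2)
    show "sets (normal2 Sg) = sets borel" by (simp add: normal2_def)
    show "Z N \<in> borel_measurable M" for N by measurable
  next
    fix d :: real assume d: "d > 0"
    then have d2: "d / 2 > 0" by simp
    obtain R where R: "R > 0" and t: "\<forall>\<^sub>F N in sequentially. \<exists>A\<in>events. prob A \<ge> 1 - d / 2 \<and> (\<forall>\<omega>\<in>A. norm (S N \<omega>) \<le> R)"
      using tightS[OF d2] by blast
    have "\<forall>\<^sub>F N in sequentially. \<exists>A\<in>events. prob A \<ge> 1 - d / 2 \<and> (\<forall>\<omega>\<in>A. norm (S N \<omega> + J *v Z N \<omega>) \<le> 1)"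
      using neg[of 1] d2 unfolding whp_def by simp
    with t have "\<forall>\<^sub>F N in sequentially. prob {\<omega>\<in>space M. norm (Z N \<omega>) \<le> (R + 1) * k} \<ge> 1 - d"
    proof eventually_elim
      case (elim N)
      then obtain A B where AB: "A \<in> events" "prob A \<ge> 1 - d / 2" "\<forall>\<omega>\<in>A. norm (S N \<omega>) \<le> R"
         "B \<in> events" "prob B \<ge> 1 - d / 2" "\<forall>\<omega>\<in>B. norm (S N \<omega> + J *v Z N \<omega>) \<le> 1" by blast
      have "prob (A \<inter> B) \<ge> 1 - d" using AB by (intro prob_Int_ge)
      also have "prob (A \<inter> B) \<le> prob {\<omega>\<in>space M. norm (Z N \<omega>) \<le> (R + 1) * k}"
      proof (rule finite_measure_mono)
        show "A \<inter> B \<subseteq> {\<omega>\<in>space M. norm (Z N \<omega>) \<le> (R + 1) * k}"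
        proof safe
          fix \<omega> assume w: "\<omega> \<in> A" "\<omega> \<in> B"
          then show "\<omega> \<in> space M" using AB sets.sets_into_space by blast
          have "norm (J *v Z N \<omega>) \<le> norm (S N \<omega> + J *v Z N \<omega>) + norm (S N \<omega>)"
            using norm_triangle_ineq4[of "S N \<omega> + J *v Z N \<omega>" "S N \<omega>"] by simp
          also have "\<dots> \<le> R + 1" using AB w by fastforce
          finally have "norm (J *v Z N \<omega>) * k \<le> (R + 1) * k" using k by (intro mult_right_mono) auto
          then show "norm (Z N \<omega>) \<le> (R + 1) * k"
            using k(2)[of "J *v Z N \<omega>"] Iinv by (simp add: matrix_vector_mul_assoc)
        qed
      qed measurable
      finally show ?case .
    qed
    then show "\<exists>R. \<forall>\<^sub>F N in sequentially. prob {\<omega>\<in>space M. norm (Z N \<omega>) \<le> R} \<ge> 1 - d" by blast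
  next
    fix v :: "real^2" and c :: real
    \<comment> \<open>Symmetry of the inverse gives
      \<open>v \<bullet> z = w \<bullet> (J *v z)\<close>, so
      \<open>v \<bullet> Z N \<omega>\<close> is close to
      \<open>- (w \<bullet> S N \<omega>)\<close>; hence the sign in the averaged function
      below.\<close>
    define w where "w = I *v v"
    have fm: "bm (\<lambda>t. psi \<beta> b0 t \<bullet> - w)" by auto
    have "Inu (\<lambda>t. (psi \<beta> b0 t \<bullet> - w) * exp (G b0 t)) =
       Inu (\<lambda>t. (- w$1) * (psi \<beta> b0 t $ 1 * exp (G b0 t)) + (- w$2) * (psi \<beta> b0 t $ 2 * exp (G b0 t)))"
      unfolding inner_real2 by (simp add: algebra_simps)
    also have "\<dots> = (- w$1) * Inu (\<lambda>t. psi \<beta> b0 t $ 1 * exp (G b0 t)) + (- w$2) * Inu (\<lambda>t. psi \<beta> b0 t $ 2 * exp (G b0 t))"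
      by (subst Inu_add) (auto simp only: Inu_cmult intro!: bm_mult bm_const bm_psi bm_exp bm_G)
    finally have m: "Inu (\<lambda>t. (psi \<beta> b0 t \<bullet> - w) * exp (G b0 t)) = 0" by (simp add: Inu_psi)
    have var: "Inu (\<lambda>t. (psi \<beta> b0 t \<bullet> - w)\<^sup>2 * exp (G b0 t)) = v \<bullet> (Sg *v v)"
      unfolding Sq w_def[symmetric] K_def Km_quad by simp
    have avg: "sqrt (real N) * avg (\<lambda>t. psi \<beta> b0 t \<bullet> - w) N \<omega> = - (w \<bullet> S N \<omega>)" for N \<omega>
      by (simp add: S_def avg_def inner_real2 sum.distrib sum_negf sum_distrib_left[symmetric] sum_subtractf
         sum_distrib_right[symmetric] algebra_simps add_divide_distrib diff_divide_distrib)
    \<comment> \<open>\<open>CLT_cos\<close> requires a positive variance; for \<open>v = 0\<close>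
      both sides reduce to \<open>cos c\<close>.\<close>
    have limS: "(\<lambda>N. expectation (\<lambda>\<omega>. cos (- (w \<bullet> S N \<omega>) + c))) \<longlonglongrightarrow> exp (- (v \<bullet> (Sg *v v)) / 2) * cos c"
    proof (cases "v = 0")
      case True
      then show ?thesis by (simp add: w_def prob_space)
    next
      case False
      from CLT_cos[OF fm m var Spos[OF False], of c] show ?thesis unfolding avg .
    qed
    have vZ: "v \<bullet> z = w \<bullet> (J *v z)" for z
      unfolding w_def symI using Iinv by (simp add: matrix_vector_mul_assoc)
    have "(\<lambda>N. expectation (\<lambda>\<omega>. cos (v \<bullet> Z N \<omega> + c))) \<longlonglongrightarrow> exp (- (v \<bullet> (Sg *v v)) / 2) * cos c"
    proof (rule whp_expectation_diff[where B=1 and g="\<lambda>N \<omega>. cos (- (w \<bullet> S N \<omega>) + c)"])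
      show "(\<lambda>\<omega>. cos (- (w \<bullet> S N \<omega>) + c)) \<in> borel_measurable M" for N
        unfolding S_def inner_real2 vec_lambda_beta by measurable
      fix e :: real assume e: "e > 0"
      have "e / (norm w + 1) > 0" using e by (simp add: add_nonneg_pos)
      from neg[OF this]
      show "whp (\<lambda>N \<omega>. \<bar>cos (v \<bullet> Z N \<omega> + c) - cos (- (w \<bullet> S N \<omega>) + c)\<bar> \<le> e)"
      proof (rule whp_mono, intro always_eventually allI ballI impI)
        fix N \<omega> assume a: "norm (S N \<omega> + J *v Z N \<omega>) \<le> e / (norm w + 1)"
        have "\<bar>cos (v \<bullet> Z N \<omega> + c) - cos (- (w \<bullet> S N \<omega>) + c)\<bar> \<le> \<bar>(v \<bullet> Z N \<omega> + c) - (- (w \<bullet> S N \<omega>) + c)\<bar>"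
          by (rule abs_cos_diff_le)
        also have "\<dots> = \<bar>w \<bullet> (S N \<omega> + J *v Z N \<omega>)\<bar>" by (simp add: vZ inner_simps add.commute)
        also have "\<dots> \<le> norm w * norm (S N \<omega> + J *v Z N \<omega>)" by (rule Cauchy_Schwarz_ineq2)
        also have "\<dots> \<le> (norm w + 1) * (e / (norm w + 1))" using a by (intro mult_mono) auto
        also have "\<dots> = e" by (simp add: add_nonneg_eq_0_iff)
        finally show "\<bar>cos (v \<bullet> Z N \<omega> + c) - cos (- (w \<bullet> S N \<omega>) + c)\<bar> \<le> e" .
      qed
    qed (use limS in auto)
    then show "(\<lambda>N. expectation (\<lambda>\<omega>. cos (v \<bullet> Z N \<omega> + c))) \<longlonglongrightarrow> (\<integral>x. cos (v \<bullet> x + c) \<partial>normal2 Sg)"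
      using N2(1)[of v c] by metis
  qed
  then show ?thesis unfolding Z_def[abs_def] Sg_def I_def J_def K_def .
qed

end

section \<open>The loss function\<close>

context step_stress
begin

text \<open>The loss is written with gauge integrals over closed intervals, \<open>Inu\<close> with
  a Lebesgue integral over a half-open one; the integrands differ only at the null set of the two
  change points.\<close>

lemma Inu_integral:
  assumes bm: "bm p"
    and f: "\<And>t. 0 \<le> t \<Longrightarrow> t < tau1 \<Longrightarrow> p t = f t" and g: "\<And>t. tau1 \<le> t \<Longrightarrow> t < tau2 \<Longrightarrow> p t = g t"
    and cf: "continuous_on {0..tau1} f" and cg: "continuous_on {tau1..tau2} g"
  shows "Inu p = integral {0..tau1} f + integral {tau1..tau2} g + p tau2"
proof -
  have 1: "integrable lborel (\<lambda>t. indicator {0..tau1} t *\<^sub>R f t)"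
    and 2: "integrable lborel (\<lambda>t. indicator {tau1..tau2} t *\<^sub>R g t)"
    using borel_integrable_compact[OF _ cf] borel_integrable_compact[OF _ cg] by auto
  have i1: "(\<integral>t. indicator {0..tau1} t *\<^sub>R f t \<partial>lborel) = integral {0..tau1} f"
    using set_borel_integral_eq_integral(2)[of "{0..tau1}" f] 1
    by (simp add: set_integrable_def set_lebesgue_integral_def)
  have i2: "(\<integral>t. indicator {tau1..tau2} t *\<^sub>R g t \<partial>lborel) = integral {tau1..tau2} g"
    using set_borel_integral_eq_integral(2)[of "{tau1..tau2}" g] 2
    by (simp add: set_integrable_def set_lebesgue_integral_def)
  have "(\<integral>t. indicator {0..<tau2} t * p t \<partial>lborel) =
     (\<integral>t. indicator {0..tau1} t *\<^sub>R f t + indicator {tau1..tau2} t *\<^sub>R g t \<partial>lborel)"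
  proof (rule integral_cong_AE)
    show "(\<lambda>t. indicator {0..<tau2} t * p t) \<in> borel_measurable lborel"
      using bm_integrable[OF bm] by simp
    show "(\<lambda>t. indicator {0..tau1} t *\<^sub>R f t + indicator {tau1..tau2} t *\<^sub>R g t) \<in> borel_measurable lborel"
      using 1 2 by (intro borel_measurable_add) (auto dest: borel_measurable_integrable)
    show "AE t in lborel. indicator {0..<tau2} t * p t = indicator {0..tau1} t *\<^sub>R f t + indicator {tau1..tau2} t *\<^sub>R g t"
      using AE_lborel_singleton[of tau1] AE_lborel_singleton[of tau2]
      by eventually_elim (use tau1_pos tau12 in \<open>auto simp: f g split: split_indicator\<close>)
  qed
  also have "\<dots> = integral {0..tau1} f + integral {tau1..tau2} g"
    using 1 2 by (simp add: i1 i2 del: real_scaleR_def)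
  finally show ?thesis by (simp add: Inu_def)
qed

lemma sum_split3:
  fixes s :: "nat \<Rightarrow> real"
  shows "(\<Sum>i\<in>{i. i < N \<and> s i < tau1}. F i) + (\<Sum>i\<in>{i. i < N \<and> tau1 \<le> s i \<and> s i < tau2}. H i)
      + real (card {i. i < N \<and> tau2 \<le> s i}) * c
    = (\<Sum>i<N. if s i < tau1 then F i else if s i < tau2 then H i else c)"
proof -
  have e: "{i. i < N \<and> Q i} = {i\<in>{..<N}. Q i}" for Q by auto
  have "real (card {i. i < N \<and> tau2 \<le> s i}) * c = (\<Sum>i\<in>{i. i < N \<and> tau2 \<le> s i}. c)" by simp
  then show ?thesis
    unfolding e sum.inter_filter[OF finite_lessThan] using tau12
    by (simp add: sum.distrib[symmetric]) (intro sum.cong, auto)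
qed

text \<open>The subtraction on natural numbers in \<open>loglik\<close> does not truncate: each unit
  is counted in exactly one of the three groups.\<close>

lemma card_split3:
  fixes s :: "nat \<Rightarrow> real"
  shows "N - card {i. i < N \<and> s i < tau1} - card {i. i < N \<and> tau1 \<le> s i \<and> s i < tau2} = card {i. i < N \<and> tau2 \<le> s i}"
proof -
  have "real (card {i. i < N \<and> s i < tau1}) + real (card {i. i < N \<and> tau1 \<le> s i \<and> s i < tau2})
      + real (card {i. i < N \<and> tau2 \<le> s i}) = real N"
    using sum_split3[where N=N and s=s and F="\<lambda>_. 1" and H="\<lambda>_. 1" and c=1]
    by (simp only: if_cancel sum_constant card_lessThan mult_1_right)
  then show ?thesis by linarith
qed

text \<open>The \<open>p\<close>-th power of the density in terms of the two failure rates; rates equal to zero are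
  admitted, where \<open>0 powr p = 0\<close> is the continuous extension.\<close>
definition w :: "real \<Rightarrow> real \<times> real \<Rightarrow> real \<Rightarrow> real" where
  "w p m t = (r1 t * fst m powr p + r2 t * snd m powr p + (1 - r1 t - r2 t)) * exp (- (p * (fst m * X t + snd m * Y t)))"

definition rates :: "real^2 \<Rightarrow> real \<times> real" where
  "rates b = (exp (- (b \<bullet> e1)), exp (- (b \<bullet> e2)))"

lemma w_rates: "w p (rates b) t = exp (p * G b t)"
proof -
  have c: "(r1 t = 1 \<and> r2 t = 0) \<or> (r1 t = 0 \<and> r2 t = 1) \<or> (r1 t = 0 \<and> r2 t = 0)"
    by (auto simp: r1_def r2_def)
  have "exp a powr p = exp (p * a)" for a by (simp add: powr_def)
  then show ?thesis using c
    by (auto simp: w_def rates_def G_def algebra_simps simp flip: exp_add)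
qed

lemma bm_w[intro!]: "bm (w p m)"
  unfolding w_def[abs_def] by (intro bm_mult bm_add bm_diff bm_const bm_exp bm_uminus bm_r1 bm_r2 bm_X bm_Y)

text \<open>The loss as a function of the rates. Unlike the loss in the original parameters it makes
  sense on the closed quadrant, where minima can be sought by compactness.\<close>

definition H :: "real \<Rightarrow> nat \<Rightarrow> (nat \<Rightarrow> real) \<Rightarrow> real \<times> real \<Rightarrow> real" where
  "H \<beta> N s m = Inu (w (\<beta> + 1) m) - (\<beta> + 1) / (\<beta> * real N) * (\<Sum>i<N. w \<beta> m (s i))"

lemma model_terms:
  fixes c0 c1 :: real
  defines "b \<equiv> vector [c0, c1] :: real^2"
  defines "l1 \<equiv> lam c0 c1 x1" and "l2 \<equiv> lam c0 c1 x2"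
  shows "0 \<le> t \<Longrightarrow> t < tau1 \<Longrightarrow> f1 l1 t = exp (G b t)"
    and "tau1 \<le> t \<Longrightarrow> t < tau2 \<Longrightarrow> f2 l2 (hsh l1 l2 tau1) t = exp (G b t)"
    and "tau2 \<le> t \<Longrightarrow> surv l2 (hsh l1 l2 tau1) tau2 = exp (G b t)"
    and "f1 l1 t = exp (- (b \<bullet> e1) - exp (- (b \<bullet> e1)) * t)"
    and "f2 l2 (hsh l1 l2 tau1) t = exp (- (b \<bullet> e2) - exp (- (b \<bullet> e1)) * tau1 - exp (- (b \<bullet> e2)) * (t - tau1))"
    and "ln l1 = b \<bullet> e1" and "ln l2 = b \<bullet> e2" and "t / l1 = exp (- (b \<bullet> e1)) * t"
    and "(t + hsh l1 l2 tau1) / l2 = exp (- (b \<bullet> e1)) * tau1 + exp (- (b \<bullet> e2)) * (t - tau1)"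
proof -
  have be: "b \<bullet> e1 = c0 + c1 * x1" "b \<bullet> e2 = c0 + c1 * x2" by (auto simp: b_def inner_real2)
  have l: "l1 = exp (b \<bullet> e1)" "l2 = exp (b \<bullet> e2)" by (simp_all add: l1_def l2_def lam_def be)
  have i: "1 / l1 = exp (- (b \<bullet> e1))" "1 / l2 = exp (- (b \<bullet> e2))"
    unfolding l by (simp_all only: exp_minus inverse_eq_divide)
  have p: "l1 > 0" "l2 > 0" by (auto simp: l)
  show ll: "ln l1 = b \<bullet> e1" "ln l2 = b \<bullet> e2" by (simp_all add: l)
  show t1: "t / l1 = exp (- (b \<bullet> e1)) * t" for t unfolding i[symmetric] by simp
  show t2: "(t + hsh l1 l2 tau1) / l2 = exp (- (b \<bullet> e1)) * tau1 + exp (- (b \<bullet> e2)) * (t - tau1)" for t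
    unfolding i[symmetric] using p by (simp add: hsh_def field_simps)
  have mt: "- t / l1 = - (exp (- (b \<bullet> e1)) * t)" for t unfolding t1[symmetric] by simp
  have mt2: "- (t + hsh l1 l2 tau1) / l2 = - (exp (- (b \<bullet> e1)) * tau1 + exp (- (b \<bullet> e2)) * (t - tau1))" for t
    unfolding t2[symmetric] by (simp only: minus_divide_left)
  show 4: "f1 l1 t = exp (- (b \<bullet> e1) - exp (- (b \<bullet> e1)) * t)" for t
    unfolding f1_def i mt by (simp flip: exp_add)
  show 5: "f2 l2 (hsh l1 l2 tau1) t = exp (- (b \<bullet> e2) - exp (- (b \<bullet> e1)) * tau1 - exp (- (b \<bullet> e2)) * (t - tau1))" for t
    unfolding f2_def i mt2 by (simp flip: exp_add)
  show "0 \<le> t \<Longrightarrow> t < tau1 \<Longrightarrow> f1 l1 t = exp (G b t)" by (simp add: 4 G_cases)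
  show "tau1 \<le> t \<Longrightarrow> t < tau2 \<Longrightarrow> f2 l2 (hsh l1 l2 tau1) t = exp (G b t)" by (simp add: 5 G_cases)
  show "tau2 \<le> t \<Longrightarrow> surv l2 (hsh l1 l2 tau1) tau2 = exp (G b t)"
    unfolding surv_def mt2 by (simp add: G_cases)
qed

text \<open>Nonnegative lifetimes matter here: \<open>X\<close> clips at 0, whereas
  \<open>f1\<close> does not.\<close>

lemma dpd_loss_eq:
  assumes s: "\<And>i. i < N \<Longrightarrow> s i \<ge> 0" and be: "\<beta> > 0"
  shows "dpd_loss \<beta> x1 x2 tau1 tau2 N s c0 c1 = H \<beta> N s (rates (vector [c0, c1]))"
proof -
  define b :: "real^2" where "b = vector [c0, c1]"
  define l1 l2 where "l1 = lam c0 c1 x1" and "l2 = lam c0 c1 x2"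
  define h where "h = hsh l1 l2 tau1"
  note mt = model_terms[where ?c0.0=c0 and ?c1.0=c1, folded b_def l1_def l2_def, folded h_def]
  have ep: "exp a powr p = exp (p * a)" for a p :: real by (simp add: powr_def)
  have "Inu (w (\<beta> + 1) (rates b)) = integral {0..tau1} (\<lambda>s. f1 l1 s powr (\<beta> + 1))
      + integral {tau1..tau2} (\<lambda>s. f2 l2 h s powr (\<beta> + 1)) + w (\<beta> + 1) (rates b) tau2"
  proof (rule Inu_integral)
    show "continuous_on {0..tau1} (\<lambda>s. f1 l1 s powr (\<beta> + 1))"
      unfolding mt(4) ep by (intro continuous_intros)
    show "continuous_on {tau1..tau2} (\<lambda>s. f2 l2 h s powr (\<beta> + 1))"
      unfolding mt(5) ep by (intro continuous_intros)
  qed (auto simp: w_rates mt(1,2) ep)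
  moreover have "w (\<beta> + 1) (rates b) tau2 = surv l2 h tau2 powr (\<beta> + 1)"
    using mt(3)[of tau2] by (simp add: w_rates ep)
  moreover have "(\<Sum>i<N. w \<beta> (rates b) (s i)) =
     (\<Sum>i\<in>{i. i < N \<and> s i < tau1}. f1 l1 (s i) powr \<beta>)
         + (\<Sum>i\<in>{i. i < N \<and> tau1 \<le> s i \<and> s i < tau2}. f2 l2 h (s i) powr \<beta>)
         + real (card {i. i < N \<and> tau2 \<le> s i}) * surv l2 h tau2 powr \<beta>"
    unfolding sum_split3
  proof (rule sum.cong)
    fix i assume "i \<in> {..<N}"
    then have "s i \<ge> 0" using s by simp
    then show "w \<beta> (rates b) (s i) = (if s i < tau1 then f1 l1 (s i) powr \<beta>
       else if s i < tau2 then f2 l2 h (s i) powr \<beta> else surv l2 h tau2 powr \<beta>)"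
      using mt(1)[of "s i"] mt(2)[of "s i"] mt(3)[of "s i"] by (auto simp: w_rates ep)
  qed simp
  ultimately show ?thesis
    unfolding dpd_loss_def Let_def H_def b_def[symmetric] l1_def[symmetric] l2_def[symmetric] h_def[symmetric]
    by simp
qed

lemma loglik_eq:
  assumes s: "\<And>i. i < N \<Longrightarrow> s i \<ge> 0"
  shows "loglik x1 x2 tau1 tau2 N s c0 c1 = (\<Sum>i<N. G (vector [c0, c1]) (s i))"
proof -
  define b :: "real^2" where "b = vector [c0, c1]"
  define l1 l2 where "l1 = lam c0 c1 x1" and "l2 = lam c0 c1 x2"
  define h where "h = hsh l1 l2 tau1"
  note mt = model_terms[where ?c0.0=c0 and ?c1.0=c1, folded b_def l1_def l2_def, folded h_def]
  define S1 S2 S3 where "S1 = {i. i < N \<and> s i < tau1}" and "S2 = {i. i < N \<and> tau1 \<le> s i \<and> s i < tau2}"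
    and "S3 = {i. i < N \<and> tau2 \<le> s i}"
  have fin: "finite S1" "finite S2" by (auto simp: S1_def S2_def)
  have "(\<Sum>i<N. G b (s i)) = (\<Sum>i<N. if s i < tau1 then - ln l1 - s i / l1 else
      if s i < tau2 then - ln l2 - (s i + h) / l2 else - (tau2 + h) / l2)"
  proof (rule sum.cong)
    fix i assume "i \<in> {..<N}"
    then have "s i \<ge> 0" using s by simp
    then show "G b (s i) = (if s i < tau1 then - ln l1 - s i / l1 else
      if s i < tau2 then - ln l2 - (s i + h) / l2 else - (tau2 + h) / l2)"
      unfolding minus_divide_left[symmetric] mt(6-9) by (auto simp: G_cases)
  qed simp
  also have "\<dots> = (\<Sum>i\<in>S1. - ln l1 - s i / l1) + (\<Sum>i\<in>S2. - ln l2 - (s i + h) / l2) + real (card S3) * (- (tau2 + h) / l2)"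
    unfolding S1_def S2_def S3_def sum_split3 ..
  also have "\<dots> = - real (card S1) * ln l1 - real (card S2) * ln l2 - (\<Sum>i\<in>S1. s i / l1) - (\<Sum>i\<in>S2. (s i + h) / l2)
     - real (card S3) * (tau2 + h) / l2"
  proof -
    have "real (card S3) * (- (tau2 + h) / l2) = - (real (card S3) * (tau2 + h) / l2)"
      by (simp only: times_divide_eq_right mult_minus_right minus_divide_left)
    then show ?thesis using fin by (simp add: sum_subtractf)
  qed
  also have "\<dots> = loglik x1 x2 tau1 tau2 N s c0 c1"
    using card_split3[of N s, folded S1_def S2_def S3_def, symmetric]
    unfolding loglik_def Let_def card_split3 l1_def[symmetric] l2_def[symmetric] h_def[symmetric]
      S1_def[symmetric] S2_def[symmetric] S3_def[symmetric] by simp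
  finally show ?thesis by (simp add: b_def)
qed

lemma mdpde_foc:
  assumes N: "N > 0" and s: "\<And>i. i < N \<Longrightarrow> s i \<ge> 0" and be: "\<beta> \<ge> 0"
    and md: "is_mdpde \<beta> x1 x2 tau1 tau2 N s b"
  shows "(\<Sum>j<N. psi \<beta> b (s j) $ i) = 0"
proof -
  have b2: "b $ 2 < 0" using md by (simp add: is_mdpde_def)
  have nb: "vector [c$1, c$2] = (c :: real^2)" for c by (simp add: vec_eq_iff forall_2)
  \<comment> \<open>The constraint is open, so an extremum is interior: increments shorter than
    \<open>- (b$2)\<close> stay admissible.\<close>
  have neg: "(b + h) $ 2 < 0" if "norm h < - (b$2)" for h
    using component_le_norm_cart[of h 2] that by (simp add: abs_le_iff)
  have "(\<Sum>j<N. psi \<beta> b (s j)) = 0"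
  proof (cases "\<beta> = 0")
    case True
    have "has_jet (\<lambda>b _. - (\<Sum>j<N. G b (s j))) b (\<lambda>_. - (\<Sum>j<N. u b (s j)))"
      by (rule has_jet_cong[OF has_jet_cmult[OF has_jet_sum[OF has_jet_eval[OF has_jet_G]], where c="-1"]]) auto
    then have "- (\<Sum>j<N. u b (s j)) = 0"
    proof (rule has_jet_min_zero)
      show "- (b$2) > 0" using b2 by simp
      fix h :: "real^2" assume "norm h < - (b$2)"
      from neg[OF this] md have "loglik x1 x2 tau1 tau2 N s ((b + h)$1) ((b + h)$2) \<le> loglik x1 x2 tau1 tau2 N s (b$1) (b$2)"
        by (simp add: is_mdpde_def True del: vector_add_component)
      then show "- (\<Sum>j<N. G b (s j)) \<le> - (\<Sum>j<N. G (b + h) (s j))"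
        by (simp add: loglik_eq[OF s] nb del: vector_add_component)
    qed
    then show ?thesis by (simp add: psi_def True xi_0 sum_negf)
  next
    case False
    with be have be: "\<beta> > 0" by simp
    define F where "F c = Inu (\<lambda>t. exp ((\<beta> + 1) * G c t)) - (\<beta> + 1) / (\<beta> * real N) * (\<Sum>j<N. exp (\<beta> * G c (s j)))" for c
    have v: "(vector [Inu (\<lambda>t. (exp ((\<beta> + 1) * G b t) *\<^sub>R (\<beta> + 1) *\<^sub>R u b t) $ 1), Inu (\<lambda>t. (exp ((\<beta> + 1) * G b t) *\<^sub>R (\<beta> + 1) *\<^sub>R u b t) $ 2)] :: real^2)
      = (\<beta> + 1) *\<^sub>R xi \<beta> b"
      by (simp add: vec_eq_iff forall_2 xi_def Inu_cmult[symmetric] mult_ac)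
    have "has_jet (\<lambda>b _. F b) b (\<lambda>_. (\<beta> + 1) *\<^sub>R xi \<beta> b - ((\<beta> + 1) / (\<beta> * real N)) *\<^sub>R (\<Sum>j<N. exp (\<beta> * G b (s j)) *\<^sub>R \<beta> *\<^sub>R u b (s j)))"
      unfolding F_def v[symmetric]
      by (intro has_jet_diff has_jet_cmult has_jet_sum has_jet_eval[OF has_jet_dens] has_jet_Inu has_jet_dens)
    then have "(\<beta> + 1) *\<^sub>R xi \<beta> b - ((\<beta> + 1) / (\<beta> * real N)) *\<^sub>R (\<Sum>j<N. exp (\<beta> * G b (s j)) *\<^sub>R \<beta> *\<^sub>R u b (s j)) = 0"
    proof (rule has_jet_min_zero)
      show "- (b$2) > 0" using b2 by simp
      fix h :: "real^2" assume "norm h < - (b$2)"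
      from neg[OF this] md False have "dpd_loss \<beta> x1 x2 tau1 tau2 N s (b$1) (b$2) \<le> dpd_loss \<beta> x1 x2 tau1 tau2 N s ((b + h)$1) ((b + h)$2)"
        by (simp add: is_mdpde_def del: vector_add_component)
      then show "F b \<le> F (b + h)"
        by (simp add: dpd_loss_eq[OF s be] nb H_def F_def w_rates w_rates[abs_def] del: vector_add_component)
    qed
    moreover have "(\<Sum>j<N. exp (\<beta> * G b (s j)) *\<^sub>R \<beta> *\<^sub>R u b (s j)) = \<beta> *\<^sub>R (\<Sum>j<N. exp (\<beta> * G b (s j)) *\<^sub>R u b (s j))"
      by (simp add: scaleR_sum_right mult.commute)
    ultimately have "(\<beta> + 1) *\<^sub>R xi \<beta> b = ((\<beta> + 1) / real N) *\<^sub>R (\<Sum>j<N. exp (\<beta> * G b (s j)) *\<^sub>R u b (s j))"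
      using be by simp
    then have "(real N / (\<beta> + 1)) *\<^sub>R ((\<beta> + 1) *\<^sub>R xi \<beta> b) =
      (real N / (\<beta> + 1)) *\<^sub>R (((\<beta> + 1) / real N) *\<^sub>R (\<Sum>j<N. exp (\<beta> * G b (s j)) *\<^sub>R u b (s j)))" by (simp only:)
    then have "real N *\<^sub>R xi \<beta> b = (\<Sum>j<N. exp (\<beta> * G b (s j)) *\<^sub>R u b (s j))"
      using be N by simp
    then show ?thesis by (simp add: psi_def sum_subtractf sum_constant_scaleR del: sum_constant)
  qed
  then show ?thesis by (metis sum_component zero_index)
qed

end

section \<open>Coercivity and divergence of the loss\<close>

context step_stress
begin

text \<open>The factor \<open>m powr (p - 1) / p\<close> avoids a division by the rate, so that the
  formula includes rates equal to zero.\<close>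

lemma Inu_w:
  assumes p: "p > 1" and m: "m1 \<ge> 0" "m2 \<ge> 0"
  shows "Inu (w p (m1, m2)) = m1 powr (p - 1) * (1 - exp (- (p * m1 * tau1))) / p
    + exp (- (p * m1 * tau1)) * (m2 powr (p - 1) * (1 - exp (- (p * m2 * (tau2 - tau1)))) / p)
    + exp (- (p * (m1 * tau1 + m2 * (tau2 - tau1))))"
proof -
  have pw: "x powr p = x powr (p - 1) * x" if "x \<ge> 0" for x
    using powr_mult_base[OF that, of "p - 1"] by (simp add: mult.commute)
  define f where "f t = m1 powr p * exp (- (p * (m1 * t)))" for t
  define g where "g t = m2 powr p * exp (- (p * (m1 * tau1 + m2 * (t - tau1))))" for t
  define F where "F t = - (m1 powr (p - 1) / p) * exp (- (p * (m1 * t)))" for t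
  define K where "K t = - (m2 powr (p - 1) / p) * exp (- (p * (m1 * tau1 + m2 * (t - tau1))))" for t
  have "Inu (w p (m1, m2)) = (F tau1 - F 0) + (K tau2 - K tau1) + w p (m1, m2) tau2"
  proof (rule Inu_FTC)
    show "DERIV F x :> f x" for x
      unfolding F_def[abs_def] f_def using p pw[OF m(1)] by (auto intro!: derivative_eq_intros)
    show "DERIV K x :> g x" for x
      unfolding K_def[abs_def] g_def using p pw[OF m(2)] by (auto intro!: derivative_eq_intros)
    show "isCont f x" "isCont g x" for x unfolding f_def g_def by (intro continuous_intros)+
    show "w p (m1, m2) t = f t" if "0 \<le> t" "t < tau1" for t
      using that by (simp add: w_def f_def r1_def r2_def X_def Y_def max_def min_def)
    show "w p (m1, m2) t = g t" if "tau1 \<le> t" "t < tau2" for t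
      using that tau1_pos by (simp add: w_def g_def r1_def r2_def X_def Y_def max_def min_def)
  qed auto
  also have "w p (m1, m2) tau2 = exp (- (p * (m1 * tau1 + m2 * (tau2 - tau1))))"
    using tau1_pos tau12 by (simp add: w_def r1_def r2_def X_def Y_def)
  finally show ?thesis
    using p by (simp add: F_def K_def field_simps flip: exp_add)
qed

lemma w_split:
  "w p (m1, m2) t = m1 powr p * (r1 t * exp (- (p * m1 * X t)))
    + exp (- (p * m1 * tau1)) * (m2 powr p * (r2 t * exp (- (p * m2 * Y t))))
    + (1 - r1 t - r2 t) * exp (- (p * (m1 * tau1 + m2 * (tau2 - tau1))))"
proof -
  consider "t < tau1" | "tau1 \<le> t" "t < tau2" | "tau2 \<le> t" by linarith
  then show ?thesis
    by cases (use tau1_pos tau12 in \<open>auto simp: w_def r1_def r2_def X_def Y_def algebra_simps simp flip: exp_add\<close>)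
qed

text \<open>In each phase the integral gains about \<open>1 / (\<beta> + 1)\<close> times the power
  of the rate, while the sample loses \<open>k\<close> times the same power, weighted by the damped
  share \<open>a1\<close> or \<open>a2\<close> of failures. Which one wins depends only on that
  share; the censored units cost at most \<open>k\<close>.\<close>

lemma H_lower:
  fixes s :: "nat \<Rightarrow> real"
  assumes be: "\<beta> > 0" and N: "N > 0" and m: "m1 \<ge> 0" "m2 \<ge> 0"
  defines "k \<equiv> (\<beta> + 1) / \<beta>"
  defines "a1 \<equiv> (\<Sum>i<N. r1 (s i) * exp (- (\<beta> * m1 * X (s i)))) / N"
    and "a2 \<equiv> (\<Sum>i<N. r2 (s i) * exp (- (\<beta> * m2 * Y (s i)))) / N"
  shows "H \<beta> N s (m1, m2) \<ge> m1 powr \<beta> * (1 / (\<beta> + 1) * (1 - exp (- ((\<beta> + 1) * m1 * tau1))) - k * a1)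
     + exp (- (\<beta> * m1 * tau1)) * (m2 powr \<beta> * (exp (- (m1 * tau1)) / (\<beta> + 1) * (1 - exp (- ((\<beta> + 1) * m2 * (tau2 - tau1)))) - k * a2))
     - k"
proof -
  define S where "S = exp (- (\<beta> * (m1 * tau1 + m2 * (tau2 - tau1))))"
  define a3 where "a3 = (\<Sum>i<N. 1 - r1 (s i) - r2 (s i)) / N"
  have k: "k > 0" using be by (simp add: k_def)
  have "(\<Sum>i<N. w \<beta> (m1, m2) (s i)) / N = m1 powr \<beta> * a1 + exp (- (\<beta> * m1 * tau1)) * (m2 powr \<beta> * a2) + a3 * S"
    unfolding w_split a1_def a2_def a3_def S_def
    by (simp add: sum.distrib sum_distrib_left[symmetric] sum_distrib_right[symmetric] add_divide_distrib)
  then have H: "H \<beta> N s (m1, m2) = Inu (w (\<beta> + 1) (m1, m2)) - k * (m1 powr \<beta> * a1 + exp (- (\<beta> * m1 * tau1)) * (m2 powr \<beta> * a2) + a3 * S)"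
    unfolding H_def k_def using be N by (simp add: field_simps)
  have E: "exp (- ((\<beta> + 1) * m1 * tau1)) = exp (- (\<beta> * m1 * tau1)) * exp (- (m1 * tau1))"
    by (simp add: algebra_simps flip: exp_add)
  have a3S: "k * (a3 * S) \<le> k"
  proof -
    have "a3 \<le> 1"
    proof -
      have "(\<Sum>i<N. 1 - r1 (s i) - r2 (s i)) \<le> (\<Sum>i<N. 1)"
        by (rule sum_mono) (auto simp: r1_def r2_def)
      then show ?thesis using N by (simp add: a3_def)
    qed
    moreover have "S \<le> 1" "S \<ge> 0" using m tau1_pos tau12 be by (auto simp: S_def intro!: add_nonneg_nonneg mult_nonneg_nonneg)
    moreover have "a3 \<ge> 0" unfolding a3_def by (intro divide_nonneg_nonneg sum_nonneg) (auto simp: r1_def r2_def)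
    ultimately have "a3 * S \<le> 1 * 1" by (intro mult_mono) auto
    then show ?thesis using k mult_left_mono[of "a3 * S" 1 k] by simp
  qed
  have S0: "exp (- ((\<beta> + 1) * (m1 * tau1 + m2 * (tau2 - tau1)))) \<ge> 0" by simp
  show ?thesis
  proof -
    have A: "P * (1 / (\<beta> + 1) * (1 - E) - k * a) = P * (1 - E) / (\<beta> + 1) - k * (P * a)" for P E a
      by (simp add: right_diff_distrib diff_divide_distrib mult.left_commute)
    have B: "e * (Q * (x / (\<beta> + 1) * (1 - E) - k * a)) = (e * x) * (Q * (1 - E) / (\<beta> + 1)) - k * (e * (Q * a))" for e Q x E a
      by (simp add: right_diff_distrib diff_divide_distrib mult_ac)
    have I: "Inu (w (\<beta> + 1) (m1, m2)) = m1 powr \<beta> * (1 - exp (- ((\<beta> + 1) * m1 * tau1))) / (\<beta> + 1)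
      + exp (- ((\<beta> + 1) * m1 * tau1)) * (m2 powr \<beta> * (1 - exp (- ((\<beta> + 1) * m2 * (tau2 - tau1)))) / (\<beta> + 1))
      + exp (- ((\<beta> + 1) * (m1 * tau1 + m2 * (tau2 - tau1))))"
      using Inu_w[of "\<beta> + 1" m1 m2] be m by simp
    show ?thesis
      using H a3S S0 unfolding A B I distrib_left[of k] E[symmetric] by linarith
  qed
qed

text \<open>Failures later than \<open>d\<close> in the phase are damped by
  \<open>exp (- (\<beta> * m1 * d))\<close>, so only the share of failures in the initial window of
  length \<open>d\<close> counts at large rates. The second phase is treated likewise.\<close>

lemma r1_mean_bound:
  assumes be: "\<beta> > 0" and m: "m1 \<ge> 0" and N: "N > (0::nat)"
  shows "(\<Sum>i<N. r1 (s i) * exp (- (\<beta> * m1 * X (s i)))) / N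
    \<le> (\<Sum>i<N. if s i < d then 1 else 0) / N + exp (- (\<beta> * m1 * d))"
proof -
  have "r1 t * exp (- (\<beta> * m1 * X t)) \<le> (if t < d then 1 else 0) + exp (- (\<beta> * m1 * d))" for t
  proof (cases "t < d \<or> tau1 \<le> t")
    case True
    have "exp (- (\<beta> * m1 * X t)) \<le> 1" using be m X_bounds(1) by simp
    then show ?thesis using True by (auto simp: r1_def add_increasing2)
  next
    case False
    then have "X t \<ge> d" by (auto simp: X_def le_max_iff_disj)
    then have "\<beta> * m1 * d \<le> \<beta> * m1 * X t" using be m by (intro mult_left_mono) auto
    then show ?thesis using False by (simp add: r1_def)
  qed
  then have "(\<Sum>i<N. r1 (s i) * exp (- (\<beta> * m1 * X (s i)))) \<le> (\<Sum>i<N. (if s i < d then 1 else 0) + exp (- (\<beta> * m1 * d)))"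
    by (intro sum_mono)
  then show ?thesis using N by (simp add: sum.distrib field_simps)
qed

lemma r2_mean_bound:
  assumes be: "\<beta> > 0" and m: "m2 \<ge> 0" and N: "N > (0::nat)"
  shows "(\<Sum>i<N. r2 (s i) * exp (- (\<beta> * m2 * Y (s i)))) / N
    \<le> (\<Sum>i<N. if tau1 \<le> s i \<and> s i < tau1 + d then 1 else 0) / N + exp (- (\<beta> * m2 * d))"
proof -
  have "r2 t * exp (- (\<beta> * m2 * Y t)) \<le> (if tau1 \<le> t \<and> t < tau1 + d then 1 else 0) + exp (- (\<beta> * m2 * d))" for t
  proof (cases "t < tau1 + d \<or> tau2 \<le> t")
    case True
    have "exp (- (\<beta> * m2 * Y t)) \<le> 1" using be m Y_bounds(1) by simp
    then show ?thesis using True by (auto simp: r2_def add_increasing2)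
  next
    case False
    then have "Y t \<ge> d" by (auto simp: Y_def le_max_iff_disj)
    then have "\<beta> * m2 * d \<le> \<beta> * m2 * Y t" using be m by (intro mult_left_mono) auto
    then show ?thesis using False by (simp add: r2_def)
  qed
  then have "(\<Sum>i<N. r2 (s i) * exp (- (\<beta> * m2 * Y (s i)))) \<le> (\<Sum>i<N. (if tau1 \<le> s i \<and> s i < tau1 + d then 1 else 0) + exp (- (\<beta> * m2 * d)))"
    by (intro sum_mono)
  then show ?thesis using N by (simp add: sum.distrib field_simps)
qed

text \<open>The bracket tends to at least \<open>c - k * q\<close>, which is positive, and the power
  in front tends to infinity. For a fixed sample \<open>q\<close> is 0; for most samples at once it
  is a small positive share.\<close>

lemma power_exp_coercive:
  fixes \<beta> k q c d D K :: real
  assumes be: "\<beta> > 0" and k: "k \<ge> 0" "k * q < c" and d: "d > 0" "D > 0"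
  obtains R where "R > 0" "\<And>s a. s \<ge> R \<Longrightarrow> a \<le> q + exp (- (\<beta> * s * d)) \<Longrightarrow>
    s powr \<beta> * (c * (1 - exp (- ((\<beta> + 1) * s * D))) - k * a) \<ge> K"
proof -
  have e: "((\<lambda>s. exp (- (a * s * b))) \<longlongrightarrow> 0) at_top" if "a > 0" "b > 0" for a b :: real
  proof -
    have "filterlim (\<lambda>s. (a * b) * s) at_top at_top"
      using that by (intro filterlim_tendsto_pos_mult_at_top[OF tendsto_const] filterlim_ident) auto
    then have "((\<lambda>s. exp (- ((a * b) * s))) \<longlongrightarrow> 0) at_top"
      by (intro filterlim_compose[OF exp_at_bot] filterlim_uminus_at_bot_at_top[THEN filterlim_compose])
    then show ?thesis by (simp add: mult_ac)
  qed
  have lim: "((\<lambda>s. c * (1 - exp (- ((\<beta> + 1) * s * D))) - k * (q + exp (- (\<beta> * s * d)))) \<longlongrightarrow> c * (1 - 0) - k * (q + 0)) at_top"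
    by (intro tendsto_intros e) (use be d in auto)
  have pw: "filterlim (\<lambda>s. s powr \<beta>) at_top at_top"
  proof -
    have "filterlim (\<lambda>s. \<beta> * ln s) at_top at_top"
      using be by (intro filterlim_tendsto_pos_mult_at_top[OF tendsto_const] ln_at_top) auto
    then have "filterlim (\<lambda>s. exp (\<beta> * ln s)) at_top at_top"
      by (rule filterlim_compose[OF exp_at_top])
    moreover have "\<forall>\<^sub>F s in at_top. exp (\<beta> * ln s) = s powr \<beta>"
      using eventually_gt_at_top[of 0] by eventually_elim (simp add: powr_def)
    ultimately show ?thesis by (simp cong: filterlim_cong)
  qed
  have pos: "c * (1 - 0) - k * (q + 0) > 0" using k by simp

  have "filterlim (\<lambda>s. s powr \<beta> * (c * (1 - exp (- ((\<beta> + 1) * s * D))) - k * (q + exp (- (\<beta> * s * d))))) at_top at_top"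
    by (rule filterlim_at_top_mult_tendsto_pos[OF lim pos pw])
  then obtain R where R: "\<And>s. s \<ge> R \<Longrightarrow> s powr \<beta> * (c * (1 - exp (- ((\<beta> + 1) * s * D))) - k * (q + exp (- (\<beta> * s * d)))) \<ge> K"
    by (auto simp: filterlim_at_top eventually_at_top_linorder)
  show thesis
  proof (rule that[of "max R 1"])
    fix s a assume s: "s \<ge> max R 1" and a: "a \<le> q + exp (- (\<beta> * s * d))"
    have "K \<le> s powr \<beta> * (c * (1 - exp (- ((\<beta> + 1) * s * D))) - k * (q + exp (- (\<beta> * s * d))))" using R s by simp
    also have "\<dots> \<le> s powr \<beta> * (c * (1 - exp (- ((\<beta> + 1) * s * D))) - k * a)"
      using k a by (intro mult_left_mono diff_left_mono) auto
    finally show "s powr \<beta> * (c * (1 - exp (- ((\<beta> + 1) * s * D))) - k * a) \<ge> K" .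
  qed simp
qed

text \<open>The inequality \<open>s * exp (- (s * d)) \<le> 1 / d\<close>, raised to the power
  \<open>\<beta>\<close>: an observation with exposure at least \<open>d\<close> has a bounded
  contribution at every rate.\<close>

lemma powr_exp_bound:
  fixes s d \<beta> :: real
  assumes "\<beta> > 0" "s \<ge> 0" "d > 0"
  shows "s powr \<beta> * exp (- (\<beta> * s * d)) \<le> (1 / d) powr \<beta>"
proof -
  have "s * d \<le> exp (s * d)" using exp_ge_add_one_self[of "s * d"] by linarith
  then have "s * d * exp (- (s * d)) \<le> exp (s * d) * exp (- (s * d))" by (intro mult_right_mono) auto
  then have "s * d * exp (- (s * d)) \<le> 1" by (simp flip: exp_add)
  then have 1: "s * exp (- (s * d)) \<le> 1 / d" using assms by (simp add: field_simps)
  have "exp (- (\<beta> * s * d)) = exp (- (s * d)) powr \<beta>" by (simp add: powr_def mult_ac)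
  then have "s powr \<beta> * exp (- (\<beta> * s * d)) = (s * exp (- (s * d))) powr \<beta>"
    using assms by (simp add: powr_mult)
  also have "\<dots> \<le> (1 / d) powr \<beta>" using 1 assms by (intro powr_mono2) auto
  finally show ?thesis .
qed

text \<open>Both phase terms are bounded below by a constant depending on the sample. A large
  \<open>m1\<close> makes the first term win. If \<open>m1\<close> stays bounded, the damping factor
  of the second term stays away from zero, and a large \<open>m2\<close> makes that term
  win.\<close>

lemma H_coercive:
  fixes s :: "nat \<Rightarrow> real"
  assumes be: "\<beta> > 0" and N: "N > 0" and s: "\<And>i. i < N \<Longrightarrow> s i > 0 \<and> s i \<noteq> tau1"
  obtains R where "\<And>m1 m2. m1 \<ge> 0 \<Longrightarrow> m2 \<ge> 0 \<Longrightarrow> m1 > R \<or> m2 > R \<Longrightarrow> H \<beta> N s (m1, m2) > K"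
proof -
  define k where "k = (\<beta> + 1) / \<beta>"
  have k: "k > 0" using be by (simp add: k_def)
  \<comment> \<open>No failure lies in the initial window of length \<open>d\<close> of either
    phase, so both window shares vanish.\<close>
  define d where "d = Min ((\<lambda>i. min (s i) \<bar>s i - tau1\<bar>) ` {..<N})"
  have dle: "d \<le> min (s i) \<bar>s i - tau1\<bar>" if "i < N" for i
    unfolding d_def using that by (intro Min_le) auto
  have "d \<in> (\<lambda>i. min (s i) \<bar>s i - tau1\<bar>) ` {..<N}" unfolding d_def using N by (intro Min_in) auto
  then have d: "d > 0" using s by auto
  have z1: "(\<Sum>i<N. if s i < d then 1 else 0) = (0::real)"
    by (rule sum.neutral) (use dle in force)
  have z2: "(\<Sum>i<N. if tau1 \<le> s i \<and> s i < tau1 + d then 1 else 0) = (0::real)"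
  proof (rule sum.neutral, intro ballI)
    fix i assume "i \<in> {..<N}"
    then show "(if tau1 \<le> s i \<and> s i < tau1 + d then 1 else 0) = (0::real)" using dle[of i] by auto
  qed
  define a1 where "a1 m = (\<Sum>i<N. r1 (s i) * exp (- (\<beta> * m * X (s i)))) / N" for m
  define a2 where "a2 m = (\<Sum>i<N. r2 (s i) * exp (- (\<beta> * m * Y (s i)))) / N" for m
  have a1: "a1 m \<le> 0 + exp (- (\<beta> * m * d))" if "m \<ge> 0" for m
    using r1_mean_bound[OF be that N, where s=s and d=d] by (simp add: a1_def z1)
  have a2: "a2 m \<le> 0 + exp (- (\<beta> * m * d))" if "m \<ge> 0" for m
    using r2_mean_bound[OF be that N, where s=s and d=d] by (simp add: a2_def z2)
  define L where "L = k * (1 / d) powr \<beta>"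
  have L0: "L \<ge> 0" using k by (simp add: L_def)
  have low: "x powr \<beta> * (c * (1 - exp (- ((\<beta> + 1) * x * D))) - k * a) \<ge> - L"
    if "x \<ge> 0" "a \<le> 0 + exp (- (\<beta> * x * d))" "c \<ge> 0" "D > 0" for x a c D
  proof -
    have "- L \<le> - (k * (x powr \<beta> * exp (- (\<beta> * x * d))))"
      using powr_exp_bound[OF be that(1) d] k by (simp add: L_def mult_left_mono)
    also have "\<dots> \<le> - (k * (x powr \<beta> * a))" using that k by (simp add: mult_left_mono)
    also have "\<dots> \<le> x powr \<beta> * (c * (1 - exp (- ((\<beta> + 1) * x * D))) - k * a)"
    proof -
      have "0 \<le> x powr \<beta> * (c * (1 - exp (- ((\<beta> + 1) * x * D))))"
        using that be by (intro mult_nonneg_nonneg) auto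
      then show ?thesis by (simp only: right_diff_distrib mult.left_commute[of k])
    qed
    finally show ?thesis .
  qed
  have lowe: "- L \<le> exp (- (\<beta> * m1 * tau1)) * z" if "z \<ge> - L" "m1 \<ge> 0" for z m1
  proof -
    have "exp (- (\<beta> * m1 * tau1)) \<le> 1" using that be tau1_pos by simp
    then have "exp (- (\<beta> * m1 * tau1)) * L \<le> 1 * L" using L0 by (intro mult_right_mono) auto
    moreover have "exp (- (\<beta> * m1 * tau1)) * (- L) \<le> exp (- (\<beta> * m1 * tau1)) * z"
      using that by (intro mult_left_mono) auto
    ultimately show ?thesis by simp
  qed
  have D: "tau2 - tau1 > 0" using tau12 by simp
  obtain R1 where R1: "R1 > 0" "\<And>s a. s \<ge> R1 \<Longrightarrow> a \<le> 0 + exp (- (\<beta> * s * d)) \<Longrightarrow>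
    s powr \<beta> * (1 / (\<beta> + 1) * (1 - exp (- ((\<beta> + 1) * s * tau1))) - k * a) \<ge> K + 1 + L + k"
    by (rule power_exp_coercive[of \<beta> k 0 "1 / (\<beta> + 1)" d tau1 "K + 1 + L + k"]) (use be k d tau1_pos in auto)
  \<comment> \<open>Smallest coefficient of the second phase while \<open>m1\<close> is below
    \<open>R1\<close>. Likewise \<open>K2\<close> compensates the smallest damping
    \<open>exp (- (\<beta> * R1 * tau1))\<close> in that range.\<close>
  define c where "c = exp (- (R1 * tau1)) / (\<beta> + 1)"
  have c: "c > 0" using be by (simp add: c_def)
  define K2 where "K2 = \<bar>K + 1 + L + k\<bar> * exp (\<beta> * R1 * tau1)"
  obtain R2 where R2: "R2 > 0" "\<And>s a. s \<ge> R2 \<Longrightarrow> a \<le> 0 + exp (- (\<beta> * s * d)) \<Longrightarrow>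
    s powr \<beta> * (c * (1 - exp (- ((\<beta> + 1) * s * (tau2 - tau1)))) - k * a) \<ge> K2"
    by (rule power_exp_coercive[of \<beta> k 0 c d "tau2 - tau1" K2]) (use be k d D c in auto)
  show thesis
  proof (rule that[of "max R1 R2"])
    fix m1 m2 :: real assume m: "m1 \<ge> 0" "m2 \<ge> 0" and big: "m1 > max R1 R2 \<or> m2 > max R1 R2"
    note HL = H_lower[OF be N m, of s, folded a1_def a2_def k_def]
    show "H \<beta> N s (m1, m2) > K"
    proof (cases "m1 \<ge> R1")
      case True
      have "m1 powr \<beta> * (1 / (\<beta> + 1) * (1 - exp (- ((\<beta> + 1) * m1 * tau1))) - k * a1 m1) \<ge> K + 1 + L + k"
        by (rule R1(2)[OF True a1[OF m(1)]])
      moreover have "exp (- (\<beta> * m1 * tau1)) * (m2 powr \<beta> * (exp (- (m1 * tau1)) / (\<beta> + 1) * (1 - exp (- ((\<beta> + 1) * m2 * (tau2 - tau1)))) - k * a2 m2)) \<ge> - L"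
        by (rule lowe[OF low[OF m(2) a2[OF m(2)]] m(1)]) (use be D in auto)
      ultimately show ?thesis using HL by linarith
    next
      case False
      with big have m2: "m2 \<ge> R2" by auto
      have "m1 powr \<beta> * (1 / (\<beta> + 1) * (1 - exp (- ((\<beta> + 1) * m1 * tau1))) - k * a1 m1) \<ge> - L"
        by (rule low[OF m(1) a1[OF m(1)]]) (use be tau1_pos in auto)
      moreover have "exp (- (\<beta> * m1 * tau1)) * (m2 powr \<beta> * (exp (- (m1 * tau1)) / (\<beta> + 1) * (1 - exp (- ((\<beta> + 1) * m2 * (tau2 - tau1)))) - k * a2 m2)) \<ge> K + 1 + L + k"
      proof -
        have e1: "exp (- (m1 * tau1)) / (\<beta> + 1) \<ge> c"
          unfolding c_def using False tau1_pos be by (intro divide_right_mono) auto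
        have "m2 powr \<beta> * (exp (- (m1 * tau1)) / (\<beta> + 1) * (1 - exp (- ((\<beta> + 1) * m2 * (tau2 - tau1)))) - k * a2 m2)
           \<ge> m2 powr \<beta> * (c * (1 - exp (- ((\<beta> + 1) * m2 * (tau2 - tau1)))) - k * a2 m2)"
          using e1 m D be by (intro mult_left_mono diff_right_mono mult_right_mono) auto
        then have B: "m2 powr \<beta> * (exp (- (m1 * tau1)) / (\<beta> + 1) * (1 - exp (- ((\<beta> + 1) * m2 * (tau2 - tau1)))) - k * a2 m2) \<ge> K2"
          using R2(2)[OF m2 a2[OF m(2)]] by linarith
        have e2: "exp (- (\<beta> * R1 * tau1)) \<le> exp (- (\<beta> * m1 * tau1))"
          using False tau1_pos be by (simp add: mult_left_mono)
        have "exp (- (\<beta> * R1 * tau1)) * K2 = \<bar>K + 1 + L + k\<bar>"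
          by (simp add: K2_def exp_minus)
        then have "K + 1 + L + k \<le> exp (- (\<beta> * R1 * tau1)) * K2" by linarith
        also have "\<dots> \<le> exp (- (\<beta> * m1 * tau1)) * K2" using e2 by (intro mult_right_mono) (auto simp: K2_def)
        also have "\<dots> \<le> exp (- (\<beta> * m1 * tau1)) * (m2 powr \<beta> * (exp (- (m1 * tau1)) / (\<beta> + 1) * (1 - exp (- ((\<beta> + 1) * m2 * (tau2 - tau1)))) - k * a2 m2))"
          using B by (intro mult_left_mono) auto
        finally show ?thesis .
      qed
      ultimately show ?thesis using HL by linarith
    qed
  qed
qed

text \<open>Contains the boundary, within the closed quadrant, of the cone of admissible rates for
  either order of the stress levels.\<close>

definition degenerate :: "real \<times> real \<Rightarrow> bool" where
  "degenerate m \<longleftrightarrow> fst m = 0 \<or> snd m = 0 \<or> fst m = snd m"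

text \<open>Here \<open>R\<close> is chosen before the sample, given small window shares. This works
  because the damping by the first phase is under control on the boundary: for \<open>m1 = 0\<close>
  it is absent, for \<open>m2 = 0\<close> the second term vanishes, and for \<open>m1 = m2\<close>
  the power of the rate is bounded after damping, at the price of the constant
  \<open>L\<close>.\<close>

lemma H_degenerate_coercive:
  assumes be: "\<beta> > 0" and q: "(\<beta> + 1) / \<beta> * q < 1 / (\<beta> + 1)" and d: "d > 0"
  obtains R where "\<And>N s m1 m2. N > 0 \<Longrightarrow> m1 \<ge> 0 \<Longrightarrow> m2 \<ge> 0 \<Longrightarrow> degenerate (m1, m2) \<Longrightarrow> m1 > R \<or> m2 > R \<Longrightarrow>
     (\<Sum>i<N. if s i < d then 1 else 0) / real N \<le> q \<Longrightarrow>
     (\<Sum>i<N. if tau1 \<le> s i \<and> s i < tau1 + d then 1 else 0) / real N \<le> q \<Longrightarrow> H \<beta> N s (m1, m2) > K"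
proof -
  define k where "k = (\<beta> + 1) / \<beta>"
  have k: "k > 0" using be by (simp add: k_def)
  define L where "L = k * (1 / tau1) powr \<beta>"
  have L0: "L \<ge> 0" using k by (simp add: L_def)
  have D: "tau2 - tau1 > 0" using tau12 by simp
  obtain R1 where R1: "R1 > 0" "\<And>s a. s \<ge> R1 \<Longrightarrow> a \<le> q + exp (- (\<beta> * s * d)) \<Longrightarrow>
    s powr \<beta> * (1 / (\<beta> + 1) * (1 - exp (- ((\<beta> + 1) * s * tau1))) - k * a) \<ge> K + 1 + L + k"
    by (rule power_exp_coercive[of \<beta> k q "1 / (\<beta> + 1)" d tau1 "K + 1 + L + k"]) (use be k d tau1_pos q in \<open>auto simp: k_def\<close>)
  obtain R2 where R2: "R2 > 0" "\<And>s a. s \<ge> R2 \<Longrightarrow> a \<le> q + exp (- (\<beta> * s * d)) \<Longrightarrow>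
    s powr \<beta> * (1 / (\<beta> + 1) * (1 - exp (- ((\<beta> + 1) * s * (tau2 - tau1)))) - k * a) \<ge> K + 1 + L + k"
    by (rule power_exp_coercive[of \<beta> k q "1 / (\<beta> + 1)" d "tau2 - tau1" "K + 1 + L + k"]) (use be k d D q in \<open>auto simp: k_def\<close>)
  show thesis
  proof (rule that[of "max R1 R2"])
    fix N :: nat and s :: "nat \<Rightarrow> real" and m1 m2 :: real
    assume N: "N > 0" and m: "m1 \<ge> 0" "m2 \<ge> 0" and deg: "degenerate (m1, m2)" and big: "m1 > max R1 R2 \<or> m2 > max R1 R2"
      and q1: "(\<Sum>i<N. if s i < d then 1 else 0) / real N \<le> q"
      and q2: "(\<Sum>i<N. if tau1 \<le> s i \<and> s i < tau1 + d then 1 else 0) / real N \<le> q"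
    define a1 where "a1 m = (\<Sum>i<N. r1 (s i) * exp (- (\<beta> * m * X (s i)))) / N" for m
    define a2 where "a2 m = (\<Sum>i<N. r2 (s i) * exp (- (\<beta> * m * Y (s i)))) / N" for m
    have a1: "a1 m \<le> q + exp (- (\<beta> * m * d))" if "m \<ge> 0" for m
      using r1_mean_bound[OF be that N, where s=s and d=d] q1 by (simp add: a1_def)
    have a2: "a2 m \<le> q + exp (- (\<beta> * m * d))" if "m \<ge> 0" for m
      using r2_mean_bound[OF be that N, where s=s and d=d] q2 by (simp add: a2_def)
    note HL = H_lower[OF be N m, of s, folded a1_def a2_def k_def]
    define A where "A = m1 powr \<beta> * (1 / (\<beta> + 1) * (1 - exp (- ((\<beta> + 1) * m1 * tau1))) - k * a1 m1)"
    define B where "B = m2 powr \<beta> * (exp (- (m1 * tau1)) / (\<beta> + 1) * (1 - exp (- ((\<beta> + 1) * m2 * (tau2 - tau1)))) - k * a2 m2)"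
    note HL = HL[folded A_def B_def]
    have A: "A \<ge> K + 1 + L + k" if "m1 \<ge> R1" unfolding A_def by (rule R1(2)[OF that a1[OF m(1)]])
    consider "m2 = 0" "m1 \<ge> R1" | "m1 = m2" "m1 \<ge> R1" | "m1 = 0" "m2 \<ge> R2"
      using deg big m R1(1) R2(1) unfolding degenerate_def by fastforce
    then have "A + exp (- (\<beta> * m1 * tau1)) * B \<ge> K + 1 + k"
    proof cases
      case 1
      then have "B = 0" by (simp add: B_def)
      then show ?thesis using A 1 L0 by simp
    next
      case 2
      have "a2 m2 \<le> 1"
      proof -
        have "r2 t * exp (- (\<beta> * m2 * Y t)) \<le> 1" for t using be m Y_bounds(1) by (simp add: r2_def)
        then have "(\<Sum>i<N. r2 (s i) * exp (- (\<beta> * m2 * Y (s i)))) \<le> (\<Sum>i<N. 1)" by (intro sum_mono)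
        then show ?thesis using N by (simp add: a2_def)
      qed
      have "B \<ge> m2 powr \<beta> * (0 - k * 1)"
        unfolding B_def using be m D k \<open>a2 m2 \<le> 1\<close> by (intro mult_left_mono diff_mono mult_nonneg_nonneg) auto
      then have "exp (- (\<beta> * m1 * tau1)) * B \<ge> exp (- (\<beta> * m1 * tau1)) * (m2 powr \<beta> * (0 - k * 1))"
        by (intro mult_left_mono) auto
      moreover have "m1 powr \<beta> * exp (- (\<beta> * m1 * tau1)) * k \<le> (1 / tau1) powr \<beta> * k"
        using powr_exp_bound[OF be m(1) tau1_pos] k by (intro mult_right_mono) auto
      ultimately have "exp (- (\<beta> * m1 * tau1)) * B \<ge> - L" using 2(1) by (simp add: L_def mult_ac)
      then show ?thesis using A[OF 2(2)] by linarith
    next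
      case 3
      then have "A = 0" by (simp add: A_def)
      moreover have "B \<ge> K + 1 + L + k"
        unfolding B_def using R2(2)[OF 3(2) a2[OF m(2)]] 3 by simp
      ultimately show ?thesis using 3 L0 by simp
    qed
    then show "H \<beta> N s (m1, m2) > K" using HL by linarith
  qed
qed

section \<open>Continuity on compact sets of rates\<close>

text \<open>\<open>w\<close> jumps in the observation, but it is a jointly continuous function of
  the rates and of the four statistics \<open>r1\<close>, \<open>r2\<close>, \<open>X\<close>,
  \<open>Y\<close>, which range over a compact box; uniform continuity there gives a modulus that is
  independent of \<open>t\<close>.\<close>

lemma w_equicontinuous:
  assumes p: "p > 0" and e: "e > 0"
  obtains d where "d > 0" "\<And>m m' t. m \<in> {0..R} \<times> {0..R} \<Longrightarrow> m' \<in> {0..R} \<times> {0..R} \<Longrightarrow> dist m m' < d \<Longrightarrow>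
    \<bar>w p m t - w p m' t\<bar> < e"
proof -
  define W where "W = (\<lambda>(m, (a, b), (x, y)). (a * fst m powr p + b * snd m powr p + (1 - a - b)) * exp (- (p * (fst m * x + snd m * y))))"
  define C where "C = (({0..R} \<times> {0..R}) \<times> (({0..1} \<times> {0..1}) \<times> ({0..tau1} \<times> {0..tau2 - tau1})) :: ((real \<times> real) \<times> (real \<times> real) \<times> real \<times> real) set)"
  have "compact C" unfolding C_def by (intro compact_Times compact_Icc)
  moreover have "continuous_on C W"
    unfolding W_def case_prod_beta C_def using p
    by (intro continuous_intros continuous_on_powr') auto
  ultimately have "uniformly_continuous_on C W" by (rule compact_uniformly_continuous[rotated])
  with e obtain d where d: "d > 0" "\<And>z z'. z \<in> C \<Longrightarrow> z' \<in> C \<Longrightarrow> dist z' z < d \<Longrightarrow> dist (W z') (W z) < e"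
    unfolding uniformly_continuous_on_def by metis
  show thesis
  proof (rule that[OF d(1)])
    fix m m' t assume m: "m \<in> {0..R} \<times> {0..R}" "m' \<in> {0..R} \<times> {0..R}" "dist m m' < d"
    define z where "z m = (m, (r1 t, r2 t), (X t, Y t))" for m :: "real \<times> real"
    have "z m \<in> C" "z m' \<in> C" using m X_bounds[of t] Y_bounds[of t] by (auto simp: z_def C_def r1_def r2_def)
    moreover have "dist (z m) (z m') < d" using m(3) by (simp add: z_def dist_Pair_Pair)
    ultimately have "dist (W (z m)) (W (z m')) < e" using d(2) by blast
    then show "\<bar>w p m t - w p m' t\<bar> < e" by (simp add: z_def W_def w_def dist_real_def)
  qed
qed

lemma continuous_Inu_w:
  assumes p: "p > 0" and f: "bm f"
  shows "continuous_on ({0..R} \<times> {0..R}) (\<lambda>m. Inu (\<lambda>t. w p m t * f t))"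
  unfolding continuous_on_iff
proof (intro ballI allI impI)
  fix m :: "real \<times> real" and e :: real assume m: "m \<in> {0..R} \<times> {0..R}" and e: "e > 0"
  obtain C where C: "C \<ge> 1" "\<And>t. \<bar>f t\<bar> \<le> C" using bm_bound[OF f] by metis
  define e' where "e' = e / (2 * C * (tau2 + 1))"
  have t2: "tau2 + 1 > 0" using tau1_pos tau12 by simp
  have e': "e' > 0" using e C t2 by (simp add: e'_def)
  obtain d where d: "d > 0" "\<And>m m' t. m \<in> {0..R} \<times> {0..R} \<Longrightarrow> m' \<in> {0..R} \<times> {0..R} \<Longrightarrow> dist m m' < d \<Longrightarrow>
    \<bar>w p m t - w p m' t\<bar> < e'" by (rule w_equicontinuous[OF p e', where R=R]) blast
  show "\<exists>d>0. \<forall>m'\<in>{0..R} \<times> {0..R}. dist m' m < d \<longrightarrow> dist (Inu (\<lambda>t. w p m' t * f t)) (Inu (\<lambda>t. w p m t * f t)) < e"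
  proof (intro exI[of _ d] conjI ballI impI d(1))
    fix m' :: "real \<times> real" assume m': "m' \<in> {0..R} \<times> {0..R}" "dist m' m < d"
    have "Inu (\<lambda>t. w p m' t * f t) - Inu (\<lambda>t. w p m t * f t) = Inu (\<lambda>t. w p m' t * f t - w p m t * f t)"
      using f by (subst Inu_diff) auto
    moreover have "\<bar>Inu (\<lambda>t. w p m' t * f t - w p m t * f t)\<bar> \<le> (e' * C) * (tau2 + 1)"
    proof (rule Inu_bound)
      show "\<bar>w p m' t * f t - w p m t * f t\<bar> \<le> e' * C" for t
        unfolding left_diff_distrib[symmetric] abs_mult using d(2)[OF m'(1) m m'(2), of t] C e'
        by (intro mult_mono) auto
    qed (use f in auto)
    moreover have "(e' * C) * (tau2 + 1) = e / 2"
    proof -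
      have "e / (2 * C * T) * C * T = e / 2" if "T > 0" for T using C(1) that by simp
      from this[OF t2] show ?thesis by (simp only: e'_def)
    qed
    ultimately show "dist (Inu (\<lambda>t. w p m' t * f t)) (Inu (\<lambda>t. w p m t * f t)) < e" using e by (simp add: dist_real_def)
  qed
qed

lemma continuous_H:
  assumes be: "\<beta> > 0"
  shows "continuous_on ({0..R} \<times> {0..R}) (H \<beta> N s)"
proof -
  have "continuous_on ({0..R} \<times> {0..R}) (\<lambda>m. w \<beta> m t)" for t
    unfolding continuous_on_iff
  proof (intro ballI allI impI)
    fix m :: "real \<times> real" and e :: real assume m: "m \<in> {0..R} \<times> {0..R}" and e: "e > 0"
    obtain d where d: "d > 0" "\<And>m m' t. m \<in> {0..R} \<times> {0..R} \<Longrightarrow> m' \<in> {0..R} \<times> {0..R} \<Longrightarrow> dist m m' < d \<Longrightarrow>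
      \<bar>w \<beta> m t - w \<beta> m' t\<bar> < e" by (rule w_equicontinuous[OF be e, where R=R]) blast
    then show "\<exists>d>0. \<forall>m'\<in>{0..R} \<times> {0..R}. dist m' m < d \<longrightarrow> dist (w \<beta> m' t) (w \<beta> m t) < e"
      using m by (intro exI[of _ d]) (auto simp: dist_real_def)
  qed
  moreover have "continuous_on ({0..R} \<times> {0..R}) (\<lambda>m. Inu (w (\<beta> + 1) m))"
    using continuous_Inu_w[of "\<beta> + 1" "\<lambda>_. 1" R] be by simp
  ultimately show ?thesis unfolding H_def[abs_def] by (intro continuous_intros)
qed

text \<open>The last term, constant in \<open>m\<close>, makes the density power divergence vanish at \<open>m = rates b\<close>.\<close>
definition dpd :: "real \<Rightarrow> real^2 \<Rightarrow> real \<times> real \<Rightarrow> real" where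
  "dpd \<beta> b m = Inu (w (\<beta> + 1) m) - (\<beta> + 1) / \<beta> * Inu (\<lambda>t. w \<beta> m t * exp (G b t)) + 1 / \<beta> * Inu (\<lambda>t. exp ((\<beta> + 1) * G b t))"

section \<open>Strict positivity of the density power divergence\<close>

lemma exp_gt_add_one: "x \<noteq> 0 \<Longrightarrow> 1 + x < exp (x::real)"
proof -
  assume x: "x \<noteq> 0"
  have "1 + x / 2 \<le> exp (x / 2)" by (rule exp_ge_add_one_self)
  show ?thesis
  proof (cases "1 + x / 2 \<ge> 0")
    case True
    have "0 < x * x" using x not_real_square_gt_zero by blast
    then have "1 + x < (1 + x / 2)\<^sup>2" by (simp add: power2_eq_square field_simps)
    also have "\<dots> \<le> (exp (x / 2))\<^sup>2" using True by (intro power_mono exp_ge_add_one_self) auto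
    also have "\<dots> = exp x" by (simp add: power2_eq_square flip: exp_add)
    finally show ?thesis .
  next
    case False
    then have "1 + x < 0" by simp
    then show ?thesis by (simp add: order_less_trans[OF _ exp_gt_zero])
  qed
qed

text \<open>With \<open>z = l - c\<close> a positive factor splits off and leaves
  \<open>exp z + exp (- (\<beta> * z)) / \<beta>\<close> minus
  \<open>(\<beta> + 1) / \<beta>\<close>. The tangent lines at 0 of the two exponentials add up to
  exactly that constant, and strictness of the first tangent bound settles the case of
  equality.\<close>

lemma dpd_pointwise:
  fixes \<beta> l c :: real
  assumes be: "\<beta> > 0"
  shows "exp ((\<beta> + 1) * l) - (\<beta> + 1) / \<beta> * (exp (\<beta> * l) * exp c) + 1 / \<beta> * exp ((\<beta> + 1) * c) \<ge> 0"
    and "exp ((\<beta> + 1) * l) - (\<beta> + 1) / \<beta> * (exp (\<beta> * l) * exp c) + 1 / \<beta> * exp ((\<beta> + 1) * c) = 0 \<Longrightarrow> l = c"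
proof -
  define z where "z = l - c"
  have eq: "exp ((\<beta> + 1) * l) - (\<beta> + 1) / \<beta> * (exp (\<beta> * l) * exp c) + 1 / \<beta> * exp ((\<beta> + 1) * c)
     = exp (\<beta> * l + c) * (exp z - (\<beta> + 1) / \<beta> + 1 / \<beta> * exp (- (\<beta> * z)))"
  proof -
    have "exp ((\<beta> + 1) * l) = exp (\<beta> * l + c) * exp z" "exp (\<beta> * l) * exp c = exp (\<beta> * l + c)"
      "exp ((\<beta> + 1) * c) = exp (\<beta> * l + c) * exp (- (\<beta> * z))"
      by (simp_all add: z_def algebra_simps flip: exp_add)
    then show ?thesis by (simp add: algebra_simps)
  qed
  have id: "(1 + z) - (\<beta> + 1) / \<beta> + 1 / \<beta> * (1 + - (\<beta> * z)) = 0"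
    using be by (simp add: field_simps)
  have "1 / \<beta> * (1 + - (\<beta> * z)) \<le> 1 / \<beta> * exp (- (\<beta> * z))"
    using be by (intro mult_left_mono exp_ge_add_one_self) auto
  then have 2: "exp z - (\<beta> + 1) / \<beta> + 1 / \<beta> * exp (- (\<beta> * z)) \<ge> exp z - (1 + z)" using id by linarith
  have 3: "exp z - (1 + z) \<ge> 0" using exp_ge_add_one_self[of z] by simp
  show "exp ((\<beta> + 1) * l) - (\<beta> + 1) / \<beta> * (exp (\<beta> * l) * exp c) + 1 / \<beta> * exp ((\<beta> + 1) * c) \<ge> 0"
    unfolding eq by (rule mult_nonneg_nonneg) (simp, use 2 3 in linarith)
  assume "exp ((\<beta> + 1) * l) - (\<beta> + 1) / \<beta> * (exp (\<beta> * l) * exp c) + 1 / \<beta> * exp ((\<beta> + 1) * c) = 0"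
  then have "exp z - (\<beta> + 1) / \<beta> + 1 / \<beta> * exp (- (\<beta> * z)) = 0" unfolding eq by simp
  with 2 3 have "exp z = 1 + z" by linarith
  then have "z = 0" using exp_gt_add_one[of z] by fastforce
  then show "l = c" by (simp add: z_def)
qed

text \<open>A vanishing divergence forces the two densities to agree inside each phase. The first
  phase determines \<open>m1\<close>; the second, after cancelling the common survival factor,
  determines \<open>m2\<close>.\<close>

lemma dpd_pos:
  assumes be: "\<beta> > 0" and m: "m1 \<ge> 0" "m2 \<ge> 0" and ne: "(m1, m2) \<noteq> rates b"
  shows "dpd \<beta> b (m1, m2) > 0"
proof -
  define f where "f t = w (\<beta> + 1) (m1, m2) t - (\<beta> + 1) / \<beta> * (w \<beta> (m1, m2) t * exp (G b t)) + 1 / \<beta> * exp ((\<beta> + 1) * G b t)" for t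
  have bmf: "bm f" unfolding f_def by (intro bm_add bm_diff bm_mult bm_const bm_exp bm_w bm_G)
  have D: "dpd \<beta> b (m1, m2) = Inu f"
    unfolding f_def dpd_def
    by (subst Inu_add, (intro bm_add bm_diff bm_mult bm_const bm_exp bm_w bm_G)+, subst Inu_diff,
        (intro bm_add bm_diff bm_mult bm_const bm_exp bm_w bm_G)+) (simp only: Inu_cmult)
  \<comment> \<open>One logarithm \<open>l\<close> serves both powers \<open>\<beta>\<close> and
    \<open>\<beta> + 1\<close>, so the pointwise inequality applies. The exception is a phase with
    rate zero, where all powers vanish and the integrand is strictly positive.\<close>
  have ws: "(\<exists>l. \<forall>p>0. w p (m1, m2) t = exp (p * l)) \<or> (\<forall>p>0. w p (m1, m2) t = 0)" for t
  proof -
    define c where "c = (if t < tau1 then m1 else if t < tau2 then m2 else 1)"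
    have w: "w p (m1, m2) t = c powr p * exp (- (p * (m1 * X t + m2 * Y t)))" for p
      using tau12 by (auto simp: w_def c_def r1_def r2_def)
    have c: "c \<ge> 0" using m by (simp add: c_def)
    show ?thesis
    proof (cases "c = 0")
      case True
      then show ?thesis by (simp add: w)
    next
      case False
      with c have "c > 0" by simp
      then have "\<forall>p>0. w p (m1, m2) t = exp (p * (ln c - (m1 * X t + m2 * Y t)))"
        by (simp add: w powr_def algebra_simps flip: exp_add)
      then show ?thesis by blast
    qed
  qed
  have f0: "f t \<ge> 0" and fz: "f t = 0 \<Longrightarrow> w 1 (m1, m2) t = exp (G b t)" for t
  proof -
    have "f t \<ge> 0 \<and> (f t = 0 \<longrightarrow> w 1 (m1, m2) t = exp (G b t))"
      using ws[of t]
    proof (elim disjE exE)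
      fix l assume l: "\<forall>p>0. w p (m1, m2) t = exp (p * l)"
      then have "f t = exp ((\<beta> + 1) * l) - (\<beta> + 1) / \<beta> * (exp (\<beta> * l) * exp (G b t)) + 1 / \<beta> * exp ((\<beta> + 1) * G b t)"
        using be by (simp add: f_def)
      then show ?thesis using dpd_pointwise[OF be, of l "G b t"] l by auto
    next
      assume "\<forall>p>0. w p (m1, m2) t = 0"
      then have "f t = 1 / \<beta> * exp ((\<beta> + 1) * G b t)" using be by (simp add: f_def)
      moreover have "\<dots> > 0" using be by simp
      ultimately show ?thesis using be by simp
    qed
    then show "f t \<ge> 0" "f t = 0 \<Longrightarrow> w 1 (m1, m2) t = exp (G b t)" by auto
  qed
  have wc: "continuous_on {0<..<tau1} (w p (m1, m2))" "continuous_on {tau1<..<tau2} (w p (m1, m2))" for p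
  proof -
    have "continuous_on {0<..<tau1} (\<lambda>t. m1 powr p * exp (- (p * (m1 * t))))" by (intro continuous_intros)
    then show "continuous_on {0<..<tau1} (w p (m1, m2))"
      by (rule continuous_on_eq) (auto simp: w_def r1_def r2_def X_def Y_def)
    have "continuous_on {tau1<..<tau2} (\<lambda>t. m2 powr p * exp (- (p * (m1 * tau1 + m2 * (t - tau1)))))" by (intro continuous_intros)
    then show "continuous_on {tau1<..<tau2} (w p (m1, m2))"
      by (rule continuous_on_eq) (use tau1_pos in \<open>auto simp: w_def r1_def r2_def X_def Y_def\<close>)
  qed
  have fc: "continuous_on {0<..<tau1} f" "continuous_on {tau1<..<tau2} f"
    unfolding f_def by (intro continuous_intros wc cont_regions)+
  have "Inu f \<noteq> 0"
  proof
    assume z: "Inu f = 0"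
    define c1 c2 where "c1 = exp (- (b \<bullet> e1))" and "c2 = exp (- (b \<bullet> e2))"
    \<comment> \<open>Taking logarithms makes both sides affine in \<open>t\<close>; comparing two
      times equates the slopes. A zero \<open>x\<close> is excluded first since the right-hand side
      is positive.\<close>
    have inj: "x = y" if "x \<ge> 0" "y > 0" "a < d" and eq: "\<And>t. a < t \<Longrightarrow> t < d \<Longrightarrow> x * exp (- (x * (t - a))) = y * exp (- (y * (t - a)))" for x y a d :: real
    proof -
      define t1 t2 where "t1 = a + (d - a) / 3" and "t2 = a + (d - a) / 2"
      have t: "a < t1" "t1 < d" "a < t2" "t2 < d" "t1 \<noteq> t2" using that by (auto simp: t1_def t2_def field_simps)
      have "x \<noteq> 0" using eq[OF t(1,2)] that by auto
      with that have x: "x > 0" by simp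
      have "ln x - x * (t - a) = ln y - y * (t - a)" if "a < t" "t < d" for t
      proof -
        have "ln (x * exp (- (x * (t - a)))) = ln (y * exp (- (y * (t - a))))" using eq that by simp
        then show ?thesis using x \<open>y > 0\<close> by (simp add: ln_mult)
      qed
      from this[OF t(1,2)] this[OF t(3,4)] have "(x - y) * (t1 - t2) = 0" by (simp add: algebra_simps)
      then show ?thesis using t by simp
    qed
    have m1: "m1 = c1"
    proof (rule inj[OF m(1) _ tau1_pos])
      fix t assume t: "0 < t" "t < tau1"
      have "f t = 0" by (rule Inu_zeroD(2)[OF bmf f0 z, of 0 tau1]) (use t tau12 fc in auto)
      then have "w 1 (m1, m2) t = exp (G b t)" by (rule fz)
      moreover have "w 1 (m1, m2) t = m1 * exp (- (m1 * (t - 0)))" using t m by (simp add: w_def r1_def r2_def X_def Y_def)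
      moreover have "exp (G b t) = c1 * exp (- (c1 * (t - 0)))"
      proof -
        have "G b t = - (b \<bullet> e1) + - (c1 * (t - 0))" using t by (simp add: G_cases c1_def)
        then show ?thesis by (simp only: exp_add c1_def)
      qed
      ultimately show "m1 * exp (- (m1 * (t - 0))) = c1 * exp (- (c1 * (t - 0)))" by simp
    qed (simp add: c1_def)
    have m2: "m2 = c2"
    proof (rule inj[OF m(2) _ tau12])
      fix t assume t: "tau1 < t" "t < tau2"
      have "f t = 0" by (rule Inu_zeroD(2)[OF bmf f0 z, of tau1 tau2]) (use t tau1_pos fc in auto)
      then have "w 1 (m1, m2) t = exp (G b t)" by (rule fz)
      moreover have "w 1 (m1, m2) t = exp (- (m1 * tau1)) * (m2 * exp (- (m2 * (t - tau1))))"
        using t m tau1_pos by (simp add: w_def r1_def r2_def X_def Y_def mult_exp_exp algebra_simps)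
      moreover have "exp (G b t) = exp (- (c1 * tau1)) * (c2 * exp (- (c2 * (t - tau1))))"
      proof -
        have "G b t = - (c1 * tau1) + (- (b \<bullet> e2) + - (c2 * (t - tau1)))"
          using t by (simp add: G_cases c1_def c2_def)
        then show ?thesis by (simp only: exp_add c2_def)
      qed
      ultimately show "m2 * exp (- (m2 * (t - tau1))) = c2 * exp (- (c2 * (t - tau1)))" using m1 by simp
    qed (simp add: c2_def)
    show False using ne m1 m2 by (simp add: rates_def c1_def c2_def)
  qed
  moreover have "Inu f \<ge> 0" by (rule Inu_nonneg[OF bmf f0])
  ultimately show ?thesis unfolding D by simp
qed

end

section \<open>Existence of minimizers\<close>

context step_stress
begin

text \<open>A negative slope means that the higher stress has the larger rate. The product covers
  both orders of the stress levels.\<close>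

lemma rates_cone:
  assumes x: "x1 \<noteq> x2"
  shows "c $ 2 < 0 \<longleftrightarrow> 0 < (x2 - x1) * (snd (rates c) - fst (rates c))"
proof -
  have d: "c \<bullet> e2 - c \<bullet> e1 = c $ 2 * (x2 - x1)" by (simp add: inner_real2 algebra_simps)
  have r: "snd (rates c) > fst (rates c) \<longleftrightarrow> c $ 2 * (x2 - x1) < 0"
    "snd (rates c) < fst (rates c) \<longleftrightarrow> c $ 2 * (x2 - x1) > 0"
    unfolding d[symmetric] by (auto simp: rates_def)
  show ?thesis
  proof (cases "x1 < x2")
    case True
    then show ?thesis using r by (auto simp: zero_less_mult_iff mult_less_0_iff)
  next
    case False
    then have "x2 < x1" using x by simp
    then show ?thesis using r by (auto simp: zero_less_mult_iff mult_less_0_iff)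
  qed
qed

lemma rates_surj:
  assumes x: "x1 \<noteq> x2" and m: "m1 > 0" "m2 > 0"
  obtains b where "rates b = (m1, m2)"
proof -
  define b2 where "b2 = (ln m2 - ln m1) / (x1 - x2)"
  define b where "b = (vector [- ln m1 - b2 * x1, b2] :: real^2)"
  have "b2 * (x1 - x2) = ln m2 - ln m1" using x by (simp add: b2_def)
  then have "b \<bullet> e1 = - ln m1" "b \<bullet> e2 = - ln m2" by (auto simp: b_def inner_real2 algebra_simps)
  then have "rates b = (m1, m2)" using m by (simp add: rates_def)
  then show thesis by (rule that)
qed

lemma rates_not_degenerate:
  assumes "x1 \<noteq> x2" "b $ 2 < 0" shows "\<not> degenerate (rates b)"
proof -
  have "snd (rates b) \<noteq> fst (rates b)" using assms rates_cone[of b] by auto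
  then show ?thesis by (auto simp: degenerate_def rates_def)
qed

lemma exists_mdpde_pos:
  assumes x: "x1 \<noteq> x2" and be: "\<beta> > 0" and N: "N > 0" and s: "\<And>i. i < N \<Longrightarrow> s i > 0 \<and> s i \<noteq> tau1"
    and b0: "b0 $ 2 < 0"
    and deg: "\<And>m1 m2. m1 \<ge> 0 \<Longrightarrow> m2 \<ge> 0 \<Longrightarrow> degenerate (m1, m2) \<Longrightarrow> H \<beta> N s (rates b0) < H \<beta> N s (m1, m2)"
  shows "\<exists>b. is_mdpde \<beta> x1 x2 tau1 tau2 N s b"
proof -
  have s0: "\<And>i. i < N \<Longrightarrow> s i \<ge> 0" using s by (simp add: less_imp_le)
  obtain R where R: "\<And>m1 m2. m1 \<ge> 0 \<Longrightarrow> m2 \<ge> 0 \<Longrightarrow> m1 > R \<or> m2 > R \<Longrightarrow> H \<beta> N s (m1, m2) > H \<beta> N s (rates b0)"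
  proof (rule H_coercive[OF be N s, where K="H \<beta> N s (rates b0)"])
    fix R assume "\<And>m1 m2. m1 \<ge> 0 \<Longrightarrow> m2 \<ge> 0 \<Longrightarrow> m1 > R \<or> m2 > R \<Longrightarrow> H \<beta> N s (m1, m2) > H \<beta> N s (rates b0)"
    then show thesis by (rule that)
  qed
  have rp: "fst (rates b) > 0" "snd (rates b) > 0" for b by (auto simp: rates_def)
  \<comment> \<open>The square must also contain \<open>rates b0\<close>, the point with which
    candidates outside the square and on the boundary are compared.\<close>
  define R' where "R' = max R (max (fst (rates b0)) (snd (rates b0)))"
  define C where "C = ({0..R'} \<times> {0..R'}) \<inter> {m. 0 \<le> (x2 - x1) * (snd m - fst m)}"
  have "compact C" unfolding C_def
    by (intro compact_Int_closed compact_Times compact_Icc closed_Collect_le continuous_intros)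
  moreover have b0C: "rates b0 \<in> C"
    using rp[of b0] rates_cone[OF x, of b0] b0 by (cases "rates b0") (auto simp: C_def R'_def)
  moreover have "continuous_on C (H \<beta> N s)"
    by (rule continuous_on_subset[OF continuous_H[OF be, of R']]) (auto simp: C_def)
  ultimately obtain m where m: "m \<in> C" "\<And>m'. m' \<in> C \<Longrightarrow> H \<beta> N s m \<le> H \<beta> N s m'"
    using continuous_attains_inf[of C "H \<beta> N s"] by blast
  obtain m1 m2 where mm: "m = (m1, m2)" by (cases m)
  have mp: "m1 \<ge> 0" "m2 \<ge> 0" "0 \<le> (x2 - x1) * (m2 - m1)" using m(1) by (auto simp: C_def mm)
  have min: "H \<beta> N s m \<le> H \<beta> N s (rates c)" if c: "c $ 2 < 0" for c
  proof (cases "rates c \<in> {0..R'} \<times> {0..R'}")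
    case True
    then have "rates c \<in> C" using rates_cone[OF x, of c] c by (simp add: C_def)
    then show ?thesis by (rule m(2))
  next
    case False
    then have "fst (rates c) > R \<or> snd (rates c) > R" using rp[of c] by (cases "rates c") (auto simp: R'_def)
    then have "H \<beta> N s (rates c) > H \<beta> N s (rates b0)" using R[of "fst (rates c)" "snd (rates c)"] rp[of c] by simp
    then show ?thesis using m(2)[OF b0C] by simp
  qed
  have "\<not> degenerate (m1, m2)" using deg[OF mp(1,2)] m(2)[OF b0C] by (auto simp: mm)
  then have pos: "m1 > 0" "m2 > 0" "m1 \<noteq> m2" using mp by (auto simp: degenerate_def)
  then have strict: "0 < (x2 - x1) * (m2 - m1)" using mp(3) x by (simp add: order_less_le)
  obtain b where b: "rates b = (m1, m2)" by (rule rates_surj[OF x pos(1,2)])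
  have b2: "b $ 2 < 0" using rates_cone[OF x, of b] strict by (simp add: b)
  have nb: "vector [c$1, c$2] = (c :: real^2)" for c by (simp add: vec_eq_iff forall_2)
  have "is_mdpde \<beta> x1 x2 tau1 tau2 N s b"
    unfolding is_mdpde_def
  proof (intro conjI b2)
    have "dpd_loss \<beta> x1 x2 tau1 tau2 N s (b $ 1) (b $ 2) \<le> dpd_loss \<beta> x1 x2 tau1 tau2 N s c0 c1" if "c1 < 0" for c0 c1
      using min[of "vector [c0, c1]"] that by (simp add: dpd_loss_eq[OF s0 be] nb b mm)
    then show "if \<beta> = 0 then \<forall>c0 c1. c1 < 0 \<longrightarrow> loglik x1 x2 tau1 tau2 N s c0 c1 \<le> loglik x1 x2 tau1 tau2 N s (b $ 1) (b $ 2)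
      else \<forall>c0 c1. c1 < 0 \<longrightarrow> dpd_loss \<beta> x1 x2 tau1 tau2 N s (b $ 1) (b $ 2) \<le> dpd_loss \<beta> x1 x2 tau1 tau2 N s c0 c1"
      using be by simp
  qed
  then show ?thesis by blast
qed

text \<open>The hypothesis on \<open>\<eta>'\<close> is the likelihood equation; the tangent line of
  the exponential at that point gives global optimality.\<close>

lemma exponential_loglik_max:
  fixes n S \<eta> \<eta>' :: real
  assumes n: "n > 0" and S: "S > 0" and e: "exp (- \<eta>') = n / S"
  shows "- n * \<eta> - exp (- \<eta>) * S \<le> - n * \<eta>' - exp (- \<eta>') * S"
proof -
  have "exp (- \<eta>) = exp (- \<eta>') * exp (\<eta>' - \<eta>)" by (simp flip: exp_add)
  then have "exp (- \<eta>) * S = n * exp (\<eta>' - \<eta>)" using S by (simp add: e)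
  also have "\<dots> \<ge> n * (1 + (\<eta>' - \<eta>))" using n by (intro mult_left_mono exp_ge_add_one_self) auto
  finally have "exp (- \<eta>) * S \<ge> n * (1 + (\<eta>' - \<eta>))" .
  moreover have "exp (- \<eta>') * S = n" using S by (simp add: e)
  ultimately show ?thesis by (simp add: algebra_simps)
qed

text \<open>The log-likelihood separates in the two log mean lifetimes. Each part is maximal when
  the rate equals failures divided by total exposure, and \<open>cone\<close> says that this pair of
  rates is admissible.\<close>

lemma exists_mle:
  assumes x: "x1 \<noteq> x2" and s: "\<And>i. i < N \<Longrightarrow> s i \<ge> 0"
  defines "n1 \<equiv> \<Sum>i<N. r1 (s i)" and "n2 \<equiv> \<Sum>i<N. r2 (s i)"
    and "S1 \<equiv> \<Sum>i<N. X (s i)" and "S2 \<equiv> \<Sum>i<N. Y (s i)"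
  assumes n: "n1 > 0" "n2 > 0" and S: "S1 > 0" "S2 > 0" and cone: "0 < (x2 - x1) * (n2 / S2 - n1 / S1)"
  shows "\<exists>b. is_mdpde 0 x1 x2 tau1 tau2 N s b"
proof -
  have "n1 / S1 > 0" "n2 / S2 > 0" using n S by auto
  then obtain b where b: "rates b = (n1 / S1, n2 / S2)" by (rule rates_surj[OF x])
  have b2: "b $ 2 < 0" using rates_cone[OF x, of b] cone by (simp add: b)
  have nb: "vector [c$1, c$2] = (c :: real^2)" for c by (simp add: vec_eq_iff forall_2)
  have G: "(\<Sum>i<N. G c (s i)) = (- n1 * (c \<bullet> e1) - exp (- (c \<bullet> e1)) * S1) + (- n2 * (c \<bullet> e2) - exp (- (c \<bullet> e2)) * S2)" for c
    unfolding G_def n1_def n2_def S1_def S2_def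
    by (simp add: sum_subtractf sum_negf sum_distrib_left[symmetric] sum_distrib_right[symmetric])
  have "(\<Sum>i<N. G c (s i)) \<le> (\<Sum>i<N. G b (s i))" for c
    unfolding G using b
    by (intro add_mono exponential_loglik_max n S) (auto simp: rates_def)
  then have "loglik x1 x2 tau1 tau2 N s c0 c1 \<le> loglik x1 x2 tau1 tau2 N s (b $ 1) (b $ 2)" for c0 c1
    by (simp add: loglik_eq[OF s] nb)
  then show ?thesis using b2 by (auto simp: is_mdpde_def)
qed

lemma Inu_small:
  assumes bm: "bm f" and z: "f tau2 = 0" and C: "C \<ge> 0" "d \<ge> 0"
    and f: "\<And>t. 0 \<le> t \<Longrightarrow> t < tau2 \<Longrightarrow> f t \<le> C * indicator {a..<a + d} t"
  shows "Inu f \<le> C * d"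
proof -
  have "(\<integral>t. indicator {0..<tau2} t * f t \<partial>lborel) \<le> (\<integral>t. C * indicator {a..<a + d} t \<partial>lborel)"
  proof (rule integral_mono[OF bm_integrable[OF bm]])
    show "integrable lborel (\<lambda>t. C * indicator {a..<a + d} t)"
      using C by (intro integrable_mult_right integrable_real_indicator) auto
    show "indicator {0..<tau2} t * f t \<le> C * indicator {a..<a + d} t" for t
      using f[of t] C by (auto split: split_indicator)
  qed
  also have "\<dots> = C * d" using C by simp
  finally show ?thesis by (simp add: Inu_def z)
qed

text \<open>Since the score has mean zero and the design vectors are independent, both coefficients
  of the mean score vanish. The expected failure counts are thus tied to the expected exposures
  without evaluating either integral.\<close>

lemma score_means:
  assumes x: "x1 \<noteq> x2"
  shows "Inu (\<lambda>t. r1 t * exp (G b t)) = exp (- (b \<bullet> e1)) * Inu (\<lambda>t. X t * exp (G b t))"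
    and "Inu (\<lambda>t. r2 t * exp (G b t)) = exp (- (b \<bullet> e2)) * Inu (\<lambda>t. Y t * exp (G b t))"
proof -
  define c1 c2 where "c1 = exp (- (b \<bullet> e1)) * Inu (\<lambda>t. X t * exp (G b t)) - Inu (\<lambda>t. r1 t * exp (G b t))"
    and "c2 = exp (- (b \<bullet> e2)) * Inu (\<lambda>t. Y t * exp (G b t)) - Inu (\<lambda>t. r2 t * exp (G b t))"
  have "Inu (\<lambda>t. u b t $ i * exp (G b t)) = e1 $ i * c1 + e2 $ i * c2" for i
  proof -
    have "Inu (\<lambda>t. u b t $ i * exp (G b t)) =
      Inu (\<lambda>t. (e1 $ i * (exp (- (b \<bullet> e1)) * (X t * exp (G b t))) - e1 $ i * (r1 t * exp (G b t)))
         + (e2 $ i * (exp (- (b \<bullet> e2)) * (Y t * exp (G b t))) - e2 $ i * (r2 t * exp (G b t))))"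
      by (rule arg_cong[where f=Inu], rule ext) (simp add: u_def algebra_simps)
    also have "\<dots> = (e1 $ i * (exp (- (b \<bullet> e1)) * Inu (\<lambda>t. X t * exp (G b t))) - e1 $ i * Inu (\<lambda>t. r1 t * exp (G b t)))
       + (e2 $ i * (exp (- (b \<bullet> e2)) * Inu (\<lambda>t. Y t * exp (G b t))) - e2 $ i * Inu (\<lambda>t. r2 t * exp (G b t)))"
      by (subst Inu_add, (intro bm_diff bm_mult bm_const bm_exp bm_G bm_X bm_Y bm_r1 bm_r2)+,
          subst Inu_diff, (intro bm_diff bm_mult bm_const bm_exp bm_G bm_X bm_Y bm_r1 bm_r2)+,
          subst Inu_diff, (intro bm_diff bm_mult bm_const bm_exp bm_G bm_X bm_Y bm_r1 bm_r2)+)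
         (simp only: Inu_cmult)
    also have "\<dots> = e1 $ i * c1 + e2 $ i * c2" by (simp add: c1_def c2_def algebra_simps)
    finally show ?thesis .
  qed
  moreover have "Inu (\<lambda>t. u b t $ i * exp (G b t)) = 0" for i
    using xi_0[of b] by (simp add: xi_def vec_eq_iff)
  ultimately have "e1 $ i * c1 + e2 $ i * c2 = 0" for i by simp
  from this[of 1] this[of 2] have a: "c1 + c2 = 0" "x1 * c1 + x2 * c2 = 0" by auto
  then have "(x1 - x2) * c1 = 0" by (simp add: algebra_simps eq_neg_iff_add_eq_0[symmetric])
  then have "c1 = 0" "c2 = 0" using a x by auto
  then show "Inu (\<lambda>t. r1 t * exp (G b t)) = exp (- (b \<bullet> e1)) * Inu (\<lambda>t. X t * exp (G b t))"
    "Inu (\<lambda>t. r2 t * exp (G b t)) = exp (- (b \<bullet> e2)) * Inu (\<lambda>t. Y t * exp (G b t))"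
    by (auto simp: c1_def c2_def)
qed

lemma Inu_pos:
  assumes bm: "bm f" and nn: "\<And>t. 0 \<le> f t" and p: "f tau2 > 0" shows "Inu f > 0"
proof -
  have "Inu f \<noteq> 0" using Inu_zeroD(1)[OF bm nn] p by auto
  then show ?thesis using Inu_nonneg[OF bm nn] by simp
qed

lemma exposure_pos: "Inu (\<lambda>t. X t * exp (G b t)) > 0" "Inu (\<lambda>t. Y t * exp (G b t)) > 0"
proof -
  have "X tau2 > 0" "Y tau2 > 0" using tau1_pos tau12 by (auto simp: X_def Y_def)
  then show "Inu (\<lambda>t. X t * exp (G b t)) > 0" "Inu (\<lambda>t. Y t * exp (G b t)) > 0"
    by (auto intro!: Inu_pos mult_nonneg_nonneg X_bounds(1) Y_bounds(1))
qed

lemma dpd_rates: "\<beta> > 0 \<Longrightarrow> dpd \<beta> b (rates b) = 0"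
proof -
  assume be: "\<beta> > 0"
  have "exp (\<beta> * G b t) * exp (G b t) = exp ((\<beta> + 1) * G b t)" for t
    by (simp add: algebra_simps flip: exp_add)
  moreover have "w (\<beta> + 1) (rates b) = (\<lambda>t. exp ((\<beta> + 1) * G b t))" by (auto simp: w_rates)
  ultimately have "dpd \<beta> b (rates b) = (1 - (\<beta> + 1) / \<beta> + 1 / \<beta>) * Inu (\<lambda>t. exp ((\<beta> + 1) * G b t))"
    by (simp add: dpd_def w_rates algebra_simps)
  also have "1 - (\<beta> + 1) / \<beta> + 1 / \<beta> = 0" using be by (simp add: field_simps)
  finally show ?thesis by simp
qed

lemma bm_indicator: "c \<le> tau2 \<Longrightarrow> bm (\<lambda>t. if a \<le> t \<and> t < c then 1 else 0)" "c \<le> tau2 \<Longrightarrow> bm (\<lambda>t. if t < c then 1 else 0)"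
  unfolding bm_def by (auto intro!: exI[of _ 1])

end

section \<open>Existence with probability tending to one\<close>

context step_stress_sample
begin

lemma LLN_pos:
  assumes bm: "bm f" and p: "Inu (\<lambda>t. f t * exp (G b0 t)) > 0"
  shows "whp (\<lambda>N \<omega>. (\<Sum>i<N. f (T i \<omega>)) > 0)"
proof (rule whp_mono[OF LLN[OF bm p]], intro eventually_mono[OF eventually_gt_at_top[of 0]] ballI impI)
  fix N :: nat and \<omega> assume N: "N > 0" and a: "\<bar>avg f N \<omega> - Inu (\<lambda>t. f t * exp (G b0 t))\<bar> < Inu (\<lambda>t. f t * exp (G b0 t))"
  then have "avg f N \<omega> > 0" by linarith
  then show "(\<Sum>i<N. f (T i \<omega>)) > 0" using N by (simp add: avg_def zero_less_divide_iff)
qed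

lemma mle_exists_whp:
  assumes x: "x1 \<noteq> x2" and b0: "b0 $ 2 < 0"
  shows "whp (\<lambda>N \<omega>. \<exists>b. is_mdpde 0 x1 x2 tau1 tau2 N (\<lambda>i. T i \<omega>) b)"
proof -
  define c1 c2 where "c1 = exp (- (b0 \<bullet> e1))" and "c2 = exp (- (b0 \<bullet> e2))"
  have c: "c1 > 0" "c2 > 0" by (auto simp: c1_def c2_def)
  have cone: "0 < (x2 - x1) * (c2 - c1)" using rates_cone[OF x, of b0] b0 by (simp add: rates_def c1_def c2_def)
  \<comment> \<open>A third of the gap, so that intervals of radius \<open>r\<close> around the two
    true rates stay disjoint and in the right order.\<close>
  define r where "r = \<bar>c2 - c1\<bar> / 3"
  have r: "r > 0" using cone by (auto simp: r_def)
  define mX mY where "mX = Inu (\<lambda>t. X t * exp (G b0 t))" and "mY = Inu (\<lambda>t. Y t * exp (G b0 t))"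
  have E: "mX > 0" "mY > 0" unfolding mX_def mY_def by (rule exposure_pos)+
  note sm = score_means[OF x, of b0, folded c1_def c2_def mX_def mY_def]
  have lin: "Inu (\<lambda>t. (p * f t + q * g t) * exp (G b0 t)) = p * Inu (\<lambda>t. f t * exp (G b0 t)) + q * Inu (\<lambda>t. g t * exp (G b0 t))"
    if "bm f" "bm g" for p q f g
  proof -
    have "Inu (\<lambda>t. (p * f t + q * g t) * exp (G b0 t)) = Inu (\<lambda>t. p * (f t * exp (G b0 t)) + q * (g t * exp (G b0 t)))"
      by (simp add: algebra_simps)
    also have "\<dots> = p * Inu (\<lambda>t. f t * exp (G b0 t)) + q * Inu (\<lambda>t. g t * exp (G b0 t))"
      by (subst Inu_add, (intro bm_mult bm_const bm_exp bm_G that)+) (simp only: Inu_cmult)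
    finally show ?thesis .
  qed
  \<comment> \<open>The ratio \<open>n1 / S1\<close> is within \<open>r\<close> of \<open>c1\<close>
    exactly when two linear combinations of failure count and exposure are positive, provided
    \<open>S1 > 0\<close>. Their means are \<open>r * mX\<close>, and \<open>r * mY\<close> in the
    second phase, so quotients need no limit theorem of their own.\<close>
  have M: "Inu (\<lambda>t. (1 * r1 t + (- (c1 - r)) * X t) * exp (G b0 t)) = r * mX"
    "Inu (\<lambda>t. ((-1) * r1 t + (c1 + r) * X t) * exp (G b0 t)) = r * mX"
    "Inu (\<lambda>t. (1 * r2 t + (- (c2 - r)) * Y t) * exp (G b0 t)) = r * mY"
    "Inu (\<lambda>t. ((-1) * r2 t + (c2 + r) * Y t) * exp (G b0 t)) = r * mY"
    unfolding lin[OF bm_r1 bm_X] lin[OF bm_r2 bm_Y] sm mX_def[symmetric] mY_def[symmetric]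
    by (simp_all add: algebra_simps)
  have rm: "0 < r * mX" "0 < r * mY" using r E by auto
  have bl: "bm (\<lambda>t. p * f t + q * g t)" if "bm f" "bm g" for p q f g using that by auto
  have L1: "whp (\<lambda>N \<omega>. (\<Sum>i<N. 1 * r1 (T i \<omega>) + (- (c1 - r)) * X (T i \<omega>)) > 0)"
    by (rule LLN_pos[where f="\<lambda>t. 1 * r1 t + (- (c1 - r)) * X t", OF bl[OF bm_r1 bm_X]]) (simp only: M rm)
  have L2: "whp (\<lambda>N \<omega>. (\<Sum>i<N. (-1) * r1 (T i \<omega>) + (c1 + r) * X (T i \<omega>)) > 0)"
    by (rule LLN_pos[where f="\<lambda>t. (-1) * r1 t + (c1 + r) * X t", OF bl[OF bm_r1 bm_X]]) (simp only: M rm)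
  have L3: "whp (\<lambda>N \<omega>. (\<Sum>i<N. 1 * r2 (T i \<omega>) + (- (c2 - r)) * Y (T i \<omega>)) > 0)"
    by (rule LLN_pos[where f="\<lambda>t. 1 * r2 t + (- (c2 - r)) * Y t", OF bl[OF bm_r2 bm_Y]]) (simp only: M rm)
  have L4: "whp (\<lambda>N \<omega>. (\<Sum>i<N. (-1) * r2 (T i \<omega>) + (c2 + r) * Y (T i \<omega>)) > 0)"
    by (rule LLN_pos[where f="\<lambda>t. (-1) * r2 t + (c2 + r) * Y t", OF bl[OF bm_r2 bm_Y]]) (simp only: M rm)
  have L5: "whp (\<lambda>N \<omega>. (\<Sum>i<N. r1 (T i \<omega>)) > 0)" by (rule LLN_pos) (use sm c E in auto)
  have L6: "whp (\<lambda>N \<omega>. (\<Sum>i<N. r2 (T i \<omega>)) > 0)" by (rule LLN_pos) (use sm c E in auto)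
  have L7: "whp (\<lambda>N \<omega>. \<forall>i. T i \<omega> > 0 \<and> T i \<omega> \<noteq> tau1)" by (rule whp_AE) (use T_AE in simp)
  show ?thesis
  proof (rule whp_mono[OF whp_conj[OF L1 whp_conj[OF L2 whp_conj[OF L3 whp_conj[OF L4 whp_conj[OF L5 whp_conj[OF L6 L7]]]]]]],
      intro always_eventually allI ballI impI, elim conjE)
    fix N \<omega>
    define n1 n2 S1 S2 where "n1 = (\<Sum>i<N. r1 (T i \<omega>))" and "n2 = (\<Sum>i<N. r2 (T i \<omega>))"
      and "S1 = (\<Sum>i<N. X (T i \<omega>))" and "S2 = (\<Sum>i<N. Y (T i \<omega>))"
    note defs = n1_def[symmetric] n2_def[symmetric] S1_def[symmetric] S2_def[symmetric]
    assume "0 < (\<Sum>i<N. 1 * r1 (T i \<omega>) + (- (c1 - r)) * X (T i \<omega>))"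
      "0 < (\<Sum>i<N. (-1) * r1 (T i \<omega>) + (c1 + r) * X (T i \<omega>))"
      "0 < (\<Sum>i<N. 1 * r2 (T i \<omega>) + (- (c2 - r)) * Y (T i \<omega>))"
      "0 < (\<Sum>i<N. (-1) * r2 (T i \<omega>) + (c2 + r) * Y (T i \<omega>))"
    then have a: "0 < n1 + (- (c1 - r)) * S1" "0 < - n1 + (c1 + r) * S1" "0 < n2 + (- (c2 - r)) * S2" "0 < - n2 + (c2 + r) * S2"
      unfolding sum.distrib sum_distrib_left[symmetric] defs by simp_all
    assume n: "0 < (\<Sum>i<N. r1 (T i \<omega>))" "0 < (\<Sum>i<N. r2 (T i \<omega>))"
    assume t: "\<forall>i. T i \<omega> > 0 \<and> T i \<omega> \<noteq> tau1"
    \<comment> \<open>Adding the two inequalities of a phase cancels the failure count, so positive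
      total exposure is a by-product.\<close>
    have "0 < (2 * r) * S1" "0 < (2 * r) * S2" using a by (simp_all add: algebra_simps)
    then have S: "S1 > 0" "S2 > 0" using r by (simp_all add: zero_less_mult_iff)
    have "c1 - r < n1 / S1" "n1 / S1 < c1 + r" "c2 - r < n2 / S2" "n2 / S2 < c2 + r"
      using a S by (simp_all add: field_simps)
    define p1 p2 where "p1 = n1 / S1" and "p2 = n2 / S2"
    from \<open>c1 - r < n1 / S1\<close> \<open>n1 / S1 < c1 + r\<close> \<open>c2 - r < n2 / S2\<close> \<open>n2 / S2 < c2 + r\<close>
    have near: "p1 < c1 + r" "p2 < c2 + r" "c1 - r < p1" "c2 - r < p2" by (simp_all add: p1_def p2_def)
    from cone consider "c1 < c2" "x1 < x2" | "c2 < c1" "x2 < x1" by (auto simp: zero_less_mult_iff)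
    then have "0 < (x2 - x1) * (n2 / S2 - n1 / S1)"
    proof cases
      case 1
      then have "3 * r = c2 - c1" by (simp add: r_def)
      then have "p2 - p1 > 0" using near 1 r by linarith
      then show ?thesis using 1 by (simp add: p1_def p2_def)
    next
      case 2
      then have "3 * r = c1 - c2" by (simp add: r_def)
      then have "p2 - p1 < 0" using near 2 r by linarith
      then show ?thesis using 2 by (intro mult_neg_neg) (simp_all add: p1_def p2_def)
    qed
    then show "\<exists>b. is_mdpde 0 x1 x2 tau1 tau2 N (\<lambda>i. T i \<omega>) b"
      using n S t unfolding n1_def n2_def S1_def S2_def by (intro exists_mle x) (auto intro: less_imp_le)
  qed
qed

text \<open>A finite net of rates suffices: the modulus of \<open>w_equicontinuous\<close> is the
  same for every observation, so moving to the nearest net point costs \<open>e / 3\<close> in the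
  empirical mean and \<open>e / 3\<close> in the expectation.\<close>

lemma uniform_LLN:
  assumes be: "\<beta> > 0" and e: "e > 0"
  shows "whp (\<lambda>N \<omega>. \<forall>m\<in>{0..R} \<times> {0..R}. \<bar>avg (w \<beta> m) N \<omega> - Inu (\<lambda>t. w \<beta> m t * exp (G b0 t))\<bar> < e)"
proof -
  have e3: "e / 3 > 0" using e by simp
  obtain d where d: "d > 0" "\<And>m m' t. m \<in> {0..R} \<times> {0..R} \<Longrightarrow> m' \<in> {0..R} \<times> {0..R} \<Longrightarrow> dist m m' < d \<Longrightarrow>
    \<bar>w \<beta> m t - w \<beta> m' t\<bar> < e / 3" by (rule w_equicontinuous[OF be e3, where R=R]) blast
  have "compact ({0..R} \<times> {0..R} :: (real \<times> real) set)" by (intro compact_Times compact_Icc)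
  then obtain k where k: "finite k" "k \<subseteq> {0..R} \<times> {0..R}" "{0..R} \<times> {0..R} \<subseteq> (\<Union>m\<in>k. ball m d)"
  proof (rule compactE_image[of _ "{0..R} \<times> {0..R}" "\<lambda>m. ball m d"])
    show "{0..R} \<times> {0..R} \<subseteq> (\<Union>m\<in>{0..R} \<times> {0..R}. ball m d)" using d(1) by force
  qed auto
  have "whp (\<lambda>N \<omega>. \<forall>m\<in>k. \<bar>avg (w \<beta> m) N \<omega> - Inu (\<lambda>t. w \<beta> m t * exp (G b0 t))\<bar> < e / 3)"
    using k(1) by (rule whp_finite) (intro LLN bm_w e3)
  then show ?thesis
  proof (rule whp_mono, intro eventually_mono[OF eventually_gt_at_top[of 0]] ballI impI)
    fix N :: nat and \<omega> and m :: "real \<times> real"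
    assume N: "N > 0" and a: "\<forall>m\<in>k. \<bar>avg (w \<beta> m) N \<omega> - Inu (\<lambda>t. w \<beta> m t * exp (G b0 t))\<bar> < e / 3"
      and m: "m \<in> {0..R} \<times> {0..R}"
    from m k(3) obtain m' where m': "m' \<in> k" "dist m' m < d" by auto
    have D: "\<bar>w \<beta> m' t - w \<beta> m t\<bar> \<le> e / 3" for t using d(2)[of m' m t] m' m k(2) by auto
    have "\<bar>avg (w \<beta> m') N \<omega> - avg (w \<beta> m) N \<omega>\<bar> = \<bar>\<Sum>i<N. w \<beta> m' (T i \<omega>) - w \<beta> m (T i \<omega>)\<bar> / N"
      by (simp add: avg_def sum_subtractf abs_divide flip: diff_divide_distrib)
    also have "\<dots> \<le> (\<Sum>i<N. e / 3) / N"
      by (intro divide_right_mono order_trans[OF sum_abs sum_mono] D) auto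
    also have "\<dots> = e / 3" using N by simp
    finally have 1: "\<bar>avg (w \<beta> m') N \<omega> - avg (w \<beta> m) N \<omega>\<bar> \<le> e / 3" .
    have le: "Inu (\<lambda>t. w \<beta> p t * exp (G b0 t)) - Inu (\<lambda>t. w \<beta> q t * exp (G b0 t)) \<le> e / 3"
      if "\<And>t. w \<beta> p t - w \<beta> q t \<le> e / 3" for p q
    proof -
      have "Inu (\<lambda>t. w \<beta> p t * exp (G b0 t)) - Inu (\<lambda>t. w \<beta> q t * exp (G b0 t)) = Inu (\<lambda>t. w \<beta> p t * exp (G b0 t) - w \<beta> q t * exp (G b0 t))"
        by (subst Inu_diff) auto
      also have "\<dots> \<le> Inu (\<lambda>t. e / 3 * exp (G b0 t))"
        unfolding left_diff_distrib[symmetric] by (intro Inu_mono mult_right_mono that bm_mult bm_diff bm_const bm_exp bm_G bm_w exp_ge_zero)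
      also have "\<dots> = e / 3" by (subst Inu_cmult) (simp add: Inu_dens_1)
      finally show ?thesis .
    qed
    have "w \<beta> m' t - w \<beta> m t \<le> e / 3" "w \<beta> m t - w \<beta> m' t \<le> e / 3" for t using D[of t] by linarith+
    note le2 = le[OF this(1)] le[OF this(2)]
    have "\<bar>avg (w \<beta> m') N \<omega> - Inu (\<lambda>t. w \<beta> m' t * exp (G b0 t))\<bar> < e / 3" using a m'(1) by blast
    then show "\<bar>avg (w \<beta> m) N \<omega> - Inu (\<lambda>t. w \<beta> m t * exp (G b0 t))\<bar> < e" using le2 1 by (simp only: abs_less_iff abs_le_iff) linarith
  qed
qed

lemma H_avg: "N > 0 \<Longrightarrow> H \<beta> N (\<lambda>i. T i \<omega>) m = Inu (w (\<beta> + 1) m) - (\<beta> + 1) / \<beta> * avg (w \<beta> m) N \<omega>"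
  by (simp add: H_def avg_def)

lemma degenerate_whp:
  assumes x: "x1 \<noteq> x2" and b0: "b0 $ 2 < 0" and be: "\<beta> > 0"
  shows "whp (\<lambda>N \<omega>. \<forall>m1 m2. m1 \<ge> 0 \<longrightarrow> m2 \<ge> 0 \<longrightarrow> degenerate (m1, m2) \<longrightarrow>
    H \<beta> N (\<lambda>i. T i \<omega>) (rates b0) < H \<beta> N (\<lambda>i. T i \<omega>) (m1, m2))"
proof -
  define k where "k = (\<beta> + 1) / \<beta>"
  have k: "k > 0" using be by (simp add: k_def)
  define E where "E m = Inu (\<lambda>t. w \<beta> m t * exp (G b0 t))" for m
  \<comment> \<open>An upper bound for the loss at the truth as soon as the average of
    \<open>w \<beta> (rates b0)\<close> deviates by less than 1 from its mean.\<close>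
  define K where "K = Inu (w (\<beta> + 1) (rates b0)) - k * E (rates b0) + k"
  \<comment> \<open>Half of the largest window share that \<open>H_degenerate_coercive\<close>
    tolerates.\<close>
  define q where "q = 1 / (2 * k * (\<beta> + 1))"
  have q: "q > 0" "(\<beta> + 1) / \<beta> * q < 1 / (\<beta> + 1)"
  proof -
    show "q > 0" using k be unfolding q_def by (intro divide_pos_pos mult_pos_pos) auto
    have "k * q = 1 / (2 * (\<beta> + 1))" using k by (simp add: q_def)
    also have "\<dots> < 1 / (\<beta> + 1)" using be by (intro divide_strict_left_mono) auto
    finally show "(\<beta> + 1) / \<beta> * q < 1 / (\<beta> + 1)" by (simp only: k_def)
  qed
  obtain C where C: "C \<ge> 1" "\<And>t. \<bar>exp (G b0 t)\<bar> \<le> C" using bm_bound[OF bm_exp[OF bm_G]] by metis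
  \<comment> \<open>As the density is at most \<open>C\<close>, a window of length \<open>d\<close>
    has probability below \<open>q / 2\<close>, which leaves \<open>q / 2\<close> for the empirical
    deviation. The second bound keeps the two windows inside their phases.\<close>
  define d where "d = min (q / (4 * C)) (min tau1 (tau2 - tau1) / 2)"
  have d: "d > 0" "d < tau1" "tau1 + d < tau2" "C * d < q / 2"
  proof -
    show "d > 0" using q C tau1_pos tau12 by (auto simp: d_def)
    define z where "z = min tau1 (tau2 - tau1)"
    have "d \<le> z / 2" unfolding d_def z_def by (rule min.cobounded2)
    moreover have "z \<le> tau1" "z \<le> tau2 - tau1" by (auto simp: z_def)
    ultimately have "d \<le> tau1 / 2" "d \<le> (tau2 - tau1) / 2" by simp_all
    then show "d < tau1" "tau1 + d < tau2" using tau1_pos tau12 by (simp_all add: field_simps)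
    have "C * d \<le> C * (q / (4 * C))" using C by (intro mult_left_mono) (auto simp: d_def)
    also have "\<dots> < q / 2" using C q by simp
    finally show "C * d < q / 2" .
  qed
  define g1 g2 where "g1 t = (if t < d then 1 else 0 :: real)" and "g2 t = (if tau1 \<le> t \<and> t < tau1 + d then 1 else 0 :: real)" for t
  have bg: "bm g1" "bm g2" unfolding g1_def[abs_def] g2_def[abs_def] using d tau12 by (auto intro: bm_indicator)
  have "Inu (\<lambda>t. g1 t * exp (G b0 t)) \<le> C * d"
    by (rule Inu_small[where a=0, OF bm_mult[OF bg(1) bm_exp[OF bm_G]]]) (use bg d C tau12 abs_le_D1[OF C(2)] in \<open>auto simp: g1_def split: split_indicator\<close>)
  then have I1: "Inu (\<lambda>t. g1 t * exp (G b0 t)) < q / 2" using d(4) by simp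
  have "Inu (\<lambda>t. g2 t * exp (G b0 t)) \<le> C * d"
    by (rule Inu_small[where a=tau1, OF bm_mult[OF bg(2) bm_exp[OF bm_G]]]) (use bg d C tau12 abs_le_D1[OF C(2)] in \<open>auto simp: g2_def split: split_indicator\<close>)
  then have I2: "Inu (\<lambda>t. g2 t * exp (G b0 t)) < q / 2" using d(4) by simp
  obtain R0 where R0: "\<And>N s m1 m2. N > 0 \<Longrightarrow> m1 \<ge> 0 \<Longrightarrow> m2 \<ge> 0 \<Longrightarrow> degenerate (m1, m2) \<Longrightarrow> m1 > R0 \<or> m2 > R0 \<Longrightarrow>
     (\<Sum>i<N. if s i < d then 1 else 0) / real N \<le> q \<Longrightarrow>
     (\<Sum>i<N. if tau1 \<le> s i \<and> s i < tau1 + d then 1 else 0) / real N \<le> q \<Longrightarrow> H \<beta> N s (m1, m2) > K"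
  proof (rule H_degenerate_coercive[OF be q(2) d(1), where K=K])
    fix R0 assume "\<And>N s m1 m2. N > 0 \<Longrightarrow> m1 \<ge> 0 \<Longrightarrow> m2 \<ge> 0 \<Longrightarrow> degenerate (m1, m2) \<Longrightarrow> m1 > R0 \<or> m2 > R0 \<Longrightarrow>
     (\<Sum>i<N. if s i < d then 1 else 0) / real N \<le> q \<Longrightarrow>
     (\<Sum>i<N. if tau1 \<le> s i \<and> s i < tau1 + d then 1 else 0) / real N \<le> q \<Longrightarrow> H \<beta> N s (m1, m2) > K"
    then show thesis by (rule that)
  qed
  define R where "R = max R0 (max (fst (rates b0)) (snd (rates b0)))"
  have m0: "rates b0 \<in> {0..R} \<times> {0..R}" by (auto simp: rates_def R_def)
  define Cc where "Cc = ({0..R} \<times> {0..R}) \<inter> ({m. fst m = 0} \<union> ({m. snd m = 0} \<union> {m. fst m = (snd m :: real)}))"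
  have "compact Cc" unfolding Cc_def
    by (intro compact_Int_closed compact_Times compact_Icc closed_Un closed_Collect_eq continuous_intros)
  moreover have "(0, 0) \<in> Cc" using m0 by (auto simp: Cc_def)
  moreover have "continuous_on Cc (dpd \<beta> b0)"
  proof (rule continuous_on_subset)
    have "continuous_on ({0..R} \<times> {0..R}) (\<lambda>m. Inu (w (\<beta> + 1) m))"
      using continuous_Inu_w[of "\<beta> + 1" "\<lambda>_. 1" R] be by simp
    moreover have "continuous_on ({0..R} \<times> {0..R}) (\<lambda>m. Inu (\<lambda>t. w \<beta> m t * exp (G b0 t)))"
      using continuous_Inu_w[of \<beta> "\<lambda>t. exp (G b0 t)" R] be by auto
    ultimately show "continuous_on ({0..R} \<times> {0..R}) (dpd \<beta> b0)"
      unfolding dpd_def[abs_def] by (intro continuous_intros)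
  qed (auto simp: Cc_def)
  ultimately obtain m' where m': "m' \<in> Cc" "\<And>m. m \<in> Cc \<Longrightarrow> dpd \<beta> b0 m' \<le> dpd \<beta> b0 m"
    using continuous_attains_inf[of Cc "dpd \<beta> b0"] by blast
  \<comment> \<open>The smallest divergence on the compact part of the degenerate set. It is
    positive because the rates of the true parameter are not degenerate.\<close>
  define e where "e = dpd \<beta> b0 m'"
  have Cdeg: "m \<in> Cc \<longleftrightarrow> m \<in> {0..R} \<times> {0..R} \<and> degenerate m" for m by (auto simp: Cc_def degenerate_def)
  have e: "e > 0"
  proof -
    have "m' \<noteq> rates b0" using m'(1) rates_not_degenerate[OF x b0] by (auto simp: Cdeg)
    then show ?thesis unfolding e_def using m'(1) by (cases m') (auto simp: Cdeg intro!: dpd_pos be)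
  qed
  have dH: "dpd \<beta> b0 m - dpd \<beta> b0 (rates b0) = (Inu (w (\<beta> + 1) m) - k * E m) - (Inu (w (\<beta> + 1) (rates b0)) - k * E (rates b0))" for m
    by (simp add: dpd_def k_def E_def)
  \<comment> \<open>The bound 1 serves the estimate by \<open>K\<close>. The bound
    \<open>e / (2 * k)\<close> leaves an error below \<open>e / 2\<close> at each of the two rate
    pairs compared, less than \<open>e\<close> in total.\<close>
  have U: "whp (\<lambda>N \<omega>. \<forall>m\<in>{0..R} \<times> {0..R}. \<bar>avg (w \<beta> m) N \<omega> - E m\<bar> < min 1 (e / (2 * k)))"
    unfolding E_def by (rule uniform_LLN) (use be e k in auto)
  have W1: "whp (\<lambda>N \<omega>. \<bar>avg g1 N \<omega> - Inu (\<lambda>t. g1 t * exp (G b0 t))\<bar> < q / 2)" by (rule LLN) (use bg q in auto)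
  have W2: "whp (\<lambda>N \<omega>. \<bar>avg g2 N \<omega> - Inu (\<lambda>t. g2 t * exp (G b0 t))\<bar> < q / 2)" by (rule LLN) (use bg q in auto)
  show ?thesis
  proof (rule whp_mono[OF whp_conj[OF U whp_conj[OF W1 W2]]],
      intro eventually_mono[OF eventually_gt_at_top[of 0]] ballI impI allI, elim conjE)
    fix N :: nat and \<omega> and m1 m2 :: real
    assume N: "N > 0" and u: "\<forall>m\<in>{0..R} \<times> {0..R}. \<bar>avg (w \<beta> m) N \<omega> - E m\<bar> < min 1 (e / (2 * k))"
      and w1: "\<bar>avg g1 N \<omega> - Inu (\<lambda>t. g1 t * exp (G b0 t))\<bar> < q / 2"
      and w2: "\<bar>avg g2 N \<omega> - Inu (\<lambda>t. g2 t * exp (G b0 t))\<bar> < q / 2"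
      and m: "m1 \<ge> 0" "m2 \<ge> 0" and deg: "degenerate (m1, m2)"
    have u': "k * \<bar>avg (w \<beta> m) N \<omega> - E m\<bar> < k" "k * \<bar>avg (w \<beta> m) N \<omega> - E m\<bar> < e / 2" if "m \<in> {0..R} \<times> {0..R}" for m
    proof -
      have "\<bar>avg (w \<beta> m) N \<omega> - E m\<bar> < 1" "\<bar>avg (w \<beta> m) N \<omega> - E m\<bar> < e / (2 * k)" using u that by auto
      then show "k * \<bar>avg (w \<beta> m) N \<omega> - E m\<bar> < k" "k * \<bar>avg (w \<beta> m) N \<omega> - E m\<bar> < e / 2"
        using k by (auto simp: field_simps)
    qed
    have u'': "\<bar>k * avg (w \<beta> m) N \<omega> - k * E m\<bar> < k" "\<bar>k * avg (w \<beta> m) N \<omega> - k * E m\<bar> < e / 2" if "m \<in> {0..R} \<times> {0..R}" for m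
    proof -
      have "\<bar>k * avg (w \<beta> m) N \<omega> - k * E m\<bar> = k * \<bar>avg (w \<beta> m) N \<omega> - E m\<bar>"
        unfolding right_diff_distrib[symmetric] abs_mult using k by simp
      then show "\<bar>k * avg (w \<beta> m) N \<omega> - k * E m\<bar> < k" "\<bar>k * avg (w \<beta> m) N \<omega> - k * E m\<bar> < e / 2" using u'[OF that] by simp_all
    qed
    show "H \<beta> N (\<lambda>i. T i \<omega>) (rates b0) < H \<beta> N (\<lambda>i. T i \<omega>) (m1, m2)"
    proof (cases "(m1, m2) \<in> {0..R} \<times> {0..R}")
      case True
      then have "(m1, m2) \<in> Cc" using deg by (simp add: Cdeg)
      then have "dpd \<beta> b0 (m1, m2) \<ge> e" using m'(2) by (simp add: e_def)
      then have "(Inu (w (\<beta> + 1) (m1, m2)) - k * E (m1, m2)) - (Inu (w (\<beta> + 1) (rates b0)) - k * E (rates b0)) \<ge> e"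
        using dH[of "(m1, m2)"] dpd_rates[OF be, of b0] by linarith
      then show ?thesis
        unfolding H_avg[OF N] k_def[symmetric] using u''(2)[OF True] u''(2)[OF m0] by linarith
    next
      case False
      then have big: "m1 > R0 \<or> m2 > R0" using m by (auto simp: R_def)
      have "avg g1 N \<omega> \<le> q" "avg g2 N \<omega> \<le> q" using w1 w2 I1 I2 by linarith+
      then have "K < H \<beta> N (\<lambda>i. T i \<omega>) (m1, m2)"
        unfolding avg_def g1_def g2_def by (intro R0[OF N m deg big])
      moreover have "H \<beta> N (\<lambda>i. T i \<omega>) (rates b0) \<le> K"
        unfolding H_avg[OF N] k_def[symmetric] K_def using u''(1)[OF m0] by linarith
      ultimately show ?thesis by linarith
    qed
  qed
qed

lemma mdpde_exists_whp:
  assumes x: "x1 \<noteq> x2" and b0: "b0 $ 2 < 0" and be: "\<beta> \<ge> 0"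
  shows "whp (\<lambda>N \<omega>. \<exists>b. is_mdpde \<beta> x1 x2 tau1 tau2 N (\<lambda>i. T i \<omega>) b)"
proof (cases "\<beta> = 0")
  case True
  then show ?thesis using mle_exists_whp[OF x b0] by simp
next
  case False
  with be have be: "\<beta> > 0" by simp
  have t: "whp (\<lambda>N \<omega>. \<forall>i. T i \<omega> > 0 \<and> T i \<omega> \<noteq> tau1)" by (rule whp_AE) (use T_AE in simp)
  show ?thesis
  proof (rule whp_mono[OF whp_conj[OF degenerate_whp[OF x b0 be] t]],
      intro eventually_mono[OF eventually_gt_at_top[of 0]] ballI impI, elim conjE)
    fix N :: nat and \<omega>
    assume "N > 0" "\<forall>m1 m2. m1 \<ge> 0 \<longrightarrow> m2 \<ge> 0 \<longrightarrow> degenerate (m1, m2) \<longrightarrow>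
      H \<beta> N (\<lambda>i. T i \<omega>) (rates b0) < H \<beta> N (\<lambda>i. T i \<omega>) (m1, m2)" "\<forall>i. T i \<omega> > 0 \<and> T i \<omega> \<noteq> tau1"
    then show "\<exists>b. is_mdpde \<beta> x1 x2 tau1 tau2 N (\<lambda>i. T i \<omega>) b"
      by (intro exists_mdpde_pos[OF x be _ _ b0]) auto
  qed
qed

lemma foc_whp:
  assumes x: "x1 \<noteq> x2" and b0: "b0 $ 2 < 0" and be: "\<beta> \<ge> 0"
    and md: "\<And>N \<omega>. \<omega> \<in> space M \<Longrightarrow> (\<exists>b. is_mdpde \<beta> x1 x2 tau1 tau2 N (\<lambda>i. T i \<omega>) b) \<Longrightarrow>
       is_mdpde \<beta> x1 x2 tau1 tau2 N (\<lambda>i. T i \<omega>) (ahat N \<omega>)"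
  shows "whp (\<lambda>N \<omega>. \<forall>i. (\<Sum>j<N. psi \<beta> (ahat N \<omega>) (T j \<omega>) $ i) = 0)"
proof -
  have t: "whp (\<lambda>N \<omega>. \<forall>i. T i \<omega> > 0 \<and> T i \<omega> \<noteq> tau1)" by (rule whp_AE) (use T_AE in simp)
  show ?thesis
  proof (rule whp_mono[OF whp_conj[OF mdpde_exists_whp[OF x b0 be] t]],
      intro eventually_mono[OF eventually_gt_at_top[of 0]] ballI impI allI, elim conjE)
    fix N :: nat and \<omega> and i
    assume w: "\<omega> \<in> space M" and N: "N > 0" and ex: "\<exists>b. is_mdpde \<beta> x1 x2 tau1 tau2 N (\<lambda>i. T i \<omega>) b"
      and t: "\<forall>i. T i \<omega> > 0 \<and> T i \<omega> \<noteq> tau1"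
    show "(\<Sum>j<N. psi \<beta> (ahat N \<omega>) (T j \<omega>) $ i) = 0"
      by (rule mdpde_foc[OF N _ be md[OF w ex]]) (use t in \<open>auto intro: less_imp_le\<close>)
  qed
qed

end

theorem theorem6:
  fixes M :: "'a measure"
    and T :: "nat \<Rightarrow> 'a \<Rightarrow> real"
    and ahat :: "nat \<Rightarrow> 'a \<Rightarrow> real^2"
    and x1 x2 tau1 tau2 a0 a1 beta :: real
  assumes "prob_space M"
    and "0 < tau1" and "tau1 < tau2"
    and "x1 \<noteq> x2"
    and "a1 < 0"
    and "0 \<le> beta"
    and "prob_space.indep_vars M (\<lambda>_. borel) T UNIV"
    and "\<And>i. distributed M lborel (T i) (\<lambda>t. ennreal (life_dens x1 x2 tau1 a0 a1 t))"
    and "\<And>N. ahat N \<in> borel_measurable M"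
    and "\<And>N \<omega>. \<omega> \<in> space M \<Longrightarrow> (\<exists>b. is_mdpde beta x1 x2 tau1 tau2 N (\<lambda>i. T i \<omega>) b) \<Longrightarrow>
           is_mdpde beta x1 x2 tau1 tau2 N (\<lambda>i. T i \<omega>) (ahat N \<omega>)"
    and "conv_in_prob M ahat (vector [a0, a1])"
  shows "conv_in_law M (\<lambda>N \<omega>. sqrt (real N) *\<^sub>R (ahat N \<omega> - vector [a0, a1]))
           (normal2 (Sigma_mdpde x1 x2 tau1 tau2 a0 a1 beta))"
proof -
  interpret prob_space M by fact
  interpret step_stress_sample x1 x2 tau1 tau2 M T "vector [a0, a1]"
    by unfold_locales (use assms in auto)
  have "whp (\<lambda>N \<omega>. \<forall>i. (\<Sum>j<N. psi beta (ahat N \<omega>) (T j \<omega>) $ i) = 0)"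
    by (rule foc_whp) (use assms in auto)
  from asymptotic_normality[OF assms(4,6,11,9) this]
  show ?thesis
    unfolding Sigma_mdpde_def Jm_eq_Jmat[OF assms(6)] Km_eq_Kmat[OF assms(6)] .
qed

end
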